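(* Let $G_1$ be the simply connected solvable Lie group of dimension $7$ whose Lie algebra is defined, in terms of a basis $e^1,\dots,e^7$ of left invariant $1$-forms, by $$\begin{aligned} de^1&=0,\\ de^2&=\tfrac12e^{15}-e^{34}+\tfrac12e^{46},\\ de^3&=\tfrac12e^{16}+e^{24}-\tfrac12e^{45},\\ de^4&=-2e^{14},\\ de^5&=2(e^{12}+e^{34})-e^{46},\\ de^6&=2(e^{13}+e^{42})+e^{45},\\ de^7&=2(e^{14}+e^{23})-\tfrac12e^{56}, \end{aligned}$$ and let $e_1,\dots,e_7$ be the dual basis of left invariant vector fields. Equip $G_1$ with the left invariant integrable qc structure given by $\eta_1=e^5$, $\eta_2=e^6$, $\eta_3=e^7$, $\xi_1=e_5$, $\xi_2=e_6$, $\xi_3=e_7$, $H=\mathrm{Span}\{e_1,\dots,e_4\}$ (with metric $g$ on $H$ for which $e_1,\dots,e_4$ are orthonormal), $\omega_1=e^{12}+e^{34}$, $\omega_2=e^{13}+e^{42}$, $\omega_3=e^{14}+e^{23}$. Then the torsion endomorphism of the Biquard connection is non-zero, the fundamental $4$-form $\Omega$ is closed, and the normalized qc scalar curvature is $S=-\frac12$.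
   Context: Notation: $e^{ij}=e^i\wedge e^j$. A quaternionic contact (qc) structure on a $7$-dimensional manifold $M$ consists of a rank $4$ distribution $H\subset TM$ with a metric $g$ such that: (i) $H$ is locally the common kernel of three $1$-forms $\eta_1,\eta_2,\eta_3$; (ii) $H$ carries a rank-three bundle $\mathbb{Q}$ of endomorphisms locally generated by almost complex structures $I_1,I_2,I_3$ with $I_1I_2=-I_2I_1=I_3$, $I_1I_2I_3=-\mathrm{id}_{|H}$, $g(I_r\cdot,I_r\cdot)=g(\cdot,\cdot)$; (iii) $2g(I_rX,Y)=d\eta_r(X,Y)$ for $X,Y\in H$. Put $\omega_r(X,Y)=g(I_rX,Y)$ on $H$, so $2\omega_r=d\eta_r{}_{|H}$. The structure is integrable if there are (local) vector fields $\xi_1,\xi_2,\xi_3$ with $\eta_s(\xi_k)=\delta_{sk}$, $(\xi_s\lrcorner d\eta_s)_{|H}=0$, $(\xi_s\lrcorner d\eta_k)_{|H}=-(\xi_k\lrcorner d\eta_s)_{|H}$. Then $V=\mathrm{Span}\{\xi_1,\xi_2,\xi_3\}$, $TM=H\oplus V$, and $g$ is extended to $TM$ by $V\perp H$, $g(\xi_r,\xi_k)=\delta_{rk}$. Biquard connection: the unique linear connection $\nabla$ on $M$, with torsion $T$, such that (i) $\nabla$ preserves $TM=H\oplus V$, $\nabla g=0$ and $\nabla\sigma\in\Gamma(\mathbb{Q})$ for $\sigma\in\Gamma(\mathbb{Q})$; (ii) $T(X,Y)=-[X,Y]_{|V}$ for $X,Y\in H$; (iii) for $\xi\in V$, $T(\xi,\cdot)_{|H}$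 lies in $(sp(1)\oplus sp(1))^{\perp}\subset gl(4)$, where one $sp(1)$ is spanned by $I_1,I_2,I_3$, the other consists of the $g$-skew endomorphisms of $H$ commuting with $I_1,I_2,I_3$, and $\perp$ is with respect to $\langle A,B\rangle=\sum_i g(Ae_i,Be_i)$ for an orthonormal basis of $H$; (iv) $\nabla\varphi=0$ for the natural identification $\varphi:V\to\mathbb{Q}$, $\xi_r\mapsto I_r$. The torsion endomorphism is $T_\xi=T(\xi,\cdot)_{|H}:H\to H$, $\xi\in V$; it is non-zero if $T_\xi\ne0$ for some $\xi\in V$. Fundamental $4$-form: $\Omega=\omega_1\wedge\omega_1+\omega_2\wedge\omega_2+\omega_3\wedge\omega_3$, with $\omega_r$ extended to $TM$ by $\xi\lrcorner\omega_r=0$ for $\xi\in V$. Normalized qc scalar curvature: with $R=[\nabla,\nabla]-\nabla_{[\ ,\ ]}$ the curvature of the Biquard connection and $R(A,B,C,D)=g(R(A,B)C,D)$, $S$ is defined (in dimension $7$) by $24\,S=\sum_{a,b=1}^4R(e_b,e_a,e_a,e_b)$ for a local orthonormal basis $e_1,\dots,e_4$ of $H$. *)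

theory Defs
  imports
    "HOL-Analysis.Analysis"
    "HOL-Combinatorics.Permutations"
    "HOL-Algebra.Solvable_Groups"
begin

section \<open>Smooth manifolds\<close>

fun Ck_on :: "nat \<Rightarrow> 'a::euclidean_space set \<Rightarrow> ('a \<Rightarrow> 'b::euclidean_space) \<Rightarrow> bool" where
  "Ck_on 0 S f \<longleftrightarrow> continuous_on S f"
| "Ck_on (Suc k) S f \<longleftrightarrow>
     f differentiable_on S \<and> (\<forall>v. Ck_on k S (\<lambda>x. frechet_derivative f (at x) v))"

text \<open>Only meaningful for open \<open>S\<close>, which is how it is used below.\<close>

definition smooth_on :: "'a::euclidean_space set \<Rightarrow> ('a \<Rightarrow> 'b::euclidean_space) \<Rightarrow> bool" where
  "smooth_on S f \<longleftrightarrow> (\<forall>k. Ck_on k S f)"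

text \<open>A chart is a pair \<open>(U, \<phi>)\<close>; \<open>\<phi>\<close> is relevant on \<open>U\<close> only, and \<open>inv_into U \<phi>\<close> is its
  inverse.  The points of the manifold are all points of the type \<open>'p\<close>.\<close>

type_synonym ('p, 'm) atlas = "('p set \<times> ('p \<Rightarrow> 'm)) set"

definition smooth_atlas ::
  "('p::{t2_space, second_countable_topology}, 'm::euclidean_space) atlas \<Rightarrow> bool" where
  "smooth_atlas A \<longleftrightarrow>
     (\<Union>(U, \<phi>)\<in>A. U) = UNIV \<and>
     (\<forall>(U, \<phi>)\<in>A. open U \<and> open (\<phi> ` U) \<and> homeomorphism U (\<phi> ` U) \<phi> (inv_into U \<phi>)) \<and>
     (\<forall>(U, \<phi>)\<in>A. \<forall>(V, \<psi>)\<in>A. smooth_on (\<phi> ` (U \<inter> V)) (\<psi> \<circ> inv_into U \<phi>))"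

definition prod_atlas :: "('p, 'm) atlas \<Rightarrow> ('q, 'n) atlas \<Rightarrow> ('p \<times> 'q, 'm \<times> 'n) atlas" where
  "prod_atlas A B = {(U \<times> V, map_prod \<phi> \<psi>) | U \<phi> V \<psi>. (U, \<phi>) \<in> A \<and> (V, \<psi>) \<in> B}"

definition smooth_map ::
  "('p::topological_space, 'm::euclidean_space) atlas \<Rightarrow>
   ('q::topological_space, 'n::euclidean_space) atlas \<Rightarrow> ('p \<Rightarrow> 'q) \<Rightarrow> bool" where
  "smooth_map A B F \<longleftrightarrow> continuous_on UNIV F \<and>
     (\<forall>(U, \<phi>)\<in>A. \<forall>(V, \<psi>)\<in>B. smooth_on (\<phi> ` (U \<inter> F -` V)) (\<psi> \<circ> F \<circ> inv_into U \<phi>))"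

definition smooth_funs :: "('p, 'm::euclidean_space) atlas \<Rightarrow> ('p \<Rightarrow> real) set" where
  "smooth_funs A = {f. \<forall>(U, \<phi>)\<in>A. smooth_on (\<phi> ` U) (f \<circ> inv_into U \<phi>)}"

section \<open>Tangent vectors and vector fields\<close>

text \<open>A tangent vector acts on smooth functions as a directional derivative
  \<open>\<Sum>i. w\<^sub>i * \<partial>/\<partial>x\<^sub>i\<close> in each chart around the point.  It is set to 0 on
  non-smooth functions, so that equality of HOL functions is equality of tangent vectors.\<close>

type_synonym 'p tvec = "('p \<Rightarrow> real) \<Rightarrow> real"
type_synonym 'p vfield = "'p \<Rightarrow> 'p tvec"

definition tangent_space :: "('p, 'm::euclidean_space) atlas \<Rightarrow> 'p \<Rightarrow> 'p tvec set" where
  "tangent_space A p = {v.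
     (\<forall>f. f \<notin> smooth_funs A \<longrightarrow> v f = 0) \<and>
     (\<forall>(U, \<phi>)\<in>A. p \<in> U \<longrightarrow>
        (\<exists>w. \<forall>f\<in>smooth_funs A. v f = frechet_derivative (f \<circ> inv_into U \<phi>) (at (\<phi> p)) w))}"

text \<open>\<open>W\<close> below is the vector of component functions of \<open>X\<close> in the chart.\<close>

definition vfields :: "('p, 'm::euclidean_space) atlas \<Rightarrow> 'p vfield set" where
  "vfields A = {X.
     (\<forall>p f. f \<notin> smooth_funs A \<longrightarrow> X p f = 0) \<and>
     (\<forall>(U, \<phi>)\<in>A. \<exists>W. smooth_on (\<phi> ` U) W \<and>
        (\<forall>p\<in>U. \<forall>f\<in>smooth_funs A.
           X p f = frechet_derivative (f \<circ> inv_into U \<phi>) (at (\<phi> p)) (W (\<phi> p))))}"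

definition vadd :: "'p vfield \<Rightarrow> 'p vfield \<Rightarrow> 'p vfield" where
  "vadd X Y = (\<lambda>p f. X p f + Y p f)"

definition vdiff :: "'p vfield \<Rightarrow> 'p vfield \<Rightarrow> 'p vfield" where
  "vdiff X Y = (\<lambda>p f. X p f - Y p f)"

definition vscale :: "('p \<Rightarrow> real) \<Rightarrow> 'p vfield \<Rightarrow> 'p vfield" where
  "vscale h X = (\<lambda>p f. h p * X p f)"

definition bracket :: "('p, 'm::euclidean_space) atlas \<Rightarrow> 'p vfield \<Rightarrow> 'p vfield \<Rightarrow> 'p vfield" where
  "bracket A X Y = (\<lambda>p f. if f \<in> smooth_funs A
     then X p (\<lambda>q. Y q f) - Y p (\<lambda>q. X q f) else 0)"

definition sections ::
  "('p, 'm::euclidean_space) atlas \<Rightarrow> ('p \<Rightarrow> 'p tvec set) \<Rightarrow> 'p vfield set" where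
  "sections A D = {X \<in> vfields A. \<forall>p. X p \<in> D p}"

definition tcomb :: "real \<Rightarrow> 'p tvec \<Rightarrow> real \<Rightarrow> 'p tvec \<Rightarrow> 'p tvec" where
  "tcomb a v b w = (\<lambda>f. a * v f + b * w f)"

definition tspan :: "nat set \<Rightarrow> (nat \<Rightarrow> 'p tvec) \<Rightarrow> 'p tvec set" where
  "tspan N b = {\<lambda>f. \<Sum>i\<in>N. c i * b i f | c. True}"

definition tindep :: "nat set \<Rightarrow> (nat \<Rightarrow> 'p tvec) \<Rightarrow> bool" where
  "tindep N b \<longleftrightarrow> (\<forall>c. (\<forall>f. (\<Sum>i\<in>N. c i * b i f) = 0) \<longrightarrow> (\<forall>i\<in>N. c i = 0))"

definition linear_form_on :: "'p tvec set \<Rightarrow> ('p tvec \<Rightarrow> real) \<Rightarrow> bool" where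
  "linear_form_on W k \<longleftrightarrow>
     (\<forall>v\<in>W. \<forall>w\<in>W. \<forall>a b. k (tcomb a v b w) = a * k v + b * k w)"

definition endo_on :: "'p tvec set \<Rightarrow> ('p tvec \<Rightarrow> 'p tvec) \<Rightarrow> bool" where
  "endo_on W B \<longleftrightarrow> (\<forall>v\<in>W. B v \<in> W) \<and>
     (\<forall>v\<in>W. \<forall>w\<in>W. \<forall>a b. B (tcomb a v b w) = tcomb a (B v) b (B w))"

definition inner_product_on :: "'p tvec set \<Rightarrow> ('p tvec \<Rightarrow> 'p tvec \<Rightarrow> real) \<Rightarrow> bool" where
  "inner_product_on W g \<longleftrightarrow>
     (\<forall>v\<in>W. linear_form_on W (g v)) \<and>
     (\<forall>v\<in>W. \<forall>w\<in>W. g v w = g w v) \<and>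
     (\<forall>v\<in>W. v \<noteq> (\<lambda>f. 0) \<longrightarrow> g v v > 0)"

section \<open>Differential forms\<close>

text \<open>A \<open>k\<close>-form takes a point and a list of \<open>k\<close> tangent vectors at that point.\<close>

type_synonym 'p form = "'p \<Rightarrow> 'p tvec list \<Rightarrow> real"

definition eval_form :: "'p form \<Rightarrow> 'p vfield list \<Rightarrow> 'p \<Rightarrow> real" where
  "eval_form \<alpha> Xs = (\<lambda>p. \<alpha> p (map (\<lambda>X. X p) Xs))"

definition one_form :: "('p, 'm::euclidean_space) atlas \<Rightarrow> 'p form \<Rightarrow> bool" where
  "one_form A \<alpha> \<longleftrightarrow>
     (\<forall>p. linear_form_on (tangent_space A p) (\<lambda>v. \<alpha> p [v])) \<and>
     (\<forall>X\<in>vfields A. eval_form \<alpha> [X] \<in> smooth_funs A)"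

text \<open>Normalised so that \<open>(\<alpha> \<and> \<beta>)(v, w) = \<alpha>(v)\<beta>(w) - \<alpha>(w)\<beta>(v)\<close> for 1-forms.\<close>

definition wedge :: "nat \<Rightarrow> nat \<Rightarrow> 'p form \<Rightarrow> 'p form \<Rightarrow> 'p form" where
  "wedge k l \<alpha> \<beta> = (\<lambda>p vs.
     (\<Sum>\<sigma> | \<sigma> permutes {..<k + l}. of_int (sign \<sigma>) *
        \<alpha> p (map (\<lambda>i. vs ! \<sigma> i) [0..<k]) * \<beta> p (map (\<lambda>i. vs ! \<sigma> i) [k..<k + l]))
     / (fact k * fact l))"

definition remove_nth :: "nat \<Rightarrow> 'a list \<Rightarrow> 'a list" where
  "remove_nth i xs = take i xs @ drop (Suc i) xs"

text \<open>Cartan's formula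
  \<open>d\<alpha>(X\<^sub>0,\<dots>,X\<^sub>k) = \<Sum>\<^sub>i (-1)\<^sup>i X\<^sub>i \<alpha>(\<dots>,X\<^sub>i omitted,\<dots>)
    + \<Sum>\<^sub>i\<^sub><\<^sub>j (-1)\<^sup>i\<^sup>+\<^sup>j \<alpha>([X\<^sub>i,X\<^sub>j],\<dots>,X\<^sub>i and X\<^sub>j omitted,\<dots>)\<close>.\<close>

definition ext_d :: "('p, 'm::euclidean_space) atlas \<Rightarrow> 'p form \<Rightarrow> 'p vfield list \<Rightarrow> 'p \<Rightarrow> real" where
  "ext_d A \<alpha> Xs = (\<lambda>p.
     (\<Sum>i<length Xs. (-1) ^ i * (Xs ! i) p (eval_form \<alpha> (remove_nth i Xs))) +
     (\<Sum>j<length Xs. \<Sum>i<j. (-1) ^ (i + j) *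
        eval_form \<alpha> (bracket A (Xs ! i) (Xs ! j) # remove_nth i (remove_nth j Xs)) p))"

text \<open>\<open>d_eq A k \<alpha> \<beta>\<close> says \<open>d\<alpha> = \<beta>\<close> for a \<open>k\<close>-form \<open>\<alpha>\<close> and a \<open>(k+1)\<close>-form \<open>\<beta>\<close>.\<close>

definition d_eq :: "('p, 'm::euclidean_space) atlas \<Rightarrow> nat \<Rightarrow> 'p form \<Rightarrow> 'p form \<Rightarrow> bool" where
  "d_eq A k \<alpha> \<beta> \<longleftrightarrow>
     (\<forall>Xs. length Xs = Suc k \<and> set Xs \<subseteq> vfields A \<longrightarrow> ext_d A \<alpha> Xs = eval_form \<beta> Xs)"

definition closed_form :: "('p, 'm::euclidean_space) atlas \<Rightarrow> nat \<Rightarrow> 'p form \<Rightarrow> bool" where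
  "closed_form A k \<alpha> \<longleftrightarrow> d_eq A k \<alpha> (\<lambda>p vs. 0)"

section \<open>Lie groups\<close>

definition lie_group ::
  "('p::{t2_space, second_countable_topology}, 'm::euclidean_space) atlas \<Rightarrow> 'p monoid \<Rightarrow> bool" where
  "lie_group A G \<longleftrightarrow> smooth_atlas A \<and> group G \<and> carrier G = UNIV \<and>
     smooth_map (prod_atlas A A) A (\<lambda>(x, y). x \<otimes>\<^bsub>G\<^esub> y) \<and>
     smooth_map A A (\<lambda>x. inv\<^bsub>G\<^esub> x)"

text \<open>Differential of the left translation \<open>q \<mapsto> a q\<close> on tangent vectors.\<close>

definition left_push :: "'p monoid \<Rightarrow> 'p \<Rightarrow> 'p tvec \<Rightarrow> 'p tvec" where
  "left_push G a v = (\<lambda>f. v (\<lambda>q. f (a \<otimes>\<^bsub>G\<^esub> q)))"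

definition left_inv_fields ::
  "('p, 'm::euclidean_space) atlas \<Rightarrow> 'p monoid \<Rightarrow> 'p vfield set" where
  "left_inv_fields A G =
     {X \<in> vfields A. \<forall>a p. X (a \<otimes>\<^bsub>G\<^esub> p) = left_push G a (X p)}"

definition left_inv_one_forms ::
  "('p, 'm::euclidean_space) atlas \<Rightarrow> 'p monoid \<Rightarrow> 'p form set" where
  "left_inv_one_forms A G = {\<alpha>. one_form A \<alpha> \<and>
     (\<forall>a p. \<forall>v\<in>tangent_space A p. \<alpha> (a \<otimes>\<^bsub>G\<^esub> p) [left_push G a v] = \<alpha> p [v])}"

definition left_inv_form_basis ::
  "('p, 'm::euclidean_space) atlas \<Rightarrow> 'p monoid \<Rightarrow> nat set \<Rightarrow> (nat \<Rightarrow> 'p form) \<Rightarrow> bool" where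
  "left_inv_form_basis A G N \<theta> \<longleftrightarrow>
     (\<forall>i\<in>N. \<theta> i \<in> left_inv_one_forms A G) \<and>
     (\<forall>c. (\<forall>p. \<forall>v\<in>tangent_space A p. (\<Sum>i\<in>N. c i * \<theta> i p [v]) = 0) \<longrightarrow> (\<forall>i\<in>N. c i = 0)) \<and>
     (\<forall>\<alpha>\<in>left_inv_one_forms A G. \<exists>c. \<forall>p. \<forall>v\<in>tangent_space A p.
        \<alpha> p [v] = (\<Sum>i\<in>N. c i * \<theta> i p [v]))"

section \<open>Quaternionic contact structures\<close>

text \<open>The data of a qc structure whose forms \<open>\<eta>\<^sub>r\<close>, almost complex structures \<open>I\<^sub>r\<close> and
  vector fields \<open>\<xi>\<^sub>r\<close> (\<open>r = 1, 2, 3\<close>) are globally defined.  \<open>qc_g\<close> and \<open>qc_I\<close> are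
  relevant on the distribution \<open>qc_H\<close> only.\<close>

record 'p qc =
  qc_H :: "'p \<Rightarrow> 'p tvec set"
  qc_g :: "'p \<Rightarrow> 'p tvec \<Rightarrow> 'p tvec \<Rightarrow> real"
  qc_eta :: "nat \<Rightarrow> 'p form"
  qc_I :: "nat \<Rightarrow> 'p \<Rightarrow> 'p tvec \<Rightarrow> 'p tvec"
  qc_xi :: "nat \<Rightarrow> 'p vfield"

definition appl :: "('p \<Rightarrow> 'p tvec \<Rightarrow> 'p tvec) \<Rightarrow> 'p vfield \<Rightarrow> 'p vfield" where
  "appl B X = (\<lambda>p. B p (X p))"

definition qc_structure :: "('p, real ^ 7) atlas \<Rightarrow> 'p qc \<Rightarrow> bool" where
  "qc_structure A Q \<longleftrightarrow>
     (\<forall>p. \<exists>b. tindep {1..4} b \<and> qc_H Q p = tspan {1..4} b) \<and>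
     (\<forall>p. inner_product_on (qc_H Q p) (qc_g Q p)) \<and>
     (\<forall>X\<in>sections A (qc_H Q). \<forall>Y\<in>sections A (qc_H Q).
        (\<lambda>p. qc_g Q p (X p) (Y p)) \<in> smooth_funs A) \<and>
     (\<forall>r\<in>{1..3}. one_form A (qc_eta Q r)) \<and>
     (\<forall>p. qc_H Q p = {v \<in> tangent_space A p. \<forall>r\<in>{1..3}. qc_eta Q r p [v] = 0}) \<and>
     (\<forall>r\<in>{1..3}. (\<forall>p. endo_on (qc_H Q p) (qc_I Q r p)) \<and>
        (\<forall>X\<in>sections A (qc_H Q). appl (qc_I Q r) X \<in> sections A (qc_H Q))) \<and>
     (\<forall>p. \<forall>v\<in>qc_H Q p.
        (\<forall>r\<in>{1..3}. qc_I Q r p (qc_I Q r p v) = (\<lambda>f. - v f)) \<and>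
        qc_I Q 1 p (qc_I Q 2 p v) = qc_I Q 3 p v \<and>
        qc_I Q 2 p (qc_I Q 1 p v) = (\<lambda>f. - qc_I Q 3 p v f) \<and>
        qc_I Q 1 p (qc_I Q 2 p (qc_I Q 3 p v)) = (\<lambda>f. - v f)) \<and>
     (\<forall>r\<in>{1..3}. \<forall>p. \<forall>v\<in>qc_H Q p. \<forall>w\<in>qc_H Q p.
        qc_g Q p (qc_I Q r p v) (qc_I Q r p w) = qc_g Q p v w) \<and>
     (\<forall>r\<in>{1..3}. \<forall>X\<in>sections A (qc_H Q). \<forall>Y\<in>sections A (qc_H Q). \<forall>p.
        2 * qc_g Q p (qc_I Q r p (X p)) (Y p) = ext_d A (qc_eta Q r) [X, Y] p)"

definition integrable_qc_structure :: "('p, real ^ 7) atlas \<Rightarrow> 'p qc \<Rightarrow> bool" where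
  "integrable_qc_structure A Q \<longleftrightarrow> qc_structure A Q \<and>
     (\<forall>s\<in>{1..3}. qc_xi Q s \<in> vfields A) \<and>
     (\<forall>s\<in>{1..3}. \<forall>k\<in>{1..3}. \<forall>p. qc_eta Q s p [qc_xi Q k p] = (if s = k then 1 else 0)) \<and>
     (\<forall>s\<in>{1..3}. \<forall>X\<in>sections A (qc_H Q). \<forall>p. ext_d A (qc_eta Q s) [qc_xi Q s, X] p = 0) \<and>
     (\<forall>s\<in>{1..3}. \<forall>k\<in>{1..3}. \<forall>X\<in>sections A (qc_H Q). \<forall>p.
        ext_d A (qc_eta Q k) [qc_xi Q s, X] p = - ext_d A (qc_eta Q s) [qc_xi Q k, X] p)"

definition qc_V :: "'p qc \<Rightarrow> 'p \<Rightarrow> 'p tvec set" where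
  "qc_V Q p = tspan {1..3} (\<lambda>r. qc_xi Q r p)"

text \<open>The projections of \<open>TM = H \<oplus> V\<close>.\<close>

definition vert :: "'p qc \<Rightarrow> 'p \<Rightarrow> 'p tvec \<Rightarrow> 'p tvec" where
  "vert Q p v = (\<lambda>f. \<Sum>r\<in>{1..3}. qc_eta Q r p [v] * qc_xi Q r p f)"

definition horiz :: "'p qc \<Rightarrow> 'p \<Rightarrow> 'p tvec \<Rightarrow> 'p tvec" where
  "horiz Q p v = (\<lambda>f. v f - vert Q p v f)"

text \<open>The metric on \<open>TM\<close> with \<open>V \<bottom> H\<close> and orthonormal \<open>\<xi>\<^sub>r\<close>.\<close>

definition ext_g :: "'p qc \<Rightarrow> 'p \<Rightarrow> 'p tvec \<Rightarrow> 'p tvec \<Rightarrow> real" where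
  "ext_g Q p v w = qc_g Q p (horiz Q p v) (horiz Q p w) +
     (\<Sum>r\<in>{1..3}. qc_eta Q r p [v] * qc_eta Q r p [w])"

definition omega :: "'p qc \<Rightarrow> nat \<Rightarrow> 'p form" where
  "omega Q r = (\<lambda>p vs. qc_g Q p (qc_I Q r p (horiz Q p (vs ! 0))) (horiz Q p (vs ! 1)))"

definition fund_form :: "'p qc \<Rightarrow> 'p form" where
  "fund_form Q = (\<lambda>p vs. \<Sum>r\<in>{1..3}. wedge 2 2 (omega Q r) (omega Q r) p vs)"

definition orthonormal_basis_at :: "'p qc \<Rightarrow> 'p \<Rightarrow> (nat \<Rightarrow> 'p tvec) \<Rightarrow> bool" where
  "orthonormal_basis_at Q p b \<longleftrightarrow>
     (\<forall>i\<in>{1..4}. b i \<in> qc_H Q p) \<and>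
     (\<forall>i\<in>{1..4}. \<forall>j\<in>{1..4}. qc_g Q p (b i) (b j) = (if i = j then 1 else 0))"

definition quat_endo :: "'p qc \<Rightarrow> (nat \<Rightarrow> 'p \<Rightarrow> real) \<Rightarrow> 'p \<Rightarrow> 'p tvec \<Rightarrow> 'p tvec" where
  "quat_endo Q a p v = (\<lambda>f. \<Sum>r\<in>{1..3}. a r p * qc_I Q r p v f)"

text \<open>Smooth sections of the bundle spanned by \<open>I\<^sub>1, I\<^sub>2, I\<^sub>3\<close>.\<close>

definition quat_sections ::
  "('p, real ^ 7) atlas \<Rightarrow> 'p qc \<Rightarrow> ('p \<Rightarrow> 'p tvec \<Rightarrow> 'p tvec) set" where
  "quat_sections A Q = {quat_endo Q a | a. \<forall>r\<in>{1..3}. a r \<in> smooth_funs A}"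

text \<open>The identification \<open>\<phi> : V \<rightarrow> \<Q>\<close>, \<open>\<xi>\<^sub>r \<mapsto> I\<^sub>r\<close>.\<close>

definition phi :: "'p qc \<Rightarrow> 'p vfield \<Rightarrow> 'p \<Rightarrow> 'p tvec \<Rightarrow> 'p tvec" where
  "phi Q \<xi> = quat_endo Q (\<lambda>r p. qc_eta Q r p [\<xi> p])"

definition sp1_first :: "'p qc \<Rightarrow> 'p \<Rightarrow> ('p tvec \<Rightarrow> 'p tvec) set" where
  "sp1_first Q p = {\<lambda>v f. \<Sum>r\<in>{1..3}. c r * qc_I Q r p v f | c. True}"

definition sp1_second :: "'p qc \<Rightarrow> 'p \<Rightarrow> ('p tvec \<Rightarrow> 'p tvec) set" where
  "sp1_second Q p = {B. endo_on (qc_H Q p) B \<and>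
     (\<forall>v\<in>qc_H Q p. \<forall>w\<in>qc_H Q p. qc_g Q p (B v) w = - qc_g Q p v (B w)) \<and>
     (\<forall>r\<in>{1..3}. \<forall>v\<in>qc_H Q p. B (qc_I Q r p v) = qc_I Q r p (B v))}"

section \<open>Connections and the Biquard connection\<close>

type_synonym 'p conn = "'p vfield \<Rightarrow> 'p vfield \<Rightarrow> 'p vfield"

definition linear_connection :: "('p, 'm::euclidean_space) atlas \<Rightarrow> 'p conn \<Rightarrow> bool" where
  "linear_connection A D \<longleftrightarrow>
     (\<forall>X\<in>vfields A. \<forall>Y\<in>vfields A. D X Y \<in> vfields A) \<and>
     (\<forall>X\<in>vfields A. \<forall>Y\<in>vfields A. \<forall>Z\<in>vfields A.
        D (vadd X Y) Z = vadd (D X Z) (D Y Z) \<and> D X (vadd Y Z) = vadd (D X Y) (D X Z)) \<and>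
     (\<forall>h\<in>smooth_funs A. \<forall>X\<in>vfields A. \<forall>Y\<in>vfields A.
        D (vscale h X) Y = vscale h (D X Y) \<and>
        D X (vscale h Y) = vadd (vscale (\<lambda>p. X p h) Y) (vscale h (D X Y)))"

definition torsion :: "('p, 'm::euclidean_space) atlas \<Rightarrow> 'p conn \<Rightarrow> 'p vfield \<Rightarrow> 'p vfield \<Rightarrow> 'p vfield" where
  "torsion A D X Y = vdiff (vdiff (D X Y) (D Y X)) (bracket A X Y)"

definition curvature ::
  "('p, 'm::euclidean_space) atlas \<Rightarrow> 'p conn \<Rightarrow> 'p vfield \<Rightarrow> 'p vfield \<Rightarrow> 'p vfield \<Rightarrow> 'p vfield" where
  "curvature A D X Y Z =
     vdiff (vdiff (D X (D Y Z)) (D Y (D X Z))) (D (bracket A X Y) Z)"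

text \<open>\<open>(\<nabla>\<^sub>X \<sigma>) Y\<close> for a section \<open>\<sigma>\<close> of endomorphisms of \<open>H\<close>.\<close>

definition nabla_endo ::
  "'p conn \<Rightarrow> 'p vfield \<Rightarrow> ('p \<Rightarrow> 'p tvec \<Rightarrow> 'p tvec) \<Rightarrow> 'p vfield \<Rightarrow> 'p vfield" where
  "nabla_endo D X \<sigma> Y = vdiff (D X (appl \<sigma> Y)) (appl \<sigma> (D X Y))"

text \<open>In the torsion condition, \<open>T\<^sub>\<xi>\<close> at \<open>p\<close> is evaluated on an orthonormal basis of \<open>H\<close>
  at \<open>p\<close> that is given as the values at \<open>p\<close> of sections \<open>E\<^sub>i\<close> of \<open>H\<close>; the torsion
  being a tensor, the choice of the sections is immaterial.  Being orthogonal to the sum of the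
  two copies of \<open>sp(1)\<close> is being orthogonal to their union.\<close>

definition biquard_connection :: "('p, real ^ 7) atlas \<Rightarrow> 'p qc \<Rightarrow> 'p conn \<Rightarrow> bool" where
  "biquard_connection A Q D \<longleftrightarrow> linear_connection A D \<and>
     (\<forall>X\<in>vfields A. \<forall>Y\<in>sections A (qc_H Q). D X Y \<in> sections A (qc_H Q)) \<and>
     (\<forall>X\<in>vfields A. \<forall>Y\<in>sections A (qc_V Q). D X Y \<in> sections A (qc_V Q)) \<and>
     (\<forall>X\<in>vfields A. \<forall>Y\<in>vfields A. \<forall>Z\<in>vfields A. \<forall>p.
        X p (\<lambda>q. ext_g Q q (Y q) (Z q)) = ext_g Q p (D X Y p) (Z p) + ext_g Q p (Y p) (D X Z p)) \<and>
     (\<forall>\<sigma>\<in>quat_sections A Q. \<forall>X\<in>vfields A. \<exists>\<tau>\<in>quat_sections A Q.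
        \<forall>Y\<in>sections A (qc_H Q). nabla_endo D X \<sigma> Y = appl \<tau> Y) \<and>
     (\<forall>X\<in>sections A (qc_H Q). \<forall>Y\<in>sections A (qc_H Q). \<forall>p f.
        torsion A D X Y p f = - vert Q p (bracket A X Y p) f) \<and>
     (\<forall>\<xi>\<in>sections A (qc_V Q). \<forall>X\<in>sections A (qc_H Q).
        torsion A D \<xi> X \<in> sections A (qc_H Q)) \<and>
     (\<forall>\<xi>\<in>sections A (qc_V Q). \<forall>E p.
        (\<forall>i\<in>{1..4}. E i \<in> sections A (qc_H Q)) \<and> orthonormal_basis_at Q p (\<lambda>i. E i p) \<longrightarrow>
        (\<forall>B\<in>sp1_first Q p \<union> sp1_second Q p.
           (\<Sum>i\<in>{1..4}. qc_g Q p (torsion A D \<xi> (E i) p) (B (E i p))) = 0)) \<and>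
     (\<forall>X\<in>vfields A. \<forall>\<xi>\<in>sections A (qc_V Q). \<forall>Y\<in>sections A (qc_H Q).
        nabla_endo D X (phi Q \<xi>) Y = appl (phi Q (D X \<xi>)) Y)"

definition nonzero_torsion_endo :: "('p, real ^ 7) atlas \<Rightarrow> 'p qc \<Rightarrow> 'p conn \<Rightarrow> bool" where
  "nonzero_torsion_endo A Q D \<longleftrightarrow>
     (\<exists>\<xi>\<in>sections A (qc_V Q). \<exists>X\<in>sections A (qc_H Q). torsion A D \<xi> X \<noteq> (\<lambda>p f. 0))"

text \<open>As above, the orthonormal basis of \<open>H\<close> at \<open>p\<close> is given by values of sections.\<close>

definition normalized_qc_scal :: "('p, real ^ 7) atlas \<Rightarrow> 'p qc \<Rightarrow> 'p conn \<Rightarrow> ('p \<Rightarrow> real) \<Rightarrow> bool" where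
  "normalized_qc_scal A Q D S \<longleftrightarrow>
     (\<forall>E p. (\<forall>a\<in>{1..4}. E a \<in> sections A (qc_H Q)) \<and> orthonormal_basis_at Q p (\<lambda>a. E a p) \<longrightarrow>
        24 * S p = (\<Sum>a\<in>{1..4::nat}. \<Sum>b\<in>{1..4::nat}.
          ext_g Q p (curvature A D (E b) (E a) (E a) p) (E b p)))"

end

theory Submission
  imports Defs
begin

text \<open>The theorem is a computation in the frame \<open>e\<^sub>1, \<dots>, e\<^sub>7\<close>, and its input is the list of the
seven differentials \<open>d\<theta>\<^sub>k\<close>.  Seven tangent vectors dual to the \<open>\<theta>\<^sub>k\<close> form a basis of a tangent space
that is the image of \<open>\<real>\<^sup>7\<close> under a linear map (\<open>tangent_expand\<close>), and the bracket of two vector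
fields is a vector field (\<open>vfields_bracket\<close>, by the symmetry of second derivatives).  So every
field is \<open>\<Sum>\<^sub>k \<theta>\<^sub>k(X) e\<^sub>k\<close> with smooth coefficients, fields are equal when their coordinates are, and
brackets enter through \<open>\<theta>\<^sub>k([X,Y]) = X \<theta>\<^sub>k(Y) - Y \<theta>\<^sub>k(X) - d\<theta>\<^sub>k(X,Y)\<close> only.

\<^emph>\<open>The qc structure.\<close>  On \<open>H\<close> the forms \<open>d\<theta>\<^sub>5, d\<theta>\<^sub>6, d\<theta>\<^sub>7\<close> are \<open>2 \<omega>\<^sub>1, 2 \<omega>\<^sub>2, 2 \<omega>\<^sub>3\<close>, and \<open>\<omega>\<^sub>r\<close> determines
\<open>I\<^sub>r\<close>, which turns out to be left multiplication by a unit quaternion.  The contractions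
\<open>\<xi>\<^sub>s \<lrcorner> d\<eta>\<^sub>k\<close> vanish on \<open>H\<close> except for \<open>\<xi>\<^sub>1 \<lrcorner> d\<eta>\<^sub>2 = - \<theta>\<^sub>4\<close> and \<open>\<xi>\<^sub>2 \<lrcorner> d\<eta>\<^sub>1 = \<theta>\<^sub>4\<close>.

\<^emph>\<open>The fundamental form.\<close>  Each \<open>\<omega>\<^sub>r \<and> \<omega>\<^sub>r\<close> is \<open>2 \<theta>\<^sub>1 \<and> \<theta>\<^sub>2 \<and> \<theta>\<^sub>3 \<and> \<theta>\<^sub>4\<close>, and every summand of \<open>d\<theta>\<^sub>k\<close> with \<open>k \<le> 4\<close>
has a factor in common with the product of the other three \<open>\<theta>\<^sub>j\<close>, \<open>j \<le> 4\<close>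
(\<open>structure_form_det4\<close>, \<open>fund_form_closed\<close>).

\<^emph>\<open>The Biquard connection.\<close>  A skew matrix of connection forms defines a metric connection; Cartan's
structure equations (\<open>coord_torsion\<close>, \<open>coord_curvature\<close>) express its torsion and curvature by the
\<open>d\<theta>\<^sub>k\<close>.  The matrix \<open>conn_form\<close> is the only candidate: along \<open>H\<close> its horizontal block
is given by Koszul's formula, and along \<open>\<xi> \<in> V\<close> the endomorphism \<open>T\<^sub>\<xi>\<close> has to be orthogonal to
\<open>sp(1) \<oplus> sp(1)\<close>, which is the space of all skew endomorphisms of the four-dimensional \<open>H\<close>, so that \<open>T\<^sub>\<xi>\<close>
is symmetric.  This gives existence (\<open>nabla_biquard\<close>) and, on sections of \<open>H\<close>, uniqueness
(\<open>biquard_unique_H\<close>).  The horizontal components of the torsion and the curvature on \<open>H\<close> depend on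
the connection on sections of \<open>H\<close> only, so they may be read off from the explicit connection:
\<open>T(\<xi>\<^sub>1, e\<^sub>1) = - 1/4 e\<^sub>2\<close>, and the horizontal Ricci form is
\<open>-5 x\<^sub>1\<^sup>2 - x\<^sub>2\<^sup>2 - x\<^sub>3\<^sup>2 - 5 x\<^sub>4\<^sup>2\<close>, of trace \<open>-12 = 24 * (- 1/2)\<close> (\<open>ricci_trace\<close>).\<close>

section \<open>Smooth functions on open sets\<close>

lemma Ck_on_continuous: "Ck_on k S f \<Longrightarrow> continuous_on S f"
  by (cases k) (auto intro: differentiable_imp_continuous_on)

lemma Ck_on_Suc_imp: "Ck_on (Suc k) S f \<Longrightarrow> Ck_on k S f"
proof (induction k arbitrary: f)
  case 0
  then show ?case by (simp add: differentiable_imp_continuous_on)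
next
  case (Suc k)
  then show ?case by (metis Ck_on.simps(2))
qed

lemma Ck_on_Suc_has_derivative:
  assumes "open S" "Ck_on (Suc k) S f" "x \<in> S"
  shows "(f has_derivative frechet_derivative f (at x)) (at x)"
  using assms by (simp add: differentiable_on_eq_differentiable_at frechet_derivative_works)

lemma Ck_on_cong:
  assumes "open S" "\<And>x. x \<in> S \<Longrightarrow> f x = g x" "Ck_on k S f"
  shows "Ck_on k S g"
  using assms(2,3)
proof (induction k arbitrary: f g)
  case 0
  then show ?case by (simp cong: continuous_on_cong)
next
  case (Suc k)
  have hd: "(g has_derivative frechet_derivative f (at x)) (at x)" if "x \<in> S" for x
    using Ck_on_Suc_has_derivative[OF assms(1) Suc.prems(2) that]
    by (rule has_derivative_transform_within_open[OF _ assms(1) that]) (use Suc.prems in auto)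
  from hd have eq: "frechet_derivative f (at x) = frechet_derivative g (at x)" if "x \<in> S" for x
    using frechet_derivative_at that by blast
  have "Ck_on k S (\<lambda>x. frechet_derivative g (at x) v)" for v
    by (rule Suc.IH[of "\<lambda>x. frechet_derivative f (at x) v"]) (use Suc.prems(2) eq in simp_all)
  moreover have "g differentiable_on S"
    using hd assms(1) by (auto simp: differentiable_on_eq_differentiable_at differentiable_def)
  ultimately show ?case
    by simp
qed

text \<open>Any derivative that can be exhibited on \<open>S\<close> coincides there with the one selected by
  \<open>frechet_derivative\<close>, so its directional derivatives are the ones to be controlled.\<close>

lemma Ck_on_SucI:
  fixes f :: "'a::euclidean_space \<Rightarrow> 'b::euclidean_space"
  assumes "open S"
    and "\<And>x. x \<in> S \<Longrightarrow> (f has_derivative f' x) (at x)"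
    and "\<And>v. Ck_on k S (\<lambda>x. f' x v)"
  shows "Ck_on (Suc k) S f"
proof -
  have "frechet_derivative f (at x) = f' x" if "x \<in> S" for x
    using assms(2)[OF that] frechet_derivative_at by metis
  then show ?thesis
    using assms(1,2) Ck_on_cong[OF assms(1) _ assms(3)]
    by (auto simp: differentiable_on_eq_differentiable_at differentiable_def)
qed

lemma Ck_on_const: "open S \<Longrightarrow> Ck_on k S (\<lambda>x. c)"
proof (induction k arbitrary: c)
  case (Suc k)
  then show ?case by auto
qed auto

lemma Ck_on_add:
  "open S \<Longrightarrow> Ck_on k S f \<Longrightarrow> Ck_on k S g \<Longrightarrow> Ck_on k S (\<lambda>x. f x + g x)"
proof (induction k arbitrary: f g)
  case 0
  then show ?case by (auto intro: continuous_on_add)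
next
  case (Suc k)
  show ?case
    by (rule Ck_on_SucI[OF Suc.prems(1), where f' = "\<lambda>x v. frechet_derivative f (at x) v +
          frechet_derivative g (at x) v"])
      (use Suc in \<open>auto intro!: has_derivative_add Ck_on_Suc_has_derivative\<close>)
qed

text \<open>By induction on \<open>k\<close> from the product rule; it covers products, scalar multiples and inner products at once.\<close>

lemma Ck_on_bilinear:
  fixes f :: "'x::euclidean_space \<Rightarrow> 'a::euclidean_space" and g :: "'x \<Rightarrow> 'b::euclidean_space"
    and b :: "'a \<Rightarrow> 'b \<Rightarrow> 'c::euclidean_space"
  assumes b: "bounded_bilinear b" and S: "open S" and "Ck_on k S f" "Ck_on k S g"
  shows "Ck_on k S (\<lambda>x. b (f x) (g x))"
  using assms(3,4)
proof (induction k arbitrary: f g)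
  case 0
  then show ?case by (auto intro: bounded_bilinear.continuous_on[OF b])
next
  case (Suc k)
  note hd = Suc.prems[THEN Ck_on_Suc_has_derivative[OF S]]
  show ?case
  proof (rule Ck_on_SucI[OF S, where f' = "\<lambda>x v. b (f x) (frechet_derivative g (at x) v) +
          b (frechet_derivative f (at x) v) (g x)"])
    show "((\<lambda>x. b (f x) (g x)) has_derivative (\<lambda>v. b (f x) (frechet_derivative g (at x) v) +
          b (frechet_derivative f (at x) v) (g x))) (at x)" if "x \<in> S" for x
      by (rule bounded_bilinear.FDERIV[OF b]) (rule hd[OF that])+
    show "Ck_on k S (\<lambda>x. b (f x) (frechet_derivative g (at x) v) +
          b (frechet_derivative f (at x) v) (g x))" for v
      using Suc.prems Suc.prems[THEN Ck_on_Suc_imp] by (auto intro!: Ck_on_add[OF S] Suc.IH)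
  qed
qed

lemma smooth_on_cong: "open S \<Longrightarrow> (\<And>x. x \<in> S \<Longrightarrow> f x = g x) \<Longrightarrow> smooth_on S f \<Longrightarrow> smooth_on S g"
  unfolding smooth_on_def using Ck_on_cong by blast

lemma smooth_on_const: "open S \<Longrightarrow> smooth_on S (\<lambda>x. c)"
  by (simp add: smooth_on_def Ck_on_const)

lemma smooth_on_add:
  "open S \<Longrightarrow> smooth_on S f \<Longrightarrow> smooth_on S g \<Longrightarrow> smooth_on S (\<lambda>x. f x + g x)"
  by (simp add: smooth_on_def Ck_on_add)

lemma smooth_on_bilinear:
  fixes f :: "'x::euclidean_space \<Rightarrow> 'a::euclidean_space" and g :: "'x \<Rightarrow> 'b::euclidean_space"
    and b :: "'a \<Rightarrow> 'b \<Rightarrow> 'c::euclidean_space"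
  shows "bounded_bilinear b \<Longrightarrow> open S \<Longrightarrow> smooth_on S f \<Longrightarrow> smooth_on S g \<Longrightarrow>
    smooth_on S (\<lambda>x. b (f x) (g x))"
  by (simp add: smooth_on_def Ck_on_bilinear)

lemmas smooth_on_mult = smooth_on_bilinear[OF bounded_bilinear_mult]
lemmas smooth_on_scaleR = smooth_on_bilinear[OF bounded_bilinear_scaleR]
lemmas smooth_on_inner = smooth_on_bilinear[OF bounded_bilinear_inner]

lemma smooth_on_diff:
  assumes "open S" "smooth_on S f" "smooth_on S g"
  shows "smooth_on S (\<lambda>x. f x - g x)"
  using smooth_on_add[OF assms(1,2) smooth_on_scaleR[OF assms(1) smooth_on_const[OF assms(1)] assms(3)], of "-1"]
  by simp

lemma smooth_on_sum:
  assumes "open S" "\<And>i. i \<in> F \<Longrightarrow> smooth_on S (f i)"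
  shows "smooth_on S (\<lambda>x. \<Sum>i\<in>F. f i x)"
  using assms(2)
  by (induction F rule: infinite_finite_induct) (auto simp: smooth_on_const smooth_on_add assms(1))

lemma smooth_on_frechet_derivative:
  "smooth_on S f \<Longrightarrow> smooth_on S (\<lambda>x. frechet_derivative f (at x) v)"
  unfolding smooth_on_def by (metis Ck_on.simps(2))

lemma smooth_on_has_derivative:
  "open S \<Longrightarrow> smooth_on S f \<Longrightarrow> x \<in> S \<Longrightarrow> (f has_derivative frechet_derivative f (at x)) (at x)"
  unfolding smooth_on_def using Ck_on_Suc_has_derivative by blast

lemma smooth_on_linear_derivative:
  "open S \<Longrightarrow> smooth_on S f \<Longrightarrow> x \<in> S \<Longrightarrow> linear (frechet_derivative f (at x))"
  using smooth_on_has_derivative has_derivative_linear by blast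

lemma linear_euclidean_sum:
  fixes L :: "'a::euclidean_space \<Rightarrow> 'b::real_vector"
  assumes "linear L"
  shows "L w = (\<Sum>b\<in>Basis. (w \<bullet> b) *\<^sub>R L b)"
proof -
  have "L w = L (\<Sum>b\<in>Basis. (w \<bullet> b) *\<^sub>R b)"
    by (simp add: euclidean_representation)
  then show ?thesis
    using assms by (simp add: linear_sum linear_scale)
qed

text \<open>Smoothness only speaks of derivatives in constant directions; expanding the variable direction \<open>W x\<close> in a basis
  reduces to these.\<close>

lemma smooth_on_derivative_along:
  fixes f :: "'a::euclidean_space \<Rightarrow> 'b::euclidean_space" and W :: "'a \<Rightarrow> 'a"
  assumes "open S" "smooth_on S f" "smooth_on S W"
  shows "smooth_on S (\<lambda>x. frechet_derivative f (at x) (W x))"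
proof (rule smooth_on_cong[OF assms(1)])
  show "smooth_on S (\<lambda>x. \<Sum>b\<in>Basis. (W x \<bullet> b) *\<^sub>R frechet_derivative f (at x) b)"
    by (intro smooth_on_sum smooth_on_scaleR smooth_on_inner smooth_on_frechet_derivative
        smooth_on_const assms)
  show "(\<Sum>b\<in>Basis. (W x \<bullet> b) *\<^sub>R frechet_derivative f (at x) b) =
      frechet_derivative f (at x) (W x)" if "x \<in> S" for x
    using linear_euclidean_sum[OF smooth_on_linear_derivative[OF assms(1,2) that], of "W x"] by simp
qed

text \<open>The mean value theorem along \<open>u\<close> and then along \<open>v\<close>. The left-hand side is symmetric in
  \<open>u\<close> and \<open>v\<close>, which is what makes the mixed derivatives comparable.\<close>

lemma second_difference_mean_value:
  fixes f :: "'a::euclidean_space \<Rightarrow> real"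
  assumes f: "open S" "smooth_on S f" and "0 < h"
    and sub: "\<And>s t. s \<in> {0..h} \<Longrightarrow> t \<in> {0..h} \<Longrightarrow> x + s *\<^sub>R u + t *\<^sub>R v \<in> S"
  shows "\<exists>s t. s \<in> {0..h} \<and> t \<in> {0..h} \<and>
    f (x + h *\<^sub>R u + h *\<^sub>R v) - f (x + h *\<^sub>R u) - f (x + h *\<^sub>R v) + f x =
    h * h * frechet_derivative (\<lambda>y. frechet_derivative f (at y) u) (at (x + s *\<^sub>R u + t *\<^sub>R v)) v"
proof -
  let ?D = "\<lambda>y. frechet_derivative f (at y)"
  let ?DD = "\<lambda>y. frechet_derivative (\<lambda>y. ?D y u) (at y)"
  have smu: "smooth_on S (\<lambda>y. ?D y u)"
    by (rule smooth_on_frechet_derivative[OF f(2)])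
  have d1: "((\<lambda>s. f (x + s *\<^sub>R u + t *\<^sub>R v)) has_real_derivative ?D (x + s *\<^sub>R u + t *\<^sub>R v) u) (at s)"
    if "s \<in> {0..h}" "t \<in> {0..h}" for s t
  proof -
    note hd = smooth_on_has_derivative[OF f sub[OF that]]
    have "((\<lambda>s. f (x + s *\<^sub>R u + t *\<^sub>R v)) has_derivative (\<lambda>r. ?D (x + s *\<^sub>R u + t *\<^sub>R v) (r *\<^sub>R u))) (at s)"
      by (rule has_derivative_compose[of "\<lambda>s. x + s *\<^sub>R u + t *\<^sub>R v" "\<lambda>r. r *\<^sub>R u" s UNIV f, OF _ hd]) (auto intro!: derivative_eq_intros)
    then show ?thesis
      using linear_scale[OF has_derivative_linear[OF hd]]
      by (simp add: has_field_derivative_def mult_commute_abs)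
  qed
  have d2: "((\<lambda>t. ?D (x + s *\<^sub>R u + t *\<^sub>R v) u) has_real_derivative ?DD (x + s *\<^sub>R u + t *\<^sub>R v) v) (at t)"
    if "s \<in> {0..h}" "t \<in> {0..h}" for s t
  proof -
    note hd = smooth_on_has_derivative[OF f(1) smu sub[OF that]]
    have "((\<lambda>t. ?D (x + s *\<^sub>R u + t *\<^sub>R v) u) has_derivative (\<lambda>r. ?DD (x + s *\<^sub>R u + t *\<^sub>R v) (r *\<^sub>R v))) (at t)"
      by (rule has_derivative_compose[of "\<lambda>t. x + s *\<^sub>R u + t *\<^sub>R v" "\<lambda>r. r *\<^sub>R v" t UNIV "\<lambda>y. ?D y u", OF _ hd]) (auto intro!: derivative_eq_intros)
    then show ?thesis
      using linear_scale[OF has_derivative_linear[OF hd]]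
      by (simp add: has_field_derivative_def mult_commute_abs)
  qed
  have d3: "((\<lambda>s. f (x + s *\<^sub>R u + h *\<^sub>R v) - f (x + s *\<^sub>R u + 0 *\<^sub>R v)) has_real_derivative
      ?D (x + s *\<^sub>R u + h *\<^sub>R v) u - ?D (x + s *\<^sub>R u + 0 *\<^sub>R v) u) (at s)"
    if "0 \<le> s" "s \<le> h" for s
    by (intro DERIV_diff d1) (use that \<open>0 < h\<close> in auto)
  obtain s where s: "0 < s" "s < h" and
    s_eq: "(f (x + h *\<^sub>R u + h *\<^sub>R v) - f (x + h *\<^sub>R u + 0 *\<^sub>R v)) -
       (f (x + 0 *\<^sub>R u + h *\<^sub>R v) - f (x + 0 *\<^sub>R u + 0 *\<^sub>R v)) =
      (h - 0) * (?D (x + s *\<^sub>R u + h *\<^sub>R v) u - ?D (x + s *\<^sub>R u + 0 *\<^sub>R v) u)"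
    using MVT2[OF \<open>0 < h\<close> d3] by blast
  have d4: "((\<lambda>t. ?D (x + s *\<^sub>R u + t *\<^sub>R v) u) has_real_derivative
      ?DD (x + s *\<^sub>R u + t *\<^sub>R v) v) (at t)" if "0 \<le> t" "t \<le> h" for t
    by (intro d2) (use that s in auto)
  obtain t where t: "0 < t" "t < h" and
    t_eq: "?D (x + s *\<^sub>R u + h *\<^sub>R v) u - ?D (x + s *\<^sub>R u + 0 *\<^sub>R v) u =
      (h - 0) * ?DD (x + s *\<^sub>R u + t *\<^sub>R v) v"
    using MVT2[OF \<open>0 < h\<close> d4] by blast
  show ?thesis
    using s t s_eq t_eq by (intro exI[of _ s] exI[of _ t]) (auto simp: algebra_simps)
qed

text \<open>Over small parallelograms both mixed derivatives equal the same second difference quotient, at points close to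
  \<open>x\<close>; by continuity they agree at \<open>x\<close>.\<close>

lemma second_derivative_commute:
  fixes f :: "'a::euclidean_space \<Rightarrow> real"
  assumes f: "open S" "smooth_on S f" and "x \<in> S"
  shows "frechet_derivative (\<lambda>y. frechet_derivative f (at y) u) (at x) v =
    frechet_derivative (\<lambda>y. frechet_derivative f (at y) v) (at x) u"
proof -
  let ?DD = "\<lambda>u y v. frechet_derivative (\<lambda>y. frechet_derivative f (at y) u) (at y) v"
  have cont: "isCont (\<lambda>y. ?DD u y v) x" for u v
  proof -
    have "smooth_on S (\<lambda>y. ?DD u y v)"
      by (intro smooth_on_frechet_derivative f)
    then have "continuous_on S (\<lambda>y. ?DD u y v)"
      unfolding smooth_on_def using Ck_on_continuous by blast
    then show ?thesis
      using assms by (simp add: continuous_on_eq_continuous_at)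
  qed
  have "\<bar>?DD u x v - ?DD v x u\<bar> \<le> 0 + r" if "0 < r" for r
  proof -
    have "0 < r / 2" using that by simp
    then obtain d1 where d1: "0 < d1" "\<And>y. dist y x < d1 \<Longrightarrow> dist (?DD u y v) (?DD u x v) < r / 2"
      using cont[of u v] unfolding continuous_at_eps_delta by metis
    obtain d2 where d2: "0 < d2" "\<And>y. dist y x < d2 \<Longrightarrow> dist (?DD v y u) (?DD v x u) < r / 2"
      using cont[of v u] \<open>0 < r / 2\<close> unfolding continuous_at_eps_delta by metis
    obtain d3 where d3: "0 < d3" "ball x d3 \<subseteq> S"
      using assms openE by blast
    (* h is so small that the parallelogram spanned by h u and h v stays within distance d of x *)
    define d where "d = min d1 (min d2 d3)"
    define h where "h = d / (2 * (norm u + norm v + 1))"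
    have d: "0 < d" using d1 d2 d3 by (simp add: d_def)
    have pos: "0 < norm u + norm v + 1"
      by (smt (verit) norm_ge_zero)
    then have h: "0 < h" using d by (simp add: h_def)
    have near: "dist (x + s *\<^sub>R a + t *\<^sub>R b) x < d"
      if "s \<in> {0..h}" "t \<in> {0..h}" "norm a + norm b = norm u + norm v" for s t a b
    proof -
      have "dist (x + s *\<^sub>R a + t *\<^sub>R b) x = norm (s *\<^sub>R a + t *\<^sub>R b)"
        by (simp add: dist_norm)
      also have "\<dots> \<le> s * norm a + t * norm b"
        using that norm_triangle_ineq[of "s *\<^sub>R a" "t *\<^sub>R b"] by simp
      also have "\<dots> \<le> h * norm a + h * norm b"
        using that by (intro add_mono mult_right_mono) auto
      also have "\<dots> = h * (norm u + norm v)"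
        using that by (simp flip: distrib_left)
      also have "\<dots> < h * (2 * (norm u + norm v + 1))"
        using h by (intro mult_strict_left_mono) (smt (verit) norm_ge_zero)+
      also have "\<dots> = d" using pos by (simp add: h_def)
      finally show ?thesis .
    qed
    have inS: "x + s *\<^sub>R a + t *\<^sub>R b \<in> S"
      if "s \<in> {0..h}" "t \<in> {0..h}" "norm a + norm b = norm u + norm v" for s t a b
      using near[OF that] d3 by (auto simp: d_def dist_commute subset_iff)
    obtain s t where st: "s \<in> {0..h}" "t \<in> {0..h}"
      "f (x + h *\<^sub>R u + h *\<^sub>R v) - f (x + h *\<^sub>R u) - f (x + h *\<^sub>R v) + f x =
       h * h * ?DD u (x + s *\<^sub>R u + t *\<^sub>R v) v"
      using second_difference_mean_value[OF f h, of x u v] inS by blast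
    obtain s' t' where st': "s' \<in> {0..h}" "t' \<in> {0..h}"
      "f (x + h *\<^sub>R v + h *\<^sub>R u) - f (x + h *\<^sub>R v) - f (x + h *\<^sub>R u) + f x =
       h * h * ?DD v (x + s' *\<^sub>R v + t' *\<^sub>R u) u"
      using second_difference_mean_value[OF f h, of x v u] inS[of _ _ v u]
      by (auto simp: add.commute[of "norm v"])
    have sw: "x + h *\<^sub>R v + h *\<^sub>R u = x + h *\<^sub>R u + h *\<^sub>R v" by simp
    have "h * h * ?DD u (x + s *\<^sub>R u + t *\<^sub>R v) v = h * h * ?DD v (x + s' *\<^sub>R v + t' *\<^sub>R u) u"
      using st(3) st'(3) unfolding sw by linarith
    then have eq: "?DD u (x + s *\<^sub>R u + t *\<^sub>R v) v = ?DD v (x + s' *\<^sub>R v + t' *\<^sub>R u) u"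
      using h by simp
    have "dist (?DD u (x + s *\<^sub>R u + t *\<^sub>R v) v) (?DD u x v) < r / 2"
      by (rule d1(2)) (use near[OF st(1,2), of u v] in \<open>simp add: d_def\<close>)
    moreover have "dist (?DD v (x + s' *\<^sub>R v + t' *\<^sub>R u) u) (?DD v x u) < r / 2"
      by (rule d2(2)) (use near[OF st'(1,2), of v u] in \<open>simp add: d_def\<close>)
    ultimately show ?thesis
      using eq unfolding dist_real_def by linarith
  qed
  then have "\<bar>?DD u x v - ?DD v x u\<bar> \<le> 0"
    by (rule field_le_epsilon)
  then show ?thesis by simp
qed

section \<open>Smooth functions and vector fields on a manifold\<close>

lemma smooth_atlas_chart:
  assumes "smooth_atlas A" "(U, \<phi>) \<in> A"
  shows "open U" "open (\<phi> ` U)" "inj_on \<phi> U"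
proof -
  show "open U" "open (\<phi> ` U)" using assms by (auto simp: smooth_atlas_def)
  have "homeomorphism U (\<phi> ` U) \<phi> (inv_into U \<phi>)" using assms by (auto simp: smooth_atlas_def)
  then show "inj_on \<phi> U" by (metis homeomorphism_apply1 inj_on_inverseI)
qed

lemma smooth_atlas_cover:
  assumes "smooth_atlas A"
  obtains U \<phi> where "(U, \<phi>) \<in> A" "p \<in> U"
proof -
  have "p \<in> (\<Union>(U, \<phi>)\<in>A. U)" using assms by (simp add: smooth_atlas_def)
  then show thesis using that by auto
qed

lemma smooth_funs_chart:
  "f \<in> smooth_funs A \<Longrightarrow> (U, \<phi>) \<in> A \<Longrightarrow> smooth_on (\<phi> ` U) (\<lambda>x. f (inv_into U \<phi> x))"
  by (auto simp: smooth_funs_def o_def)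

lemma smooth_funsI:
  "(\<And>U \<phi>. (U, \<phi>) \<in> A \<Longrightarrow> smooth_on (\<phi> ` U) (\<lambda>x. f (inv_into U \<phi> x))) \<Longrightarrow> f \<in> smooth_funs A"
  by (auto simp: smooth_funs_def o_def)

lemma smooth_funs_const: "smooth_atlas A \<Longrightarrow> (\<lambda>p. c) \<in> smooth_funs A"
  by (rule smooth_funsI, rule smooth_on_const) (auto intro: smooth_atlas_chart(2))

lemma smooth_funs_add:
  "smooth_atlas A \<Longrightarrow> f \<in> smooth_funs A \<Longrightarrow> g \<in> smooth_funs A \<Longrightarrow> (\<lambda>p. f p + g p) \<in> smooth_funs A"
  by (rule smooth_funsI, rule smooth_on_add) (auto intro: smooth_atlas_chart(2) smooth_funs_chart)

lemma smooth_funs_diff: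
  "smooth_atlas A \<Longrightarrow> f \<in> smooth_funs A \<Longrightarrow> g \<in> smooth_funs A \<Longrightarrow> (\<lambda>p. f p - g p) \<in> smooth_funs A"
  by (rule smooth_funsI, rule smooth_on_diff) (auto intro: smooth_atlas_chart(2) smooth_funs_chart)

lemma smooth_funs_mult:
  "smooth_atlas A \<Longrightarrow> f \<in> smooth_funs A \<Longrightarrow> g \<in> smooth_funs A \<Longrightarrow> (\<lambda>p. f p * g p) \<in> smooth_funs A"
  by (rule smooth_funsI, rule smooth_on_mult) (auto intro: smooth_atlas_chart(2) smooth_funs_chart)

lemma smooth_funs_uminus:
  assumes "smooth_atlas A" "f \<in> smooth_funs A"
  shows "(\<lambda>p. - f p) \<in> smooth_funs A"
  using smooth_funs_diff[OF assms(1) smooth_funs_const[OF assms(1), of 0] assms(2)] by simp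

lemma smooth_funs_sum:
  "smooth_atlas A \<Longrightarrow> (\<And>i. i \<in> F \<Longrightarrow> f i \<in> smooth_funs A) \<Longrightarrow> (\<lambda>p. \<Sum>i\<in>F. f i p) \<in> smooth_funs A"
  by (rule smooth_funsI, rule smooth_on_sum) (auto intro: smooth_atlas_chart(2) smooth_funs_chart)

text \<open>The tangent vector at \<open>p\<close> with components \<open>w\<close> in the chart; like every tangent vector it is 0 on
  functions that are not smooth.\<close>

definition chart_deriv ::
  "('p, 'm::euclidean_space) atlas \<Rightarrow> 'p set \<Rightarrow> ('p \<Rightarrow> 'm) \<Rightarrow> 'p \<Rightarrow> 'm \<Rightarrow> 'p tvec" where
  "chart_deriv A U \<phi> p w = (\<lambda>f. if f \<in> smooth_funs A
     then frechet_derivative (\<lambda>x. f (inv_into U \<phi> x)) (at (\<phi> p)) w else 0)"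

lemma smooth_fun_has_derivative:
  assumes "smooth_atlas A" "(U, \<phi>) \<in> A" "p \<in> U" "f \<in> smooth_funs A"
  shows "((\<lambda>x. f (inv_into U \<phi> x)) has_derivative
    frechet_derivative (\<lambda>x. f (inv_into U \<phi> x)) (at (\<phi> p))) (at (\<phi> p))"
  by (rule smooth_on_has_derivative[OF smooth_atlas_chart(2) smooth_funs_chart])
    (use assms in auto)

lemma chart_deriv_linear:
  assumes "smooth_atlas A" "(U, \<phi>) \<in> A" "p \<in> U"
  shows "linear (\<lambda>w. chart_deriv A U \<phi> p w f)"
proof (cases "f \<in> smooth_funs A")
  case True
  then show ?thesis
    using has_derivative_linear[OF smooth_fun_has_derivative[OF assms]] by (simp add: chart_deriv_def)
next
  case False
  then show ?thesis by (simp add: chart_deriv_def linear_zero module_hom_zero)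
qed

lemma tangent_space_chart:
  assumes "v \<in> tangent_space A p" "(U, \<phi>) \<in> A" "p \<in> U"
  obtains w where "v = chart_deriv A U \<phi> p w"
proof -
  obtain w where "\<forall>f\<in>smooth_funs A. v f = frechet_derivative (f \<circ> inv_into U \<phi>) (at (\<phi> p)) w"
    using assms unfolding tangent_space_def by blast
  then have "v = chart_deriv A U \<phi> p w"
    using assms(1) by (auto simp: chart_deriv_def tangent_space_def o_def)
  then show thesis by (rule that)
qed

lemma vfields_chart:
  assumes A: "smooth_atlas A" and "X \<in> vfields A" "(U, \<phi>) \<in> A"
  obtains W where "smooth_on (\<phi> ` U) W" "\<And>p. p \<in> U \<Longrightarrow> X p = chart_deriv A U \<phi> p (W (\<phi> p))"
    "\<And>x f. x \<in> \<phi> ` U \<Longrightarrow> f \<in> smooth_funs A \<Longrightarrow>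
       X (inv_into U \<phi> x) f = frechet_derivative (\<lambda>x. f (inv_into U \<phi> x)) (at x) (W x)"
proof -
  obtain W where W: "smooth_on (\<phi> ` U) W" "\<forall>p\<in>U. \<forall>f\<in>smooth_funs A.
      X p f = frechet_derivative (f \<circ> inv_into U \<phi>) (at (\<phi> p)) (W (\<phi> p))"
    using assms unfolding vfields_def by blast
  have "X p = chart_deriv A U \<phi> p (W (\<phi> p))" if "p \<in> U" for p
    using W(2) assms(2) that by (auto simp: chart_deriv_def vfields_def o_def)
  moreover have "X (inv_into U \<phi> x) f = frechet_derivative (\<lambda>x. f (inv_into U \<phi> x)) (at x) (W x)"
    if "x \<in> \<phi> ` U" "f \<in> smooth_funs A" for x f
    using W(2) that by (auto simp: o_def inv_into_f_f[OF smooth_atlas_chart(3)[OF A assms(3)]])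
  ultimately show thesis using W(1) that by blast
qed

lemma vfieldsI:
  assumes "\<And>p f. f \<notin> smooth_funs A \<Longrightarrow> X p f = 0"
    and "\<And>U \<phi>. (U, \<phi>) \<in> A \<Longrightarrow> \<exists>W. smooth_on (\<phi> ` U) W \<and>
        (\<forall>p\<in>U. \<forall>f\<in>smooth_funs A. X p f = chart_deriv A U \<phi> p (W (\<phi> p)) f)"
  shows "X \<in> vfields A"
  using assms unfolding vfields_def by (fastforce simp: chart_deriv_def o_def)

lemma vfields_nonsmooth: "X \<in> vfields A \<Longrightarrow> f \<notin> smooth_funs A \<Longrightarrow> X p f = 0"
  by (simp add: vfields_def)

text \<open>In a chart, \<open>X f\<close> is the derivative of \<open>f\<close> along the smooth component function of \<open>X\<close>.\<close>

lemma vfields_smooth: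
  assumes "smooth_atlas A" "X \<in> vfields A" "f \<in> smooth_funs A"
  shows "(\<lambda>p. X p f) \<in> smooth_funs A"
proof (rule smooth_funsI)
  fix U \<phi> assume U: "(U, \<phi>) \<in> A"
  obtain W where W: "smooth_on (\<phi> ` U) W" "\<And>x f. x \<in> \<phi> ` U \<Longrightarrow> f \<in> smooth_funs A \<Longrightarrow>
       X (inv_into U \<phi> x) f = frechet_derivative (\<lambda>x. f (inv_into U \<phi> x)) (at x) (W x)"
    using vfields_chart[OF assms(1,2) U] by metis
  note op = smooth_atlas_chart(2)[OF assms(1) U]
  show "smooth_on (\<phi> ` U) (\<lambda>x. X (inv_into U \<phi> x) f)"
    by (rule smooth_on_cong[OF op _ smooth_on_derivative_along[OF op smooth_funs_chart[OF assms(3) U] W(1)]])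
      (simp add: W(2) assms(3))
qed

lemma vfields_add:
  assumes "smooth_atlas A" "X \<in> vfields A" "f \<in> smooth_funs A" "g \<in> smooth_funs A"
  shows "X p (\<lambda>q. f q + g q) = X p f + X p g"
proof -
  obtain U \<phi> where U: "(U, \<phi>) \<in> A" "p \<in> U" using smooth_atlas_cover[OF assms(1)] .
  obtain W where W: "\<And>p. p \<in> U \<Longrightarrow> X p = chart_deriv A U \<phi> p (W (\<phi> p))"
    using vfields_chart[OF assms(1,2) U(1)] by metis
  note hd = smooth_fun_has_derivative[OF assms(1) U]
  show ?thesis
    using fun_cong[OF frechet_derivative_at[OF has_derivative_add[OF hd[OF assms(3)] hd[OF assms(4)]]],
        of "W (\<phi> p)"] smooth_funs_add[OF assms(1,3,4)] assms
    by (simp add: W[OF U(2)] chart_deriv_def)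
qed

lemma vfields_mult:
  assumes "smooth_atlas A" "X \<in> vfields A" "f \<in> smooth_funs A" "g \<in> smooth_funs A"
  shows "X p (\<lambda>q. f q * g q) = X p f * g p + f p * X p g"
proof -
  obtain U \<phi> where U: "(U, \<phi>) \<in> A" "p \<in> U" using smooth_atlas_cover[OF assms(1)] .
  obtain W where W: "\<And>p. p \<in> U \<Longrightarrow> X p = chart_deriv A U \<phi> p (W (\<phi> p))"
    using vfields_chart[OF assms(1,2) U(1)] by metis
  note hd = smooth_fun_has_derivative[OF assms(1) U]
  have "inv_into U \<phi> (\<phi> p) = p"
    using inv_into_f_f[OF smooth_atlas_chart(3)[OF assms(1) U(1)] U(2)] .
  then show ?thesis
    using fun_cong[OF frechet_derivative_at[OF has_derivative_mult[OF hd[OF assms(3)] hd[OF assms(4)]]],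
        of "W (\<phi> p)"] smooth_funs_mult[OF assms(1,3,4)] assms
    by (simp add: W[OF U(2)] chart_deriv_def)
qed

lemma vfields_const:
  assumes "smooth_atlas A" "X \<in> vfields A"
  shows "X p (\<lambda>q. c) = 0"
proof -
  obtain U \<phi> where U: "(U, \<phi>) \<in> A" "p \<in> U" using smooth_atlas_cover[OF assms(1)] .
  obtain W where W: "\<And>p. p \<in> U \<Longrightarrow> X p = chart_deriv A U \<phi> p (W (\<phi> p))"
    using vfields_chart[OF assms(1,2) U(1)] by metis
  show ?thesis by (simp add: W[OF U(2)] chart_deriv_def)
qed

lemma vfields_uminus:
  assumes "smooth_atlas A" "X \<in> vfields A" "f \<in> smooth_funs A"
  shows "X p (\<lambda>q. - f q) = - X p f"
  using vfields_add[OF assms smooth_funs_uminus[OF assms(1,3)], of p] vfields_const[OF assms(1,2), of p 0]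
  by simp

lemma vfields_diff:
  assumes "smooth_atlas A" "X \<in> vfields A" "f \<in> smooth_funs A" "g \<in> smooth_funs A"
  shows "X p (\<lambda>q. f q - g q) = X p f - X p g"
  using vfields_add[OF assms(1,2,3) smooth_funs_uminus[OF assms(1,4)], of p] vfields_uminus[OF assms(1,2,4)]
  by simp

lemma vfields_sum:
  assumes "smooth_atlas A" "X \<in> vfields A" "\<And>i. i \<in> F \<Longrightarrow> f i \<in> smooth_funs A"
  shows "X p (\<lambda>q. \<Sum>i\<in>F. f i q) = (\<Sum>i\<in>F. X p (f i))"
  using assms(3)
proof (induction F rule: infinite_finite_induct)
  case (insert i F)
  have "X p (\<lambda>q. f i q + (\<Sum>i\<in>F. f i q)) = X p (f i) + X p (\<lambda>q. \<Sum>i\<in>F. f i q)"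
    using insert.prems by (intro vfields_add[OF assms(1,2)] smooth_funs_sum[OF assms(1)]) auto
  then show ?case using insert by simp
qed (simp_all add: vfields_const[OF assms(1,2)])

lemma vfields_vadd:
  assumes A: "smooth_atlas A" and X: "X \<in> vfields A" "Y \<in> vfields A"
  shows "vadd X Y \<in> vfields A"
proof (rule vfieldsI)
  fix U \<phi> assume U: "(U, \<phi>) \<in> A"
  obtain V where V: "smooth_on (\<phi> ` U) V" "\<And>p. p \<in> U \<Longrightarrow> X p = chart_deriv A U \<phi> p (V (\<phi> p))"
    using vfields_chart[OF A X(1) U] by metis
  obtain W where W: "smooth_on (\<phi> ` U) W" "\<And>p. p \<in> U \<Longrightarrow> Y p = chart_deriv A U \<phi> p (W (\<phi> p))"
    using vfields_chart[OF A X(2) U] by metis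
  show "\<exists>Z. smooth_on (\<phi> ` U) Z \<and> (\<forall>p\<in>U. \<forall>f\<in>smooth_funs A.
      vadd X Y p f = chart_deriv A U \<phi> p (Z (\<phi> p)) f)"
    by (rule exI[of _ "\<lambda>x. V x + W x"])
      (simp add: V W vadd_def smooth_on_add smooth_atlas_chart[OF A U] linear_add[OF chart_deriv_linear[OF A U]])
qed (use X in \<open>simp add: vadd_def vfields_nonsmooth\<close>)

lemma vfields_vscale:
  assumes A: "smooth_atlas A" and h: "h \<in> smooth_funs A" and X: "X \<in> vfields A"
  shows "vscale h X \<in> vfields A"
proof (rule vfieldsI)
  fix U \<phi> assume U: "(U, \<phi>) \<in> A"
  obtain W where W: "smooth_on (\<phi> ` U) W" "\<And>p. p \<in> U \<Longrightarrow> X p = chart_deriv A U \<phi> p (W (\<phi> p))"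
    using vfields_chart[OF A X U] by metis
  show "\<exists>Z. smooth_on (\<phi> ` U) Z \<and> (\<forall>p\<in>U. \<forall>f\<in>smooth_funs A.
      vscale h X p f = chart_deriv A U \<phi> p (Z (\<phi> p)) f)"
    by (rule exI[of _ "\<lambda>x. h (inv_into U \<phi> x) *\<^sub>R W x"])
      (simp add: W vscale_def smooth_on_scaleR smooth_funs_chart[OF h U] smooth_atlas_chart[OF A U]
        linear_scale[OF chart_deriv_linear[OF A U]] inv_into_f_f[OF smooth_atlas_chart(3)[OF A U]])
qed (use X in \<open>simp add: vscale_def vfields_nonsmooth\<close>)

definition lincomb :: "'i set \<Rightarrow> ('i \<Rightarrow> 'p \<Rightarrow> real) \<Rightarrow> ('i \<Rightarrow> 'p vfield) \<Rightarrow> 'p vfield" where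
  "lincomb F h X = (\<lambda>p f. \<Sum>i\<in>F. h i p * X i p f)"

lemma lincomb_insert:
  "finite F \<Longrightarrow> i \<notin> F \<Longrightarrow> lincomb (insert i F) h X = vadd (vscale (h i) (X i)) (lincomb F h X)"
  by (simp add: lincomb_def vadd_def vscale_def)

lemma vfields_zero: "smooth_atlas A \<Longrightarrow> (\<lambda>p f. 0) \<in> vfields A"
  by (rule vfieldsI) (auto intro!: exI[of _ "\<lambda>x. 0"] smooth_on_const smooth_atlas_chart
      simp: linear_0[OF chart_deriv_linear])

lemma vfields_lincomb:
  assumes A: "smooth_atlas A" and "finite F" "\<And>i. i \<in> F \<Longrightarrow> h i \<in> smooth_funs A"
    "\<And>i. i \<in> F \<Longrightarrow> X i \<in> vfields A"
  shows "lincomb F h X \<in> vfields A"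
  using assms(2-)
proof (induction F)
  case empty
  then show ?case by (simp add: lincomb_def vfields_zero A)
next
  case (insert i F)
  then show ?case by (simp add: lincomb_insert vfields_vadd vfields_vscale A)
qed

text \<open>The product rule: differentiating \<open>W\<close> gives a first-order derivative of \<open>f\<close>, differentiating the
  rest gives the Hessian of \<open>f\<close> applied to \<open>W x\<close> and \<open>v\<close>.\<close>

lemma derivative_of_derivative_along:
  fixes f :: "'a::euclidean_space \<Rightarrow> real"
  assumes S: "open S" "x \<in> S" and f: "smooth_on S f" and W: "smooth_on S W"
  shows "frechet_derivative (\<lambda>y. frechet_derivative f (at y) (W y)) (at x) v =
    frechet_derivative f (at x) (frechet_derivative W (at x) v) +
    (\<Sum>b\<in>Basis. \<Sum>c\<in>Basis. (W x \<bullet> b) * (v \<bullet> c) *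
       frechet_derivative (\<lambda>y. frechet_derivative f (at y) b) (at x) c)"
proof -
  let ?D = "\<lambda>y. frechet_derivative f (at y)"
  have hD: "((\<lambda>y. ?D y b) has_derivative frechet_derivative (\<lambda>y. ?D y b) (at x)) (at x)" for b
    by (rule smooth_on_has_derivative[OF S(1) smooth_on_frechet_derivative[OF f] S(2)])
  have hW: "((\<lambda>y. W y \<bullet> b) has_derivative (\<lambda>v. frechet_derivative W (at x) v \<bullet> b)) (at x)" for b
    by (rule has_derivative_inner_left[OF smooth_on_has_derivative[OF S(1) W S(2)]])
  have "((\<lambda>y. \<Sum>b\<in>Basis. (W y \<bullet> b) * ?D y b) has_derivative
     (\<lambda>v. \<Sum>b\<in>Basis. (W x \<bullet> b) * frechet_derivative (\<lambda>y. ?D y b) (at x) v +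
       (frechet_derivative W (at x) v \<bullet> b) * ?D x b)) (at x)"
    by (rule has_derivative_sum) (rule has_derivative_mult[OF hW hD])
  moreover have "(\<Sum>b\<in>Basis. (W y \<bullet> b) * ?D y b) = ?D y (W y)" if "y \<in> S" for y
    using linear_euclidean_sum[OF smooth_on_linear_derivative[OF S(1) f that], of "W y"] by simp
  ultimately have "((\<lambda>y. ?D y (W y)) has_derivative
     (\<lambda>v. \<Sum>b\<in>Basis. (W x \<bullet> b) * frechet_derivative (\<lambda>y. ?D y b) (at x) v +
       (frechet_derivative W (at x) v \<bullet> b) * ?D x b)) (at x)"
    by (rule has_derivative_transform_within_open[OF _ S])
  note fun_cong[OF frechet_derivative_at[OF this, symmetric], of v]
  then have "frechet_derivative (\<lambda>y. ?D y (W y)) (at x) v =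
     (\<Sum>b\<in>Basis. (W x \<bullet> b) * frechet_derivative (\<lambda>y. ?D y b) (at x) v +
       (frechet_derivative W (at x) v \<bullet> b) * ?D x b)"
    .
  moreover have "frechet_derivative (\<lambda>y. ?D y b) (at x) v =
      (\<Sum>c\<in>Basis. (v \<bullet> c) * frechet_derivative (\<lambda>y. ?D y b) (at x) c)" for b
    using linear_euclidean_sum[OF has_derivative_linear[OF hD], of b v] by (simp only: real_scaleR_def)
  moreover have "(\<Sum>b\<in>Basis. (frechet_derivative W (at x) v \<bullet> b) * ?D x b) =
      ?D x (frechet_derivative W (at x) v)"
    using linear_euclidean_sum[OF smooth_on_linear_derivative[OF S(1) f S(2)],
        of "frechet_derivative W (at x) v"] by simp
  ultimately show ?thesis
    by (simp only: sum.distrib sum_distrib_left mult.assoc add.commute)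
qed

lemma vfields_iterated_derivative:
  assumes A: "smooth_atlas A" and U: "(U, \<phi>) \<in> A" "p \<in> U" and f: "f \<in> smooth_funs A"
    and X: "X p = chart_deriv A U \<phi> p v"
    and Y: "Y \<in> vfields A" and W: "smooth_on (\<phi> ` U) W"
      "\<And>x. x \<in> \<phi> ` U \<Longrightarrow>
         Y (inv_into U \<phi> x) f = frechet_derivative (\<lambda>x. f (inv_into U \<phi> x)) (at x) (W x)"
  shows "X p (\<lambda>q. Y q f) =
    frechet_derivative (\<lambda>x. f (inv_into U \<phi> x)) (at (\<phi> p)) (frechet_derivative W (at (\<phi> p)) v) +
    (\<Sum>b\<in>Basis. \<Sum>c\<in>Basis. (W (\<phi> p) \<bullet> b) * (v \<bullet> c) *
       frechet_derivative (\<lambda>y. frechet_derivative (\<lambda>x. f (inv_into U \<phi> x)) (at y) b) (at (\<phi> p)) c)"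
proof -
  let ?f = "\<lambda>x. f (inv_into U \<phi> x)" and ?x = "\<phi> p"
  note op = smooth_atlas_chart(2)[OF A U(1)]
  have x: "?x \<in> \<phi> ` U" using U by simp
  have Yf: "(\<lambda>q. Y q f) \<in> smooth_funs A" by (rule vfields_smooth[OF A Y f])
  then have "X p (\<lambda>q. Y q f) = frechet_derivative (\<lambda>x. Y (inv_into U \<phi> x) f) (at ?x) v"
    by (simp add: X chart_deriv_def)
  also have "frechet_derivative (\<lambda>x. Y (inv_into U \<phi> x) f) (at ?x) =
      frechet_derivative (\<lambda>x. frechet_derivative ?f (at x) (W x)) (at ?x)"
    by (rule frechet_derivative_transform_within_open[OF _ op x W(2)])
      (rule differentiableI[OF smooth_fun_has_derivative[OF A U Yf]])
  also note derivative_of_derivative_along[OF op x smooth_funs_chart[OF f U(1)] W(1)]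
  finally show ?thesis .
qed

text \<open>In a chart the Hessian terms of \<open>X (Y f)\<close> and \<open>Y (X f)\<close> cancel by the symmetry of second
  derivatives, and what remains is the derivative of \<open>f\<close> in the direction \<open>Z\<close>, the commutator of
  the component functions.\<close>

lemma vfields_bracket:
  assumes A: "smooth_atlas A" and X: "X \<in> vfields A" "Y \<in> vfields A"
  shows "bracket A X Y \<in> vfields A"
proof (rule vfieldsI)
  show "bracket A X Y p f = 0" if "f \<notin> smooth_funs A" for p f
    using that by (simp add: bracket_def)
next
  fix U \<phi> assume U: "(U, \<phi>) \<in> A"
  let ?S = "\<phi> ` U"
  note op = smooth_atlas_chart(2)[OF A U]
  obtain V where V: "smooth_on ?S V" "\<And>p. p \<in> U \<Longrightarrow> X p = chart_deriv A U \<phi> p (V (\<phi> p))"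
    "\<And>x f. x \<in> ?S \<Longrightarrow> f \<in> smooth_funs A \<Longrightarrow>
       X (inv_into U \<phi> x) f = frechet_derivative (\<lambda>x. f (inv_into U \<phi> x)) (at x) (V x)"
    using vfields_chart[OF A X(1) U] by metis
  obtain W where W: "smooth_on ?S W" "\<And>p. p \<in> U \<Longrightarrow> Y p = chart_deriv A U \<phi> p (W (\<phi> p))"
    "\<And>x f. x \<in> ?S \<Longrightarrow> f \<in> smooth_funs A \<Longrightarrow>
       Y (inv_into U \<phi> x) f = frechet_derivative (\<lambda>x. f (inv_into U \<phi> x)) (at x) (W x)"
    using vfields_chart[OF A X(2) U] by metis
  define Z where "Z = (\<lambda>x. frechet_derivative W (at x) (V x) - frechet_derivative V (at x) (W x))"
  have "bracket A X Y p f = chart_deriv A U \<phi> p (Z (\<phi> p)) f" if p: "p \<in> U" and f: "f \<in> smooth_funs A" for p f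
  proof -
    let ?f = "\<lambda>x. f (inv_into U \<phi> x)" and ?x = "\<phi> p"
    let ?H = "\<lambda>b c. frechet_derivative (\<lambda>y. frechet_derivative ?f (at y) b) (at ?x) c"
    have x: "?x \<in> ?S" using p by simp
    note f' = smooth_funs_chart[OF f U]
    have H: "?H b c = ?H c b" for b c
      by (rule second_derivative_commute[OF op f' x])
    have "(\<Sum>b\<in>Basis. \<Sum>c\<in>Basis. (W ?x \<bullet> b) * (V ?x \<bullet> c) * ?H b c) =
      (\<Sum>c\<in>Basis. \<Sum>b\<in>Basis. (W ?x \<bullet> b) * (V ?x \<bullet> c) * ?H b c)"
      by (rule sum.swap)
    also have "\<dots> = (\<Sum>b\<in>Basis. \<Sum>c\<in>Basis. (V ?x \<bullet> b) * (W ?x \<bullet> c) * ?H b c)"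
      by (intro sum.cong refl) (simp only: H[of _ _] mult.commute[of "V ?x \<bullet> _"])
    finally have "X p (\<lambda>q. Y q f) - Y p (\<lambda>q. X q f) =
       frechet_derivative ?f (at ?x) (frechet_derivative W (at ?x) (V ?x)) -
       frechet_derivative ?f (at ?x) (frechet_derivative V (at ?x) (W ?x))"
      using vfields_iterated_derivative[where X = X and Y = Y, OF A U p f V(2)[OF p] X(2) W(1) W(3)[OF _ f]]
        vfields_iterated_derivative[where X = Y and Y = X, OF A U p f W(2)[OF p] X(1) V(1) V(3)[OF _ f]]
      by linarith
    also have "\<dots> = frechet_derivative ?f (at ?x) (Z ?x)"
      unfolding Z_def using linear_diff[OF smooth_on_linear_derivative[OF op f' x]] by simp
    finally show ?thesis
      using f by (simp add: bracket_def chart_deriv_def)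
  qed
  moreover have "smooth_on ?S Z"
    unfolding Z_def using op V(1) W(1) by (intro smooth_on_diff smooth_on_derivative_along)
  ultimately show "\<exists>Z. smooth_on (\<phi> ` U) Z \<and> (\<forall>p\<in>U. \<forall>f\<in>smooth_funs A.
      bracket A X Y p f = chart_deriv A U \<phi> p (Z (\<phi> p)) f)"
    by blast
qed

section \<open>Tangent spaces and one-forms\<close>

lemma tangent_spaceI:
  assumes "\<And>f. f \<notin> smooth_funs A \<Longrightarrow> v f = 0"
    "\<And>U \<phi>. (U, \<phi>) \<in> A \<Longrightarrow> p \<in> U \<Longrightarrow> \<exists>w. v = chart_deriv A U \<phi> p w"
  shows "v \<in> tangent_space A p"
  using assms unfolding tangent_space_def by (fastforce simp: chart_deriv_def o_def)

lemma vfields_tangent: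
  assumes A: "smooth_atlas A" and X: "X \<in> vfields A"
  shows "X p \<in> tangent_space A p"
proof (rule tangent_spaceI)
  show "X p f = 0" if "f \<notin> smooth_funs A" for f
    using vfields_nonsmooth[OF X that] .
  show "\<exists>w. X p = chart_deriv A U \<phi> p w" if "(U, \<phi>) \<in> A" "p \<in> U" for U \<phi>
    using vfields_chart[OF A X that(1)] that(2) by metis
qed

lemma tangent_space_tcomb:
  assumes A: "smooth_atlas A" and v: "v \<in> tangent_space A p" "w \<in> tangent_space A p"
  shows "tcomb a v b w \<in> tangent_space A p"
proof (rule tangent_spaceI)
  show "tcomb a v b w f = 0" if "f \<notin> smooth_funs A" for f
    using v that by (simp add: tcomb_def tangent_space_def)
  fix U \<phi> assume U: "(U, \<phi>) \<in> A" "p \<in> U"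
  obtain x y where x: "v = chart_deriv A U \<phi> p x" and y: "w = chart_deriv A U \<phi> p y"
    using tangent_space_chart[OF v(1) U] tangent_space_chart[OF v(2) U] by metis
  note lin = chart_deriv_linear[OF A U]
  have "tcomb a v b w = chart_deriv A U \<phi> p (a *\<^sub>R x + b *\<^sub>R y)"
    by (rule ext) (simp add: tcomb_def x y linear_add[OF lin] linear_scale[OF lin])
  then show "\<exists>w'. tcomb a v b w = chart_deriv A U \<phi> p w'" by blast
qed

lemma tangent_space_zero: "smooth_atlas A \<Longrightarrow> (\<lambda>f. 0) \<in> tangent_space A p"
  using vfields_tangent[OF _ vfields_zero] by blast

lemma tangent_space_sum:
  assumes A: "smooth_atlas A" and "\<And>i. i \<in> F \<Longrightarrow> v i \<in> tangent_space A p"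
  shows "(\<lambda>f. \<Sum>i\<in>F. c i * v i f) \<in> tangent_space A p"
  using assms(2)
proof (induction F rule: infinite_finite_induct)
  case (insert i F)
  have "(\<lambda>f. \<Sum>i\<in>insert i F. c i * v i f) = tcomb (c i) (v i) 1 (\<lambda>f. \<Sum>i\<in>F. c i * v i f)"
    using insert by (simp add: tcomb_def)
  then show ?case using insert tangent_space_tcomb[OF A] by simp
qed (simp_all add: tangent_space_zero A)

text \<open>Linearity is defined by binary combinations, whence the induction; the lemma yields the evaluation of one-forms on
  combinations of frame vectors.\<close>

lemma linear_form_on_sum:
  assumes A: "smooth_atlas A" and k: "linear_form_on (tangent_space A p) k"
    and "\<And>i. i \<in> F \<Longrightarrow> v i \<in> tangent_space A p"
  shows "k (\<lambda>f. \<Sum>i\<in>F. c i * v i f) = (\<Sum>i\<in>F. c i * k (v i))"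
proof -
  have z: "k (\<lambda>f. 0) = 0"
  proof -
    have "k (tcomb 0 (\<lambda>f. 0) 0 (\<lambda>f. 0)) = 0"
      using k tangent_space_zero[OF A] unfolding linear_form_on_def by simp
    then show ?thesis by (simp add: tcomb_def)
  qed
  show ?thesis
    using assms(3)
  proof (induction F rule: infinite_finite_induct)
    case (insert i F)
    have "(\<lambda>f. \<Sum>i\<in>insert i F. c i * v i f) = tcomb (c i) (v i) 1 (\<lambda>f. \<Sum>i\<in>F. c i * v i f)"
      using insert by (simp add: tcomb_def)
    moreover have "(\<lambda>f. \<Sum>i\<in>F. c i * v i f) \<in> tangent_space A p"
      using insert by (intro tangent_space_sum A) auto
    ultimately show ?case using insert k unfolding linear_form_on_def by simp
  qed (simp_all add: z)
qed

lemma one_form_sum: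
  assumes "smooth_atlas A" "one_form A \<alpha>" "\<And>i. i \<in> F \<Longrightarrow> v i \<in> tangent_space A p"
  shows "\<alpha> p [\<lambda>f. \<Sum>i\<in>F. c i * v i f] = (\<Sum>i\<in>F. c i * \<alpha> p [v i])"
  using linear_form_on_sum[of A p "\<lambda>v. \<alpha> p [v]" F v c] assms by (simp add: one_form_def)

lemma one_form_tcomb:
  assumes "one_form A \<alpha>" "v \<in> tangent_space A p" "w \<in> tangent_space A p"
  shows "\<alpha> p [\<lambda>f. a * v f + b * w f] = a * \<alpha> p [v] + b * \<alpha> p [w]"
  using assms unfolding one_form_def linear_form_on_def tcomb_def by simp

lemma one_form_vadd:
  assumes "smooth_atlas A" "one_form A \<alpha>" "X \<in> vfields A" "Y \<in> vfields A"
  shows "\<alpha> p [vadd X Y p] = \<alpha> p [X p] + \<alpha> p [Y p]"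
  using one_form_tcomb[OF assms(2) vfields_tangent[OF assms(1,3)] vfields_tangent[OF assms(1,4)], of p 1 1]
  by (simp add: vadd_def)

lemma one_form_vdiff:
  assumes "smooth_atlas A" "one_form A \<alpha>" "X \<in> vfields A" "Y \<in> vfields A"
  shows "\<alpha> p [vdiff X Y p] = \<alpha> p [X p] - \<alpha> p [Y p]"
  using one_form_tcomb[OF assms(2) vfields_tangent[OF assms(1,3)] vfields_tangent[OF assms(1,4)], of p 1 "-1"]
  by (simp add: vdiff_def)

lemma one_form_vscale:
  assumes "smooth_atlas A" "one_form A \<alpha>" "X \<in> vfields A"
  shows "\<alpha> p [vscale h X p] = h p * \<alpha> p [X p]"
  using one_form_tcomb[OF assms(2) vfields_tangent[OF assms(1,3)] vfields_tangent[OF assms(1,3)], of p "h p" 0]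
  by (simp add: vscale_def)

lemma one_form_smooth: "one_form A \<alpha> \<Longrightarrow> X \<in> vfields A \<Longrightarrow> (\<lambda>p. \<alpha> p [X p]) \<in> smooth_funs A"
  by (simp add: one_form_def eval_form_def)

lemma one_form_scale:
  assumes "smooth_atlas A" "one_form A \<alpha>"
  shows "one_form A (\<lambda>p vs. c * \<alpha> p vs)"
  using assms smooth_funs_mult[OF assms(1) smooth_funs_const[OF assms(1)]]
  by (auto simp: one_form_def linear_form_on_def eval_form_def algebra_simps)

lemma vfields_vdiff:
  assumes "smooth_atlas A" "X \<in> vfields A" "Y \<in> vfields A"
  shows "vdiff X Y \<in> vfields A"
  using vfields_vadd[OF assms(1,2) vfields_vscale[OF assms(1) smooth_funs_const[OF assms(1), of "-1"] assms(3)]]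
  by (simp add: vadd_def vscale_def vdiff_def)

lemma ext_d_one_form:
  "ext_d A \<alpha> [X, Y] p = X p (\<lambda>q. \<alpha> q [Y q]) - Y p (\<lambda>q. \<alpha> q [X q]) - \<alpha> p [bracket A X Y p]"
  by (simp add: ext_d_def eval_form_def remove_nth_def lessThan_Suc numeral_2_eq_2)

lemma ext_d_one_form_scale:
  assumes A: "smooth_atlas A" and "one_form A \<alpha>" "X \<in> vfields A" "Y \<in> vfields A"
  shows "ext_d A (\<lambda>p vs. c * \<alpha> p vs) [X, Y] p = c * ext_d A \<alpha> [X, Y] p"
proof -
  have "Z p (\<lambda>q. c * \<alpha> q [W q]) = c * Z p (\<lambda>q. \<alpha> q [W q])"
    if "Z \<in> vfields A" "W \<in> vfields A" for Z W
    using vfields_mult[OF A that(1) smooth_funs_const[OF A] one_form_smooth[OF assms(2) that(2)], of p c]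
    by (simp add: vfields_const[OF A that(1)])
  then show ?thesis
    using assms by (simp add: ext_d_one_form right_diff_distrib)
qed

section \<open>Linear connections\<close>

lemma linear_connection_zero:
  assumes A: "smooth_atlas A" and D: "linear_connection A D" and X: "X \<in> vfields A"
  shows "D (\<lambda>p f. 0) X = (\<lambda>p f. 0)" "D X (\<lambda>p f. 0) = (\<lambda>p f. 0)"
proof -
  note c0 = smooth_funs_const[OF A, of 0]
  have "D (vscale (\<lambda>p. 0) X) X = vscale (\<lambda>p. 0) (D X X)"
    "D X (vscale (\<lambda>p. 0) X) = vadd (vscale (\<lambda>p. X p (\<lambda>p. 0)) X) (vscale (\<lambda>p. 0) (D X X))"
    using D X c0 unfolding linear_connection_def by blast+
  then show "D (\<lambda>p f. 0) X = (\<lambda>p f. 0)" "D X (\<lambda>p f. 0) = (\<lambda>p f. 0)"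
    by (simp_all add: vscale_def vadd_def vfields_const[OF A X])
qed

lemma linear_connection_lincomb_left:
  assumes A: "smooth_atlas A" and D: "linear_connection A D" and Y: "Y \<in> vfields A"
    and "finite F" "\<And>i. i \<in> F \<Longrightarrow> h i \<in> smooth_funs A" "\<And>i. i \<in> F \<Longrightarrow> X i \<in> vfields A"
  shows "D (lincomb F h X) Y = lincomb F h (\<lambda>i. D (X i) Y)"
  using assms(4-)
proof (induction F)
  case empty
  then show ?case by (simp add: lincomb_def linear_connection_zero[OF A D Y])
next
  case (insert i F)
  have "D (vadd (vscale (h i) (X i)) (lincomb F h X)) Y = vadd (D (vscale (h i) (X i)) Y) (D (lincomb F h X) Y)"
    using D Y insert unfolding linear_connection_def by (simp add: vfields_vscale vfields_lincomb A)
  also have "D (vscale (h i) (X i)) Y = vscale (h i) (D (X i) Y)"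
    using D Y insert unfolding linear_connection_def by simp
  finally show ?case using insert by (simp add: lincomb_insert)
qed

lemma linear_connection_lincomb_right:
  assumes A: "smooth_atlas A" and D: "linear_connection A D" and X: "X \<in> vfields A"
    and "finite F" "\<And>i. i \<in> F \<Longrightarrow> h i \<in> smooth_funs A" "\<And>i. i \<in> F \<Longrightarrow> Y i \<in> vfields A"
  shows "D X (lincomb F h Y) = vadd (lincomb F (\<lambda>i p. X p (h i)) Y) (lincomb F h (\<lambda>i. D X (Y i)))"
  using assms(4-)
proof (induction F)
  case empty
  then show ?case by (simp add: lincomb_def vadd_def linear_connection_zero[OF A D X])
next
  case (insert i F)
  have "D X (vadd (vscale (h i) (Y i)) (lincomb F h Y)) = vadd (D X (vscale (h i) (Y i))) (D X (lincomb F h Y))"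
    using D X insert unfolding linear_connection_def by (simp add: vfields_vscale vfields_lincomb A)
  also have "D X (vscale (h i) (Y i)) = vadd (vscale (\<lambda>p. X p (h i)) (Y i)) (vscale (h i) (D X (Y i)))"
    using D X insert unfolding linear_connection_def by simp
  finally show ?case using insert by (simp add: lincomb_insert vadd_def algebra_simps)
qed

section \<open>Frames and Cartan's structure equations\<close>

locale smooth_frame =
  fixes A :: "('p::{t2_space, second_countable_topology}, 'm::euclidean_space) atlas"
    and N :: "nat set" and \<theta> :: "nat \<Rightarrow> 'p form" and e :: "nat \<Rightarrow> 'p vfield"
  assumes atlas: "smooth_atlas A" and N: "finite N" "card N = DIM('m)"
    and coframe: "i \<in> N \<Longrightarrow> one_form A (\<theta> i)"
    and frame: "j \<in> N \<Longrightarrow> e j \<in> vfields A"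
    and dual: "i \<in> N \<Longrightarrow> j \<in> N \<Longrightarrow> \<theta> i p [e j p] = (if i = j then 1 else 0)"
begin

lemma frame_tangent: "j \<in> N \<Longrightarrow> e j p \<in> tangent_space A p"
  by (simp add: vfields_tangent atlas frame)

lemma coord_sum:
  assumes "i \<in> N" "F \<subseteq> N"
  shows "\<theta> i p [\<lambda>f. \<Sum>j\<in>F. c j * e j p f] = (if i \<in> F then c i else 0)"
proof -
  have "\<theta> i p [\<lambda>f. \<Sum>j\<in>F. c j * e j p f] = (\<Sum>j\<in>F. c j * \<theta> i p [e j p])"
    by (rule one_form_sum[OF atlas coframe]) (use assms frame_tangent in auto)
  also have "\<dots> = (\<Sum>j\<in>F. if i = j then c j else 0)"
    by (rule sum.cong) (use assms dual in auto)
  finally show ?thesis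
    using assms finite_subset[OF _ N(1)] by simp
qed

text \<open>In a chart the tangent space at \<open>p\<close> is the image of the model space under a linear map. The preimages of the
  frame vectors are independent, since the coframe separates the frame vectors, and there are \<open>DIM(m)\<close> of them;
  so they span the model space, and the frame spans the tangent space.\<close>

lemma tangent_expand:
  assumes v: "v \<in> tangent_space A p"
  shows "v = (\<lambda>f. \<Sum>i\<in>N. \<theta> i p [v] * e i p f)"
proof -
  obtain U \<phi> where U: "(U, \<phi>) \<in> A" "p \<in> U" using smooth_atlas_cover[OF atlas] .
  let ?\<tau> = "chart_deriv A U \<phi> p"
  note lin = chart_deriv_linear[OF atlas U]
  have "\<forall>j\<in>N. \<exists>w. e j p = ?\<tau> w"
    using tangent_space_chart[OF frame_tangent U] by metis
  then obtain w where w: "\<And>j. j \<in> N \<Longrightarrow> e j p = ?\<tau> (w j)" by metis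
  obtain u where u: "v = ?\<tau> u" using tangent_space_chart[OF v U] .
  have tau_sum: "?\<tau> (\<Sum>j\<in>N. c j *\<^sub>R w j) = (\<lambda>f. \<Sum>j\<in>N. c j * e j p f)" for c
    by (rule ext) (simp add: linear_sum[OF lin] linear_scale[OF lin] w)
  have coeff: "c i = \<theta> i p [?\<tau> (\<Sum>j\<in>N. c j *\<^sub>R w j)]" if "i \<in> N" for c i
    using coord_sum[OF that order.refl, of p c] that by (simp add: tau_sum)
  have "?\<tau> 0 = (\<lambda>f. 0)" by (rule ext) (rule linear_0[OF lin])
  then have zero: "\<theta> i p [?\<tau> 0] = 0" if "i \<in> N" for i
    using coord_sum[OF that order.refl, of p "\<lambda>j. 0"] by simp
  have inj: "inj_on w N"
  proof (rule inj_onI)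
    fix i j assume ij: "i \<in> N" "j \<in> N" "w i = w j"
    then have "\<theta> i p [e i p] = \<theta> i p [e j p]" using w by simp
    then show "i = j" using dual ij by (simp split: if_splits)
  qed
  have "independent (w ` N)"
  proof (rule independent_if_scalars_zero)
    fix c x assume c: "(\<Sum>x\<in>w ` N. c x *\<^sub>R x) = 0" and "x \<in> w ` N"
    then obtain i where i: "i \<in> N" "x = w i" by blast
    have "(\<Sum>j\<in>N. c (w j) *\<^sub>R w j) = 0" using c by (simp add: sum.reindex[OF inj])
    then show "c x = 0" using coeff[OF i(1), of "\<lambda>j. c (w j)"] zero i by simp
  qed (use N in simp)
  then have "UNIV \<subseteq> span (w ` N)"
    by (intro card_ge_dim_independent) (simp_all add: card_image[OF inj] N)
  then have "u \<in> range (\<lambda>c. \<Sum>x\<in>w ` N. c x *\<^sub>R x)"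
    using span_finite[of "w ` N"] N by auto
  then obtain c where "u = (\<Sum>x\<in>w ` N. c x *\<^sub>R x)" by blast
  then have u': "u = (\<Sum>j\<in>N. c (w j) *\<^sub>R w j)" by (simp add: sum.reindex[OF inj])
  have "c (w i) = \<theta> i p [v]" if "i \<in> N" for i
    using coeff[OF that, of "\<lambda>j. c (w j)"] by (simp add: u u')
  then have "(\<lambda>f. \<Sum>i\<in>N. \<theta> i p [v] * e i p f) = (\<lambda>f. \<Sum>j\<in>N. c (w j) * e j p f)"
    by simp
  then show ?thesis
    using tau_sum[of "\<lambda>j. c (w j)"] unfolding u u' by metis
qed

lemma tangent_eqI:
  assumes "v \<in> tangent_space A p" "w \<in> tangent_space A p" "\<And>i. i \<in> N \<Longrightarrow> \<theta> i p [v] = \<theta> i p [w]"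
  shows "v = w"
  using tangent_expand[OF assms(1)] tangent_expand[OF assms(2)] assms(3) by simp

lemma vfields_eqI:
  assumes "X \<in> vfields A" "Y \<in> vfields A" "\<And>i p. i \<in> N \<Longrightarrow> \<theta> i p [X p] = \<theta> i p [Y p]"
  shows "X = Y"
  by (rule ext, rule tangent_eqI) (use assms vfields_tangent[OF atlas] in auto)

lemma coord_smooth: "i \<in> N \<Longrightarrow> X \<in> vfields A \<Longrightarrow> (\<lambda>p. \<theta> i p [X p]) \<in> smooth_funs A"
  by (simp add: one_form_smooth coframe)

lemma vfields_expand: "X \<in> vfields A \<Longrightarrow> X = lincomb N (\<lambda>i p. \<theta> i p [X p]) e"
  unfolding lincomb_def by (rule ext) (rule tangent_expand[OF vfields_tangent[OF atlas]])

lemma coord_lincomb: "i \<in> N \<Longrightarrow> F \<subseteq> N \<Longrightarrow> \<theta> i p [lincomb F h e p] = (if i \<in> F then h i p else 0)"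
  unfolding lincomb_def by (rule coord_sum)

text \<open>A linear connection is tensorial in its first argument and obeys the Leibniz rule in the second, so on the fields spanned by
  \<open>e\<^sub>a\<close>, \<open>a \<in> M\<close>, it is determined by its values on pairs of frame fields.\<close>

lemma linear_connection_eqI:
  assumes D: "linear_connection A D" and D': "linear_connection A D'" and "M \<subseteq> N"
    and eq: "\<And>i a. i \<in> N \<Longrightarrow> a \<in> M \<Longrightarrow> D (e i) (e a) = D' (e i) (e a)"
    and X: "X \<in> vfields A" and Y: "Y \<in> vfields A" "\<And>k p. k \<in> N - M \<Longrightarrow> \<theta> k p [Y p] = 0"
  shows "D X Y = D' X Y"
proof -
  let ?x = "\<lambda>i p. \<theta> i p [X p]" and ?y = "\<lambda>i p. \<theta> i p [Y p]"
  have fM: "finite M" using assms(3) N finite_subset by blast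
  have "lincomb N ?y e = lincomb M ?y e"
    unfolding lincomb_def using assms(3) Y(2) N by (intro ext sum.mono_neutral_right) auto
  then have Ye: "Y = lincomb M ?y e" using vfields_expand[OF Y(1)] by simp
  have Xa: "D X (e a) = D' X (e a)" if "a \<in> M" for a
  proof -
    have a: "a \<in> N" using that assms(3) by blast
    have "D (lincomb N ?x e) (e a) = lincomb N ?x (\<lambda>i. D (e i) (e a))"
      by (rule linear_connection_lincomb_left[OF atlas D frame[OF a] N(1)]) (simp_all add: coord_smooth X frame)
    also have "\<dots> = lincomb N ?x (\<lambda>i. D' (e i) (e a))"
      unfolding lincomb_def using eq that by simp
    also have "\<dots> = D' (lincomb N ?x e) (e a)"
      by (rule linear_connection_lincomb_left[OF atlas D' frame[OF a] N(1), symmetric])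
        (simp_all add: coord_smooth X frame)
    finally show ?thesis using vfields_expand[OF X] by simp
  qed
  have "D X (lincomb M ?y e) = vadd (lincomb M (\<lambda>i p. X p (?y i)) e) (lincomb M ?y (\<lambda>i. D X (e i)))"
    by (rule linear_connection_lincomb_right[OF atlas D X fM]) (use assms(3) in \<open>auto simp: coord_smooth Y frame\<close>)
  also have "lincomb M ?y (\<lambda>i. D X (e i)) = lincomb M ?y (\<lambda>i. D' X (e i))"
    unfolding lincomb_def using Xa by simp
  also have "vadd (lincomb M (\<lambda>i p. X p (?y i)) e) \<dots> = D' X (lincomb M ?y e)"
    by (rule linear_connection_lincomb_right[OF atlas D' X fM, symmetric])
      (use assms(3) in \<open>auto simp: coord_smooth Y frame\<close>)
  finally show ?thesis using Ye by simp
qed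

text \<open>The connection with \<open>\<nabla>e\<^sub>j = \<Sum>\<^sub>k \<psi>\<^sub>k\<^sub>j e\<^sub>k\<close>, so that
  \<open>\<psi>\<close> is its matrix of connection forms.\<close>

definition frame_conn :: "(nat \<Rightarrow> nat \<Rightarrow> 'p form) \<Rightarrow> 'p conn" where
  "frame_conn \<psi> X Y = lincomb N
     (\<lambda>k p. X p (\<lambda>q. \<theta> k q [Y q]) + (\<Sum>j\<in>N. \<psi> k j p [X p] * \<theta> j p [Y p])) e"

lemma coord_frame_conn:
  "k \<in> N \<Longrightarrow> \<theta> k p [frame_conn \<psi> X Y p] =
     X p (\<lambda>q. \<theta> k q [Y q]) + (\<Sum>j\<in>N. \<psi> k j p [X p] * \<theta> j p [Y p])"
  by (simp add: frame_conn_def coord_lincomb)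

context
  fixes \<psi> :: "nat \<Rightarrow> nat \<Rightarrow> 'p form"
  assumes psi: "\<And>k j. k \<in> N \<Longrightarrow> j \<in> N \<Longrightarrow> one_form A (\<psi> k j)"
begin

lemma frame_conn_vfields:
  assumes X: "X \<in> vfields A" and Y: "Y \<in> vfields A"
  shows "frame_conn \<psi> X Y \<in> vfields A"
  unfolding frame_conn_def
proof (rule vfields_lincomb[OF atlas N(1) _ frame])
  fix k assume k: "k \<in> N"
  have "(\<lambda>p. \<psi> k j p [X p] * \<theta> j p [Y p]) \<in> smooth_funs A" if "j \<in> N" for j
    by (rule smooth_funs_mult[OF atlas one_form_smooth[OF psi[OF k that] X] coord_smooth[OF that Y]])
  then have "(\<lambda>p. \<Sum>j\<in>N. \<psi> k j p [X p] * \<theta> j p [Y p]) \<in> smooth_funs A"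
    by (rule smooth_funs_sum[OF atlas])
  then show "(\<lambda>p. X p (\<lambda>q. \<theta> k q [Y q]) + (\<Sum>j\<in>N. \<psi> k j p [X p] * \<theta> j p [Y p])) \<in> smooth_funs A"
    by (rule smooth_funs_add[OF atlas vfields_smooth[OF atlas X coord_smooth[OF k Y]]])
qed

lemma linear_connection_frame_conn: "linear_connection A (frame_conn \<psi>)"
  unfolding linear_connection_def
proof (intro conjI ballI)
  fix X Y Z assume V: "X \<in> vfields A" "Y \<in> vfields A" "Z \<in> vfields A"
  note simps = coord_frame_conn one_form_vadd[OF atlas coframe] one_form_vadd[OF atlas psi]
    vfields_vadd atlas frame_conn_vfields
  show "frame_conn \<psi> (vadd X Y) Z = vadd (frame_conn \<psi> X Z) (frame_conn \<psi> Y Z)"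
  proof (rule vfields_eqI)
    fix i p assume i: "i \<in> N"
    have "vadd X Y p (\<lambda>q. \<theta> i q [Z q]) = X p (\<lambda>q. \<theta> i q [Z q]) + Y p (\<lambda>q. \<theta> i q [Z q])"
      by (simp add: vadd_def)
    then show "\<theta> i p [frame_conn \<psi> (vadd X Y) Z p] = \<theta> i p [vadd (frame_conn \<psi> X Z) (frame_conn \<psi> Y Z) p]"
      using V i by (simp add: simps sum.distrib algebra_simps)
  qed (use V in \<open>simp_all add: simps\<close>)
  show "frame_conn \<psi> X (vadd Y Z) = vadd (frame_conn \<psi> X Y) (frame_conn \<psi> X Z)"
    using V by (intro vfields_eqI)
      (simp_all add: simps vfields_add[OF atlas V(1)] coord_smooth sum.distrib algebra_simps)
next
  fix h X Y assume h: "h \<in> smooth_funs A" and V: "X \<in> vfields A" "Y \<in> vfields A"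
  note simps = coord_frame_conn one_form_vadd[OF atlas coframe] one_form_vscale[OF atlas coframe]
    one_form_vscale[OF atlas psi] vfields_vadd vfields_vscale vfields_smooth atlas frame_conn_vfields h
  show "frame_conn \<psi> (vscale h X) Y = vscale h (frame_conn \<psi> X Y)"
  proof (rule vfields_eqI)
    fix i p assume i: "i \<in> N"
    have "vscale h X p (\<lambda>q. \<theta> i q [Y q]) = h p * X p (\<lambda>q. \<theta> i q [Y q])" by (simp add: vscale_def)
    then show "\<theta> i p [frame_conn \<psi> (vscale h X) Y p] = \<theta> i p [vscale h (frame_conn \<psi> X Y) p]"
      using V i by (simp add: simps sum_distrib_left algebra_simps)
  qed (use V in \<open>simp_all add: simps\<close>)
  show "frame_conn \<psi> X (vscale h Y) = vadd (vscale (\<lambda>p. X p h) Y) (vscale h (frame_conn \<psi> X Y))"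
    using V by (intro vfields_eqI)
      (simp_all add: simps vfields_mult[OF atlas V(1)] coord_smooth sum_distrib_left algebra_simps)
qed (simp add: frame_conn_vfields)

lemma torsion_vfields: "X \<in> vfields A \<Longrightarrow> Y \<in> vfields A \<Longrightarrow> torsion A (frame_conn \<psi>) X Y \<in> vfields A"
  by (simp add: torsion_def vfields_vdiff vfields_bracket frame_conn_vfields atlas)

text \<open>Cartan's first structure equation \<open>T = d\<theta> + \<psi> \<and> \<theta>\<close>.\<close>

lemma coord_torsion:
  assumes "k \<in> N" "X \<in> vfields A" "Y \<in> vfields A"
  shows "\<theta> k p [torsion A (frame_conn \<psi>) X Y p] = ext_d A (\<theta> k) [X, Y] p +
    (\<Sum>j\<in>N. \<psi> k j p [X p] * \<theta> j p [Y p] - \<psi> k j p [Y p] * \<theta> j p [X p])"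
  using assms
  by (simp add: torsion_def one_form_vdiff[OF atlas coframe] vfields_vdiff vfields_bracket
      frame_conn_vfields atlas coord_frame_conn ext_d_one_form sum_subtractf)

lemma curvature_vfields:
  "X \<in> vfields A \<Longrightarrow> Y \<in> vfields A \<Longrightarrow> Z \<in> vfields A \<Longrightarrow> curvature A (frame_conn \<psi>) X Y Z \<in> vfields A"
  by (simp add: curvature_def vfields_vdiff vfields_bracket frame_conn_vfields atlas)

text \<open>Cartan's second structure equation \<open>\<Omega> = d\<psi> + \<psi> \<and> \<psi>\<close>. The second derivatives of the
  coordinates of \<open>Z\<close> cancel against the derivative along \<open>[X, Y]\<close>, and the first derivatives cancel
  in pairs.\<close>

lemma coord_curvature:
  assumes k: "k \<in> N" and V: "X \<in> vfields A" "Y \<in> vfields A" "Z \<in> vfields A"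
  shows "\<theta> k p [curvature A (frame_conn \<psi>) X Y Z p] = (\<Sum>j\<in>N. (ext_d A (\<psi> k j) [X, Y] p +
    (\<Sum>m\<in>N. \<psi> k m p [X p] * \<psi> m j p [Y p] - \<psi> k m p [Y p] * \<psi> m j p [X p])) * \<theta> j p [Z p])"
proof -
  let ?z = "\<lambda>j q. \<theta> j q [Z q]"
  have zs: "?z j \<in> smooth_funs A" if "j \<in> N" for j using that V by (simp add: coord_smooth)
  have ps: "(\<lambda>q. \<psi> k j q [W q]) \<in> smooth_funs A" if "j \<in> N" "W \<in> vfields A" for j W
    using that k psi by (simp add: one_form_smooth)
  have *: "\<theta> k p [frame_conn \<psi> W (frame_conn \<psi> W' Z) p] =
      W p (\<lambda>q. W' q (?z k)) + (\<Sum>j\<in>N. W p (\<lambda>q. \<psi> k j q [W' q]) * ?z j p + \<psi> k j p [W' p] * W p (?z j))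
      + (\<Sum>m\<in>N. \<psi> k m p [W p] * W' p (?z m)) + (\<Sum>j\<in>N. (\<Sum>m\<in>N. \<psi> k m p [W p] * \<psi> m j p [W' p]) * ?z j p)"
    if "W \<in> vfields A" "W' \<in> vfields A" for W W'
  proof -
    have prods: "(\<lambda>q. \<psi> k j q [W' q] * ?z j q) \<in> smooth_funs A" if "j \<in> N" for j
      by (rule smooth_funs_mult[OF atlas ps[OF that \<open>W' \<in> vfields A\<close>] zs[OF that]])
    have "\<theta> k p [frame_conn \<psi> W (frame_conn \<psi> W' Z) p] =
      W p (\<lambda>q. W' q (?z k) + (\<Sum>j\<in>N. \<psi> k j q [W' q] * ?z j q)) +
      (\<Sum>m\<in>N. \<psi> k m p [W p] * (W' p (?z m) + (\<Sum>j\<in>N. \<psi> m j p [W' p] * ?z j p)))"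
      using k by (simp add: coord_frame_conn)
    also have "W p (\<lambda>q. W' q (?z k) + (\<Sum>j\<in>N. \<psi> k j q [W' q] * ?z j q)) =
      W p (\<lambda>q. W' q (?z k)) + W p (\<lambda>q. \<Sum>j\<in>N. \<psi> k j q [W' q] * ?z j q)"
      by (rule vfields_add[OF atlas that(1) vfields_smooth[OF atlas that(2) zs[OF k]]
            smooth_funs_sum[OF atlas prods]])
    also have "W p (\<lambda>q. \<Sum>j\<in>N. \<psi> k j q [W' q] * ?z j q) =
      (\<Sum>j\<in>N. W p (\<lambda>q. \<psi> k j q [W' q] * ?z j q))"
      by (rule vfields_sum[OF atlas that(1) prods])
    also have "\<dots> = (\<Sum>j\<in>N. W p (\<lambda>q. \<psi> k j q [W' q]) * ?z j p + \<psi> k j p [W' p] * W p (?z j))"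
      by (rule sum.cong) (simp_all add: vfields_mult[OF atlas that(1)] zs ps that)
    also have "(\<Sum>m\<in>N. \<psi> k m p [W p] * (W' p (?z m) + (\<Sum>j\<in>N. \<psi> m j p [W' p] * ?z j p))) =
      (\<Sum>m\<in>N. \<psi> k m p [W p] * W' p (?z m)) + (\<Sum>m\<in>N. \<Sum>j\<in>N. \<psi> k m p [W p] * \<psi> m j p [W' p] * ?z j p)"
      by (simp add: sum.distrib distrib_left sum_distrib_left mult.assoc)
    also have "(\<Sum>m\<in>N. \<Sum>j\<in>N. \<psi> k m p [W p] * \<psi> m j p [W' p] * ?z j p) =
      (\<Sum>j\<in>N. (\<Sum>m\<in>N. \<psi> k m p [W p] * \<psi> m j p [W' p]) * ?z j p)"
      by (subst sum.swap) (simp add: sum_distrib_right)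
    finally show ?thesis by (simp add: add.assoc)
  qed
  have "\<theta> k p [curvature A (frame_conn \<psi>) X Y Z p] =
    \<theta> k p [frame_conn \<psi> X (frame_conn \<psi> Y Z) p] - \<theta> k p [frame_conn \<psi> Y (frame_conn \<psi> X Z) p] -
    \<theta> k p [frame_conn \<psi> (bracket A X Y) Z p]"
    using V k by (simp add: curvature_def one_form_vdiff[OF atlas coframe] vfields_vdiff vfields_bracket
      frame_conn_vfields atlas)
  also have "\<theta> k p [frame_conn \<psi> (bracket A X Y) Z p] =
    X p (\<lambda>q. Y q (?z k)) - Y p (\<lambda>q. X q (?z k)) + (\<Sum>j\<in>N. \<psi> k j p [bracket A X Y p] * ?z j p)"
    using k zs by (simp add: coord_frame_conn bracket_def[of A X Y])
  finally show ?thesis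
    by (simp add: *[OF V(1,2)] *[OF V(2,1)] ext_d_one_form sum.distrib sum_subtractf algebra_simps)
qed

end

end

section \<open>Traces over orthonormal bases\<close>

text \<open>A right inverse of a square matrix is a left inverse. The index set \<open>{1..4}\<close> is identified with a four-element
  type in order to read \<open>f\<close> as a matrix.\<close>

lemma orthonormal_rows_imp_columns:
  fixes f :: "nat \<Rightarrow> nat \<Rightarrow> real"
  assumes "\<And>i j. i \<in> {1..4} \<Longrightarrow> j \<in> {1..4} \<Longrightarrow> (\<Sum>c\<in>{1..4}. f i c * f j c) = (if i = j then 1 else 0)"
    and "a \<in> {1..4}" "b \<in> {1..4}"
  shows "(\<Sum>i\<in>{1..4}. f i a * f i b) = (if a = b then 1 else 0)"
proof -
  have "\<exists>h. bij_betw h (UNIV :: 4 set) {1..4::nat}"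
    by (rule finite_same_card_bij) auto
  then obtain h where h: "bij_betw h (UNIV :: 4 set) {1..4::nat}" ..
  then have hr: "h i \<in> {1..4}" for i by (auto simp: bij_betw_def)
  have hinj: "h i = h j \<longleftrightarrow> i = j" for i j using h by (auto simp: bij_betw_def inj_on_def)
  define M :: "real^4^4" where "M = (\<chi> i j. f (h i) (h j))"
  have "M ** transpose M = mat 1"
  proof -
    have "(\<Sum>k\<in>UNIV. f (h i) (h k) * f (h j) (h k)) = (if i = j then 1 else 0)" for i j
      using sum.reindex_bij_betw[OF h, of "\<lambda>c. f (h i) c * f (h j) c"] assms(1)[OF hr[of i] hr[of j]]
      by (simp add: hinj)
    then show ?thesis
      by (simp add: matrix_matrix_mult_def transpose_def mat_def M_def vec_eq_iff)
  qed
  then have T: "transpose M ** M = mat 1"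
    by (simp add: matrix_left_right_inverse)
  have "range h = {1..4}" using h by (simp only: bij_betw_def)
  then obtain i j where ij: "a = h i" "b = h j" using assms(2,3) by (metis imageE)
  have "(transpose M ** M) $ i $ j = (\<Sum>k\<in>UNIV. f (h k) (h i) * f (h k) (h j))"
    by (simp add: matrix_matrix_mult_def transpose_def M_def)
  then show ?thesis
    using sum.reindex_bij_betw[OF h, of "\<lambda>k. f k a * f k b"] T by (simp add: ij mat_def hinj)
qed

text \<open>The trace of a bilinear form \<open>\<beta>\<close> is the same in every orthonormal basis; \<open>f i\<close> lists the
  coordinates of the \<open>i\<close>-th basis vector. This is what makes conditions on arbitrary orthonormal bases
  computable in the frame.\<close>

lemma trace_orthonormal:
  fixes f \<beta> :: "nat \<Rightarrow> nat \<Rightarrow> real"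
  assumes "\<And>i j. i \<in> {1..4} \<Longrightarrow> j \<in> {1..4} \<Longrightarrow> (\<Sum>c\<in>{1..4}. f i c * f j c) = (if i = j then 1 else 0)"
  shows "(\<Sum>i\<in>{1..4}. \<Sum>a\<in>{1..4}. \<Sum>b\<in>{1..4}. \<beta> a b * f i a * f i b) = (\<Sum>a\<in>{1..4}. \<beta> a a)"
proof -
  have "(\<Sum>i\<in>{1..4}. \<Sum>a\<in>{1..4}. \<Sum>b\<in>{1..4}. \<beta> a b * f i a * f i b) =
    (\<Sum>a\<in>{1..4}. \<Sum>i\<in>{1..4}. \<Sum>b\<in>{1..4}. \<beta> a b * f i a * f i b)"
    by (rule sum.swap)
  also have "\<dots> = (\<Sum>a\<in>{1..4}. \<Sum>b\<in>{1..4}. \<Sum>i\<in>{1..4}. \<beta> a b * f i a * f i b)"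
    by (intro sum.cong refl sum.swap)
  also have "\<dots> = (\<Sum>a\<in>{1..4}. \<Sum>b\<in>{1..4}. if a = b then \<beta> a b else 0)"
  proof (intro sum.cong refl)
    fix a b :: nat assume "a \<in> {1..4}" "b \<in> {1..4}"
    then show "(\<Sum>i\<in>{1..4}. \<beta> a b * f i a * f i b) = (if a = b then \<beta> a b else 0)"
      using orthonormal_rows_imp_columns[OF assms, where a = a and b = b] by (simp add: mult.assoc flip: sum_distrib_left)
  qed
  also have "\<dots> = (\<Sum>a\<in>{1..4}. \<beta> a a)"
    by (rule sum.cong) simp_all
  finally show ?thesis .
qed

section \<open>Alternating forms and quaternions in coordinates\<close>

text \<open>The values of \<open>\<theta>\<^sub>i \<and> \<theta>\<^sub>j\<close>, of \<open>\<theta>\<^sub>i \<and> \<theta>\<^sub>j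
  \<and> \<theta>\<^sub>k\<close> and of \<open>\<theta>\<^sub>1 \<and> \<theta>\<^sub>2 \<and> \<theta>\<^sub>3 \<and>
  \<theta>\<^sub>4\<close> on vectors with the given coordinates. They are defined by expansion along the first index, which
  suits the Leibniz rule below.\<close>

definition minor2 :: "nat \<Rightarrow> nat \<Rightarrow> (nat \<Rightarrow> real) \<Rightarrow> (nat \<Rightarrow> real) \<Rightarrow> real" where
  "minor2 i j x y = x i * y j - x j * y i"

definition minor3 :: "nat \<Rightarrow> nat \<Rightarrow> nat \<Rightarrow> (nat \<Rightarrow> real) \<Rightarrow> (nat \<Rightarrow> real) \<Rightarrow> (nat \<Rightarrow> real) \<Rightarrow> real" where
  "minor3 i j k x y z = x i * minor2 j k y z - y i * minor2 j k x z + z i * minor2 j k x y"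

definition det4 :: "(nat \<Rightarrow> real) \<Rightarrow> (nat \<Rightarrow> real) \<Rightarrow> (nat \<Rightarrow> real) \<Rightarrow> (nat \<Rightarrow> real) \<Rightarrow> real" where
  "det4 x y z u = x 1 * minor3 2 3 4 y z u - y 1 * minor3 2 3 4 x z u + z 1 * minor3 2 3 4 x y u - u 1 * minor3 2 3 4 x y z"

text \<open>Expansion along the first vector instead of the first index; \<open>minor3 4 1 2\<close> is \<open>minor3 1 2 4\<close>.\<close>

lemma det4_expand:
  "det4 x y z u = x 1 * minor3 2 3 4 y z u - x 2 * minor3 1 3 4 y z u + x 3 * minor3 4 1 2 y z u - x 4 * minor3 1 2 3 y z u"
  unfolding det4_def minor3_def minor2_def by algebra

lemma det4_swap:
  "det4 y x z u = - det4 x y z u" "det4 y z x u = det4 x y z u" "det4 y z u x = - det4 x y z u"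
  unfolding det4_def minor3_def minor2_def by algebra+

lemma det4_diff: "det4 (\<lambda>a. r a - s a - t a) y z u = det4 r y z u - det4 s y z u - det4 t y z u"
  unfolding det4_expand by (simp add: algebra_simps)

text \<open>The value of \<open>(\<theta>\<^sub>s \<and> \<theta>\<^sub>t) \<and> (\<theta>\<^sub>s \<and> \<theta>\<^sub>u \<and>
  \<theta>\<^sub>v)\<close> on five vectors, which is 0 because \<open>\<theta>\<^sub>s\<close> is repeated.\<close>

lemma minor2_minor3_repeated:
  "minor2 s t a b * minor3 s u v c d f - minor2 s t a c * minor3 s u v b d f + minor2 s t a d * minor3 s u v b c f
   - minor2 s t a f * minor3 s u v b c d + minor2 s t b c * minor3 s u v a d f - minor2 s t b d * minor3 s u v a c f
   + minor2 s t b f * minor3 s u v a c d + minor2 s t c d * minor3 s u v a b f - minor2 s t c f * minor3 s u v a b d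
   + minor2 s t d f * minor3 s u v a b c = 0"
  unfolding minor3_def minor2_def by algebra

lemma wedge_1_1: "wedge 1 1 \<alpha> \<beta> p [x, y] = \<alpha> p [x] * \<beta> p [y] - \<alpha> p [y] * \<beta> p [x]"
proof -
  have set: "{..<1 + 1} = insert 0 {1::nat}" by auto
  have upt: "[0..<1] = [0::nat]" "[1..<1 + 1] = [1::nat]" by (simp_all add: upt_rec)
  have f: "finite {1::nat}" "0 \<notin> {1::nat}" by auto
  show ?thesis
    unfolding wedge_def set sum_over_permutations_insert[OF f] permutes_sing upt
    by (simp add: sign_swap_id permutation_swap_id sign_compose sign_id)
qed

text \<open>The 24 permutations fall into 8 for each of the three ways of pairing the arguments, and the normalisation divides by 4.\<close>

lemma wedge_2_2_self:
  assumes alt: "\<And>x y. x \<in> {a, b, c, d} \<Longrightarrow> y \<in> {a, b, c, d} \<Longrightarrow> \<alpha> p [x, y] = - \<alpha> p [y, x]"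
  shows "wedge 2 2 \<alpha> \<alpha> p [a, b, c, d] =
    2 * (\<alpha> p [a, b] * \<alpha> p [c, d] - \<alpha> p [a, c] * \<alpha> p [b, d] + \<alpha> p [a, d] * \<alpha> p [b, c])"
proof -
  have set: "{..<2 + 2} = insert 0 (insert 1 (insert 2 {3::nat}))" by auto
  have upt: "[0..<2] = [0, 1::nat]" "[2..<2 + 2] = [2, 3::nat]" by (simp_all add: upt_rec)
  have f: "finite {1, 2, 3::nat}" "0 \<notin> {1, 2, 3::nat}" "finite {2, 3::nat}" "1 \<notin> {2, 3::nat}"
    "finite {3::nat}" "2 \<notin> {3::nat}" by auto
  have alts: "\<alpha> p [b, a] = - \<alpha> p [a, b]" "\<alpha> p [c, a] = - \<alpha> p [a, c]" "\<alpha> p [d, a] = - \<alpha> p [a, d]"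
    "\<alpha> p [c, b] = - \<alpha> p [b, c]" "\<alpha> p [d, b] = - \<alpha> p [b, d]" "\<alpha> p [d, c] = - \<alpha> p [c, d]"
    by (rule alt; simp)+
  show ?thesis
    unfolding wedge_def set sum_over_permutations_insert[OF f(1,2)]
      sum_over_permutations_insert[OF f(3,4)] sum_over_permutations_insert[OF f(5,6)] permutes_sing upt
    by (simp add: sign_swap_id permutation_swap_id sign_compose sign_id permutation_compose
        transpose_def numeral_2_eq_2 numeral_3_eq_3 alts)
qed

lemma minor3_rotate: "minor3 i j k x y z = minor3 j k i x y z"
  unfolding minor3_def minor2_def by algebra

text \<open>Coordinates are indexed by numerals. Equations about the index 1 can serve as rewrite rules only if the simplifier leaves
  \<open>1\<close> alone.\<close>

declare One_nat_def [simp del]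

lemma interval_3: "{1..3::nat} = {1, 2, 3}" by auto
lemma interval_4: "{1..4::nat} = {1, 2, 3, 4}" by auto
lemma interval_7: "{1..7::nat} = {1, 2, 3, 4, 5, 6, 7}" by auto
lemma sum_3: "(\<Sum>i\<in>{1..3::nat}. f i) = f 1 + f 2 + (f 3 :: real)" by (simp add: interval_3)
lemma sum_4: "(\<Sum>i\<in>{1..4::nat}. f i) = f 1 + f 2 + f 3 + (f 4 :: real)" by (simp add: interval_4)
lemma sum_7: "(\<Sum>i\<in>{1..7::nat}. f i) = f 1 + f 2 + f 3 + f 4 + f 5 + f 6 + (f 7 :: real)"
  by (simp add: interval_7)

lemma cases_1_3: "r \<in> {1..3::nat} \<Longrightarrow> r = 1 \<or> r = 2 \<or> r = 3" by auto
lemma cases_1_4: "r \<in> {1..4::nat} \<Longrightarrow> r = 1 \<or> r = 2 \<or> r = 3 \<or> r = 4" by auto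
lemma cases_1_7: "k \<in> {1..7::nat} \<Longrightarrow> k = 1 \<or> k = 2 \<or> k = 3 \<or> k = 4 \<or> k = 5 \<or> k = 6 \<or> k = 7"
  by auto

text \<open>The value of \<open>d\<theta>\<^sub>k\<close> on vectors with coordinates \<open>x\<close> and \<open>y\<close>; the default
  0 is \<open>d\<theta>\<^sub>1\<close>.\<close>

definition structure_form :: "nat \<Rightarrow> (nat \<Rightarrow> real) \<Rightarrow> (nat \<Rightarrow> real) \<Rightarrow> real" where
  "structure_form k x y = (
     if k = 2 then 1/2 * minor2 1 5 x y - minor2 3 4 x y + 1/2 * minor2 4 6 x y
     else if k = 3 then 1/2 * minor2 1 6 x y + minor2 2 4 x y - 1/2 * minor2 4 5 x y
     else if k = 4 then - 2 * minor2 1 4 x y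
     else if k = 5 then 2 * (minor2 1 2 x y + minor2 3 4 x y) - minor2 4 6 x y
     else if k = 6 then 2 * (minor2 1 3 x y + minor2 4 2 x y) + minor2 4 5 x y
     else if k = 7 then 2 * (minor2 1 4 x y + minor2 2 3 x y) - 1/2 * minor2 5 6 x y
     else 0)"

text \<open>The value of \<open>\<omega>\<^sub>r\<close> on vectors with coordinates \<open>x\<close> and \<open>y\<close>.\<close>

definition kaehler_form :: "nat \<Rightarrow> (nat \<Rightarrow> real) \<Rightarrow> (nat \<Rightarrow> real) \<Rightarrow> real" where
  "kaehler_form r x y = (if r = 1 then minor2 1 2 x y + minor2 3 4 x y
     else if r = 2 then minor2 1 3 x y + minor2 4 2 x y else minor2 1 4 x y + minor2 2 3 x y)"

text \<open>The \<open>k\<close>-th coordinate of \<open>I\<^sub>r x\<close>, which is \<open>g(I\<^sub>r x, e\<^sub>k) =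
  \<omega>\<^sub>r(x, e\<^sub>k)\<close>. The table that follows is that of left multiplication by the imaginary units on the
  quaternions.\<close>

definition quat_mult :: "nat \<Rightarrow> (nat \<Rightarrow> real) \<Rightarrow> nat \<Rightarrow> real" where
  "quat_mult r x k = kaehler_form r x (\<lambda>i. if i = k then 1 else 0)"

lemma quat_mult_simps:
  "quat_mult 1 x 1 = - x 2" "quat_mult 1 x 2 = x 1" "quat_mult 1 x 3 = - x 4" "quat_mult 1 x 4 = x 3"
  "quat_mult 2 x 1 = - x 3" "quat_mult 2 x 2 = x 4" "quat_mult 2 x 3 = x 1" "quat_mult 2 x 4 = - x 2"
  "quat_mult 3 x 1 = - x 4" "quat_mult 3 x 2 = - x 3" "quat_mult 3 x 3 = x 2" "quat_mult 3 x 4 = x 1"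
  by (simp_all add: quat_mult_def kaehler_form_def minor2_def)

section \<open>The qc structure in the frame\<close>

text \<open>The situation of the theorem, with the differentials \<open>d\<theta>\<^sub>k\<close> and the forms
  \<open>\<omega>\<^sub>r\<close> evaluated in coordinates.\<close>

locale qc_coframe = smooth_frame A "{1..7}" \<theta> e
  for A :: "('g::{t2_space, second_countable_topology}, real ^ 7) atlas" and \<theta> e +
  fixes Q :: "'g qc"
  assumes struct_eq: "k \<in> {1..7} \<Longrightarrow> X \<in> vfields A \<Longrightarrow> Y \<in> vfields A \<Longrightarrow>
      ext_d A (\<theta> k) [X, Y] p = structure_form k (\<lambda>i. \<theta> i p [X p]) (\<lambda>i. \<theta> i p [Y p])"
    and eta: "r \<in> {1..3} \<Longrightarrow> qc_eta Q r = \<theta> (4 + r)"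
    and xi: "r \<in> {1..3} \<Longrightarrow> qc_xi Q r = e (4 + r)"
    and dist: "qc_H Q p = tspan {1..4} (\<lambda>a. e a p)"
    and inner: "inner_product_on (qc_H Q p) (qc_g Q p)"
    and onb: "orthonormal_basis_at Q p (\<lambda>a. e a p)"
    and I_H: "r \<in> {1..3} \<Longrightarrow> v \<in> qc_H Q p \<Longrightarrow> qc_I Q r p v \<in> qc_H Q p"
    and omega: "r \<in> {1..3} \<Longrightarrow> v \<in> tangent_space A p \<Longrightarrow> w \<in> tangent_space A p \<Longrightarrow>
      omega Q r p [v, w] = kaehler_form r (\<lambda>i. \<theta> i p [v]) (\<lambda>i. \<theta> i p [w])"
begin

lemma eta_simps: "qc_eta Q 1 = \<theta> 5" "qc_eta Q 2 = \<theta> 6" "qc_eta Q 3 = \<theta> 7"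
  using eta[of 1] eta[of 2] eta[of 3] by simp_all

lemma xi_simps: "qc_xi Q 1 = e 5" "qc_xi Q 2 = e 6" "qc_xi Q 3 = e 7"
  using xi[of 1] xi[of 2] xi[of 3] by simp_all

lemma coord_tcomb:
  "k \<in> {1..7} \<Longrightarrow> v \<in> tangent_space A p \<Longrightarrow> w \<in> tangent_space A p \<Longrightarrow>
    \<theta> k p [tcomb a v b w] = a * \<theta> k p [v] + b * \<theta> k p [w]"
  unfolding tcomb_def by (rule one_form_tcomb[OF coframe])

lemma H_iff: "v \<in> qc_H Q p \<longleftrightarrow>
  v \<in> tangent_space A p \<and> \<theta> 5 p [v] = 0 \<and> \<theta> 6 p [v] = 0 \<and> \<theta> 7 p [v] = 0"
proof
  assume "v \<in> qc_H Q p"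
  then obtain c where v: "v = (\<lambda>f. \<Sum>i\<in>{1..4}. c i * e i p f)"
    by (auto simp: dist tspan_def)
  have "v \<in> tangent_space A p"
    unfolding v by (rule tangent_space_sum[OF atlas frame_tangent]) auto
  moreover have "\<theta> k p [v] = 0" if "k \<in> {5..7}" for k
    unfolding v using that by (subst coord_sum) auto
  ultimately show "v \<in> tangent_space A p \<and> \<theta> 5 p [v] = 0 \<and> \<theta> 6 p [v] = 0 \<and> \<theta> 7 p [v] = 0"
    by simp
next
  assume v: "v \<in> tangent_space A p \<and> \<theta> 5 p [v] = 0 \<and> \<theta> 6 p [v] = 0 \<and> \<theta> 7 p [v] = 0"
  then have "v = (\<lambda>f. \<Sum>i\<in>{1..7}. \<theta> i p [v] * e i p f)"
    using tangent_expand by blast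
  then have "v = (\<lambda>f. \<Sum>i\<in>{1..4}. \<theta> i p [v] * e i p f)"
    using v by (simp add: sum_4 sum_7)
  then show "v \<in> qc_H Q p"
    unfolding dist tspan_def mem_Collect_eq by (intro exI[of _ "\<lambda>i. \<theta> i p [v]"] conjI TrueI)
qed

lemma H_tangent: "v \<in> qc_H Q p \<Longrightarrow> v \<in> tangent_space A p"
  by (simp add: H_iff)

lemma H_vertical: "v \<in> qc_H Q p \<Longrightarrow> \<theta> 5 p [v] = 0" "v \<in> qc_H Q p \<Longrightarrow> \<theta> 6 p [v] = 0"
  "v \<in> qc_H Q p \<Longrightarrow> \<theta> 7 p [v] = 0"
  by (simp_all add: H_iff)

lemma H_expand:
  assumes "v \<in> qc_H Q p"
  shows "v = (\<lambda>f. \<Sum>i\<in>{1..4}. \<theta> i p [v] * e i p f)"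
  using tangent_expand[OF H_tangent[OF assms]] by (simp add: sum_4 sum_7 H_vertical[OF assms])

lemma V_iff: "v \<in> qc_V Q p \<longleftrightarrow> v \<in> tangent_space A p \<and>
  \<theta> 1 p [v] = 0 \<and> \<theta> 2 p [v] = 0 \<and> \<theta> 3 p [v] = 0 \<and> \<theta> 4 p [v] = 0"
proof
  assume "v \<in> qc_V Q p"
  then obtain c where v: "v = (\<lambda>f. \<Sum>r\<in>{1..3}. c r * qc_xi Q r p f)"
    by (auto simp: qc_V_def tspan_def)
  have t: "qc_xi Q r p \<in> tangent_space A p" if "r \<in> {1..3}" for r
    using that by (simp add: xi frame_tangent)
  have "\<theta> k p [v] = 0" if "k \<in> {1..4}" for k
  proof -
    have k: "k \<in> {1..7}" using that by simp
    have "\<theta> k p [v] = (\<Sum>r\<in>{1..3}. c r * \<theta> k p [qc_xi Q r p])"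
      unfolding v by (rule one_form_sum[OF atlas coframe[OF k] t])
    then show ?thesis using that by (simp add: sum_3 xi_simps dual)
  qed
  moreover have "v \<in> tangent_space A p"
    unfolding v by (rule tangent_space_sum[OF atlas t])
  ultimately show "v \<in> tangent_space A p \<and>
      \<theta> 1 p [v] = 0 \<and> \<theta> 2 p [v] = 0 \<and> \<theta> 3 p [v] = 0 \<and> \<theta> 4 p [v] = 0" by simp
next
  assume v: "v \<in> tangent_space A p \<and>
    \<theta> 1 p [v] = 0 \<and> \<theta> 2 p [v] = 0 \<and> \<theta> 3 p [v] = 0 \<and> \<theta> 4 p [v] = 0"
  then have "v = (\<lambda>f. \<Sum>i\<in>{1..7}. \<theta> i p [v] * e i p f)"
    using tangent_expand by blast
  then have "v = (\<lambda>f. \<Sum>r\<in>{1..3}. \<theta> (4 + r) p [v] * qc_xi Q r p f)"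
    using v by (simp add: sum_3 sum_7 xi_simps)
  then show "v \<in> qc_V Q p"
    unfolding qc_V_def tspan_def mem_Collect_eq by (intro exI[of _ "\<lambda>r. \<theta> (4 + r) p [v]"] conjI TrueI)
qed

lemma frame_H: "a \<in> {1..4} \<Longrightarrow> e a p \<in> qc_H Q p"
  by (auto simp: H_iff frame_tangent dual)

lemma H_eqI:
  assumes v: "v \<in> qc_H Q p" and w: "w \<in> qc_H Q p"
    and "\<And>a. a \<in> {1..4} \<Longrightarrow> \<theta> a p [v] = \<theta> a p [w]"
  shows "v = w"
  using H_expand[OF v] H_expand[OF w] assms(3) by simp

lemma H_tcomb: "v \<in> qc_H Q p \<Longrightarrow> w \<in> qc_H Q p \<Longrightarrow> tcomb a v b w \<in> qc_H Q p"
  by (simp add: H_iff tangent_space_tcomb atlas coord_tcomb)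

lemma H_linear_form:
  assumes k: "linear_form_on (qc_H Q p) k" and v: "v \<in> qc_H Q p"
  shows "k v = (\<Sum>a\<in>{1..4}. \<theta> a p [v] * k (e a p))"
proof -
  let ?c = "\<lambda>a. \<theta> a p [v]"
  have lin: "k (tcomb a x b y) = a * k x + b * k y" if "x \<in> qc_H Q p" "y \<in> qc_H Q p" for a b x y
    using k that unfolding linear_form_on_def by blast
  have "v = tcomb (?c 1) (e 1 p) 1 (tcomb (?c 2) (e 2 p) 1 (tcomb (?c 3) (e 3 p) (?c 4) (e 4 p)))"
    using H_expand[OF v] by (simp add: tcomb_def sum_4 algebra_simps)
  then have "k v = k (tcomb (?c 1) (e 1 p) 1 (tcomb (?c 2) (e 2 p) 1 (tcomb (?c 3) (e 3 p) (?c 4) (e 4 p))))"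
    by simp
  then show ?thesis
    by (simp add: lin H_tcomb frame_H sum_4)
qed

lemma g_coord:
  assumes v: "v \<in> qc_H Q p" and w: "w \<in> qc_H Q p"
  shows "qc_g Q p v w = (\<Sum>a\<in>{1..4}. \<theta> a p [v] * \<theta> a p [w])"
proof -
  have lin: "linear_form_on (qc_H Q p) (qc_g Q p x)" if "x \<in> qc_H Q p" for x
    using inner that unfolding inner_product_on_def by blast
  have on: "qc_g Q p (e a p) (e b p) = (if a = b then 1 else 0)" if "a \<in> {1..4}" "b \<in> {1..4}" for a b
    using onb that unfolding orthonormal_basis_at_def by blast
  have "qc_g Q p v (e a p) = \<theta> a p [v]" if a: "a \<in> {1..4}" for a
  proof -
    have "qc_g Q p v (e a p) = qc_g Q p (e a p) v"
      using inner v frame_H[OF a] unfolding inner_product_on_def by blast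
    also have "\<dots> = (\<Sum>b\<in>{1..4}. \<theta> b p [v] * qc_g Q p (e a p) (e b p))"
      by (rule H_linear_form[OF lin[OF frame_H[OF a]] v])
    also have "\<dots> = (\<Sum>b\<in>{1..4}. if a = b then \<theta> b p [v] else 0)"
      by (rule sum.cong) (use on a in auto)
    finally show ?thesis using a by simp
  qed
  then show ?thesis
    using H_linear_form[OF lin[OF v] w] by (simp add: mult.commute)
qed

lemma vert_tangent: "vert Q p v \<in> tangent_space A p"
  unfolding vert_def by (rule tangent_space_sum[OF atlas]) (simp add: xi frame_tangent)

lemma coord_vert:
  assumes "k \<in> {1..7}"
  shows "\<theta> k p [vert Q p v] = (if k \<le> 4 then 0 else \<theta> k p [v])"
proof -
  have "\<theta> k p [vert Q p v] = (\<Sum>r\<in>{1..3}. qc_eta Q r p [v] * \<theta> k p [qc_xi Q r p])"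
    unfolding vert_def by (rule one_form_sum[OF atlas coframe[OF assms]]) (simp add: xi frame_tangent)
  moreover have "k \<in> {1, 2, 3, 4, 5, 6, 7}" using assms by auto
  ultimately show ?thesis by (auto simp: sum_3 xi_simps eta_simps dual)
qed

lemma horiz_tcomb: "horiz Q p v = tcomb 1 v (-1) (vert Q p v)"
  by (simp add: horiz_def tcomb_def)

lemma coord_horiz:
  "k \<in> {1..7} \<Longrightarrow> v \<in> tangent_space A p \<Longrightarrow> \<theta> k p [horiz Q p v] = (if k \<le> 4 then \<theta> k p [v] else 0)"
  unfolding horiz_tcomb by (simp add: coord_tcomb vert_tangent coord_vert)

lemma horiz_H: "v \<in> tangent_space A p \<Longrightarrow> horiz Q p v \<in> qc_H Q p"
  by (simp add: H_iff coord_horiz) (simp add: horiz_tcomb tangent_space_tcomb atlas vert_tangent)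

lemma horiz_id: "v \<in> qc_H Q p \<Longrightarrow> horiz Q p v = v"
  by (rule H_eqI) (auto simp: horiz_H H_tangent coord_horiz)

lemma ext_g_coord:
  "v \<in> tangent_space A p \<Longrightarrow> w \<in> tangent_space A p \<Longrightarrow>
    ext_g Q p v w = (\<Sum>i\<in>{1..7}. \<theta> i p [v] * \<theta> i p [w])"
  by (simp add: ext_g_def g_coord horiz_H coord_horiz sum_3 sum_4 sum_7 eta_simps)

text \<open>Since \<open>I\<^sub>r\<close> preserves \<open>H\<close> and \<open>e\<^sub>1, \<dots>, e\<^sub>4\<close> is orthonormal,
  \<open>I\<^sub>r\<close> is recovered from \<open>\<omega>\<^sub>r(v, w) = g(I\<^sub>r v, w)\<close>.\<close>

lemma coord_I:
  assumes r: "r \<in> {1..3}" and v: "v \<in> qc_H Q p" and b: "b \<in> {1..4}"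
  shows "\<theta> b p [qc_I Q r p v] = quat_mult r (\<lambda>i. \<theta> i p [v]) b"
proof -
  have b7: "b \<in> {1..7}" using b by simp
  have "\<theta> b p [qc_I Q r p v] = (\<Sum>a\<in>{1..4}. if a = b then \<theta> a p [qc_I Q r p v] else 0)"
    using b by simp
  also have "\<dots> = (\<Sum>a\<in>{1..4}. \<theta> a p [qc_I Q r p v] * \<theta> a p [e b p])"
    by (rule sum.cong) (use b dual in auto)
  also have "\<dots> = qc_g Q p (qc_I Q r p v) (e b p)"
    by (rule g_coord[symmetric]) (use r v b I_H frame_H in auto)
  also have "\<dots> = omega Q r p [v, e b p]"
    by (simp add: omega_def horiz_id[OF v] horiz_id[OF frame_H[OF b]])
  also have "\<dots> = kaehler_form r (\<lambda>i. \<theta> i p [v]) (\<lambda>i. \<theta> i p [e b p])"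
    by (rule omega) (use r v b7 in \<open>auto simp: H_tangent frame_tangent\<close>)
  also have "\<dots> = quat_mult r (\<lambda>i. \<theta> i p [v]) b"
    using b7 by (simp add: quat_mult_def kaehler_form_def minor2_def dual)
  finally show ?thesis .
qed

lemma coord_I_simps:
  assumes "v \<in> qc_H Q p"
  shows "\<theta> 1 p [qc_I Q 1 p v] = - \<theta> 2 p [v]" "\<theta> 2 p [qc_I Q 1 p v] = \<theta> 1 p [v]"
    "\<theta> 3 p [qc_I Q 1 p v] = - \<theta> 4 p [v]" "\<theta> 4 p [qc_I Q 1 p v] = \<theta> 3 p [v]"
    "\<theta> 1 p [qc_I Q 2 p v] = - \<theta> 3 p [v]" "\<theta> 2 p [qc_I Q 2 p v] = \<theta> 4 p [v]"
    "\<theta> 3 p [qc_I Q 2 p v] = \<theta> 1 p [v]" "\<theta> 4 p [qc_I Q 2 p v] = - \<theta> 2 p [v]"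
    "\<theta> 1 p [qc_I Q 3 p v] = - \<theta> 4 p [v]" "\<theta> 2 p [qc_I Q 3 p v] = - \<theta> 3 p [v]"
    "\<theta> 3 p [qc_I Q 3 p v] = \<theta> 2 p [v]" "\<theta> 4 p [qc_I Q 3 p v] = \<theta> 1 p [v]"
  using assms by (simp_all add: coord_I quat_mult_simps)

lemma sections_vfields: "X \<in> sections A D \<Longrightarrow> X \<in> vfields A"
  by (simp add: sections_def)

lemma sections_mem: "X \<in> sections A D \<Longrightarrow> X p \<in> D p"
  by (simp add: sections_def)

lemma appl_I_section:
  assumes r: "r \<in> {1..3}" and X: "X \<in> sections A (qc_H Q)"
  shows "appl (qc_I Q r) X \<in> sections A (qc_H Q)"
proof -
  note XH = sections_mem[OF X] and XV = sections_vfields[OF X]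
  have sm: "(\<lambda>p. \<theta> k p [qc_I Q r p (X p)]) \<in> smooth_funs A" if "k \<in> {1..4}" for k
    using cases_1_3[OF r] cases_1_4[OF that]
    by (elim disjE; simp only: coord_I_simps[OF XH]) (simp_all add: smooth_funs_uminus atlas coord_smooth XV)
  have "appl (qc_I Q r) X = lincomb {1..4} (\<lambda>k p. \<theta> k p [qc_I Q r p (X p)]) e"
    unfolding appl_def lincomb_def by (rule ext) (rule H_expand[OF I_H[OF r XH]])
  also have "\<dots> \<in> vfields A"
    by (rule vfields_lincomb[OF atlas _ sm frame]) auto
  finally show ?thesis
    using I_H[OF r XH] by (simp add: sections_def appl_def)
qed

lemma I_endo:
  assumes r: "r \<in> {1..3}"
  shows "endo_on (qc_H Q p) (qc_I Q r p)"
  unfolding endo_on_def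
proof (intro conjI ballI allI)
  fix v w a b assume v: "v \<in> qc_H Q p" and w: "w \<in> qc_H Q p"
  show "qc_I Q r p (tcomb a v b w) = tcomb a (qc_I Q r p v) b (qc_I Q r p w)"
  proof (rule H_eqI)
    fix k :: nat assume k: "k \<in> {1..4}"
    show "\<theta> k p [qc_I Q r p (tcomb a v b w)] = \<theta> k p [tcomb a (qc_I Q r p v) b (qc_I Q r p w)]"
      using cases_1_3[OF r] cases_1_4[OF k]
      by (elim disjE) (simp_all add: coord_tcomb coord_I_simps H_tcomb v w I_H H_tangent)
  qed (simp_all add: v w I_H[OF r] H_tcomb)
qed (simp add: I_H[OF r])

lemma neg_H: "v \<in> qc_H Q p \<Longrightarrow> (\<lambda>f. - v f) \<in> qc_H Q p"
  using H_tcomb[of v p v "-1" 0] by (simp add: tcomb_def)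

lemma coord_neg: "k \<in> {1..7} \<Longrightarrow> v \<in> qc_H Q p \<Longrightarrow> \<theta> k p [\<lambda>f. - v f] = - \<theta> k p [v]"
  using coord_tcomb[of k v p v "-1" 0] by (simp add: tcomb_def H_tangent)

lemma quaternion_relations:
  assumes v: "v \<in> qc_H Q p"
  shows "r \<in> {1..3} \<Longrightarrow> qc_I Q r p (qc_I Q r p v) = (\<lambda>f. - v f)"
    "qc_I Q 1 p (qc_I Q 2 p v) = qc_I Q 3 p v"
    "qc_I Q 2 p (qc_I Q 1 p v) = (\<lambda>f. - qc_I Q 3 p v f)"
    "qc_I Q 1 p (qc_I Q 2 p (qc_I Q 3 p v)) = (\<lambda>f. - v f)"
proof -
  note s = coord_I_simps coord_neg neg_H I_H v
  show "qc_I Q r p (qc_I Q r p v) = (\<lambda>f. - v f)" if r: "r \<in> {1..3}"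
  proof (rule H_eqI)
    fix k :: nat assume k: "k \<in> {1..4}"
    show "\<theta> k p [qc_I Q r p (qc_I Q r p v)] = \<theta> k p [\<lambda>f. - v f]"
      using cases_1_3[OF r] cases_1_4[OF k] by (elim disjE) (simp_all add: s)
  qed (simp_all add: neg_H v I_H[OF r])
  show "qc_I Q 1 p (qc_I Q 2 p v) = qc_I Q 3 p v"
  proof (rule H_eqI)
    fix k :: nat assume k: "k \<in> {1..4}"
    show "\<theta> k p [qc_I Q 1 p (qc_I Q 2 p v)] = \<theta> k p [qc_I Q 3 p v]"
      using cases_1_4[OF k] by (elim disjE) (simp_all add: s)
  qed (simp_all add: s)
  show "qc_I Q 2 p (qc_I Q 1 p v) = (\<lambda>f. - qc_I Q 3 p v f)"
  proof (rule H_eqI)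
    fix k :: nat assume k: "k \<in> {1..4}"
    show "\<theta> k p [qc_I Q 2 p (qc_I Q 1 p v)] = \<theta> k p [\<lambda>f. - qc_I Q 3 p v f]"
      using cases_1_4[OF k] by (elim disjE) (simp_all add: s)
  qed (simp_all add: s)
  show "qc_I Q 1 p (qc_I Q 2 p (qc_I Q 3 p v)) = (\<lambda>f. - v f)"
  proof (rule H_eqI)
    fix k :: nat assume k: "k \<in> {1..4}"
    show "\<theta> k p [qc_I Q 1 p (qc_I Q 2 p (qc_I Q 3 p v))] = \<theta> k p [\<lambda>f. - v f]"
      using cases_1_4[OF k] by (elim disjE) (simp_all add: s)
  qed (simp_all add: s)
qed

lemma g_I:
  assumes r: "r \<in> {1..3}" and v: "v \<in> qc_H Q p" and w: "w \<in> qc_H Q p"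
  shows "qc_g Q p (qc_I Q r p v) (qc_I Q r p w) = qc_g Q p v w"
    and "qc_g Q p (qc_I Q r p v) w = kaehler_form r (\<lambda>i. \<theta> i p [v]) (\<lambda>i. \<theta> i p [w])"
  using cases_1_3[OF r]
  by (elim disjE; simp add: g_coord I_H v w coord_I_simps sum_4 kaehler_form_def minor2_def)+

lemma ext_d_eta_H:
  assumes r: "r \<in> {1..3}" and X: "X \<in> sections A (qc_H Q)" and Y: "Y \<in> sections A (qc_H Q)"
  shows "ext_d A (qc_eta Q r) [X, Y] p = 2 * kaehler_form r (\<lambda>i. \<theta> i p [X p]) (\<lambda>i. \<theta> i p [Y p])"
  using cases_1_3[OF r] X Y
  by (elim disjE) (simp_all add: eta_simps struct_eq sections_vfields[OF X] sections_vfields[OF Y] structure_form_def kaehler_form_def minor2_def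
      H_vertical[OF sections_mem[OF X]] H_vertical[OF sections_mem[OF Y]])

lemma qc_structure_Q: "qc_structure A Q"
  unfolding qc_structure_def
proof (intro conjI allI ballI)
  fix p
  have "tindep {1..4} (\<lambda>a. e a p)"
    unfolding tindep_def
  proof (intro allI impI ballI)
    fix c :: "nat \<Rightarrow> real" and i :: nat
    assume c: "\<forall>f. (\<Sum>i\<in>{1..4}. c i * e i p f) = 0" and i: "i \<in> {1..4}"
    have "c i = \<theta> i p [(\<lambda>f. \<Sum>i\<in>{1..4}. c i * e i p f)]"
      using i by (subst coord_sum) auto
    also have "\<dots> = \<theta> i p [(\<lambda>f. \<Sum>i\<in>{1..4}. 0 * e i p f)]" using c by simp
    also have "\<dots> = 0" using i by (subst coord_sum) auto
    finally show "c i = 0" .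
  qed
  then show "\<exists>b. tindep {1..4} b \<and> qc_H Q p = tspan {1..4} b"
    using dist by blast
  show "inner_product_on (qc_H Q p) (qc_g Q p)" by (rule inner)
  show "qc_H Q p = {v \<in> tangent_space A p. \<forall>r\<in>{1..3}. qc_eta Q r p [v] = 0}"
    by (auto simp: H_iff interval_3 eta_simps)
next
  fix X Y assume X: "X \<in> sections A (qc_H Q)" and Y: "Y \<in> sections A (qc_H Q)"
  have "(\<lambda>p. \<Sum>a\<in>{1..4}. \<theta> a p [X p] * \<theta> a p [Y p]) \<in> smooth_funs A"
    by (rule smooth_funs_sum[OF atlas], rule smooth_funs_mult[OF atlas coord_smooth coord_smooth])
      (auto simp: sections_vfields[OF X] sections_vfields[OF Y])
  then show "(\<lambda>p. qc_g Q p (X p) (Y p)) \<in> smooth_funs A"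
    by (simp add: g_coord sections_mem[OF X] sections_mem[OF Y])
next
  fix r :: nat assume r: "r \<in> {1..3}"
  then show "one_form A (qc_eta Q r)" by (simp add: eta coframe)
next
  fix r p assume r: "r \<in> {1..3::nat}"
  then show "endo_on (qc_H Q p) (qc_I Q r p)" by (rule I_endo)
next
  fix r X assume "r \<in> {1..3::nat}" "X \<in> sections A (qc_H Q)"
  then show "appl (qc_I Q r) X \<in> sections A (qc_H Q)" by (rule appl_I_section)
next
  fix r p v w assume "r \<in> {1..3::nat}" "v \<in> qc_H Q p" "w \<in> qc_H Q p"
  then show "qc_g Q p (qc_I Q r p v) (qc_I Q r p w) = qc_g Q p v w" by (rule g_I)
next
  fix r X Y p assume r: "r \<in> {1..3::nat}" and X: "X \<in> sections A (qc_H Q)" and Y: "Y \<in> sections A (qc_H Q)"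
  then show "2 * qc_g Q p (qc_I Q r p (X p)) (Y p) = ext_d A (qc_eta Q r) [X, Y] p"
    by (simp add: ext_d_eta_H g_I(2) sections_mem)
qed (rule quaternion_relations; assumption)+

text \<open>Inserting \<open>\<xi>\<^sub>s\<close> leaves a form on \<open>H\<close> in two cases only: the summand
  \<open>\<theta>\<^sub>4 \<and> \<theta>\<^sub>5\<close> of \<open>d\<theta>\<^sub>6\<close> gives \<open>-
  \<theta>\<^sub>4\<close> for \<open>\<xi>\<^sub>1\<close>, and the summand \<open>- \<theta>\<^sub>4 \<and>
  \<theta>\<^sub>6\<close> of \<open>d\<theta>\<^sub>5\<close> gives \<open>\<theta>\<^sub>4\<close> for
  \<open>\<xi>\<^sub>2\<close>.\<close>

lemma integrable: "integrable_qc_structure A Q"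
  unfolding integrable_qc_structure_def
proof (intro conjI ballI allI)
  show "qc_structure A Q" by (rule qc_structure_Q)
  fix s k :: nat assume s: "s \<in> {1..3}"
  then show "qc_xi Q s \<in> vfields A" by (simp add: xi frame)
  fix p
  { fix X assume X: "X \<in> sections A (qc_H Q)"
    note simps = eta_simps xi_simps struct_eq sections_vfields[OF X] frame structure_form_def minor2_def
      H_vertical[OF sections_mem[OF X]] dual
    show "ext_d A (qc_eta Q s) [qc_xi Q s, X] p = 0"
      using cases_1_3[OF s] by (elim disjE) (simp_all add: simps)
    assume k: "k \<in> {1..3}"
    show "ext_d A (qc_eta Q k) [qc_xi Q s, X] p = - ext_d A (qc_eta Q s) [qc_xi Q k, X] p"
      using cases_1_3[OF s] cases_1_3[OF k] by (elim disjE) (simp_all add: simps)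
  }
  assume k: "k \<in> {1..3}"
  show "qc_eta Q s p [qc_xi Q k p] = (if s = k then 1 else 0)"
    using s k by (simp add: eta xi dual)
qed

end

section \<open>The fundamental four-form\<close>

lemma ext_d_four_form:
  "ext_d A \<alpha> [X0, X1, X2, X3, X4] p =
     X0 p (\<lambda>q. \<alpha> q [X1 q, X2 q, X3 q, X4 q]) - X1 p (\<lambda>q. \<alpha> q [X0 q, X2 q, X3 q, X4 q]) +
     X2 p (\<lambda>q. \<alpha> q [X0 q, X1 q, X3 q, X4 q]) - X3 p (\<lambda>q. \<alpha> q [X0 q, X1 q, X2 q, X4 q]) +
     X4 p (\<lambda>q. \<alpha> q [X0 q, X1 q, X2 q, X3 q])
   - \<alpha> p [bracket A X0 X1 p, X2 p, X3 p, X4 p] + \<alpha> p [bracket A X0 X2 p, X1 p, X3 p, X4 p]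
   - \<alpha> p [bracket A X0 X3 p, X1 p, X2 p, X4 p] + \<alpha> p [bracket A X0 X4 p, X1 p, X2 p, X3 p]
   - \<alpha> p [bracket A X1 X2 p, X0 p, X3 p, X4 p] + \<alpha> p [bracket A X1 X3 p, X0 p, X2 p, X4 p]
   - \<alpha> p [bracket A X1 X4 p, X0 p, X2 p, X3 p] - \<alpha> p [bracket A X2 X3 p, X0 p, X1 p, X4 p]
   + \<alpha> p [bracket A X2 X4 p, X0 p, X1 p, X3 p] - \<alpha> p [bracket A X3 X4 p, X0 p, X1 p, X2 p]"
  by (simp add: ext_d_def eval_form_def remove_nth_def eval_nat_numeral lessThan_Suc One_nat_def)

text \<open>This and the next two lemmas are the Leibniz rule for the alternating forms above: a derivation acts on one vector argument
  at a time.\<close>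

lemma deriv_minor2:
  assumes A: "smooth_atlas A" and X: "X \<in> vfields A"
    and sm: "\<And>k. k \<in> {i, j} \<Longrightarrow> (\<lambda>q. x q k) \<in> smooth_funs A" "\<And>k. k \<in> {i, j} \<Longrightarrow> (\<lambda>q. y q k) \<in> smooth_funs A"
  shows "(\<lambda>q. minor2 i j (x q) (y q)) \<in> smooth_funs A"
    "X p (\<lambda>q. minor2 i j (x q) (y q)) = minor2 i j (\<lambda>k. X p (\<lambda>q. x q k)) (y p) + minor2 i j (x p) (\<lambda>k. X p (\<lambda>q. y q k))"
proof -
  have s: "(\<lambda>q. x q i * y q j) \<in> smooth_funs A" "(\<lambda>q. x q j * y q i) \<in> smooth_funs A"
    by (rule smooth_funs_mult[OF A sm]; simp)+
  show "(\<lambda>q. minor2 i j (x q) (y q)) \<in> smooth_funs A"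
    unfolding minor2_def by (rule smooth_funs_diff[OF A s])
  show "X p (\<lambda>q. minor2 i j (x q) (y q)) = minor2 i j (\<lambda>k. X p (\<lambda>q. x q k)) (y p) + minor2 i j (x p) (\<lambda>k. X p (\<lambda>q. y q k))"
    unfolding minor2_def using vfields_diff[OF A X s] sm
    by (simp add: vfields_mult[OF A X] algebra_simps)
qed

lemma deriv_minor3:
  assumes A: "smooth_atlas A" and X: "X \<in> vfields A"
    and sm: "\<And>m. m \<in> {i, j, k} \<Longrightarrow> (\<lambda>q. x q m) \<in> smooth_funs A"
      "\<And>m. m \<in> {i, j, k} \<Longrightarrow> (\<lambda>q. y q m) \<in> smooth_funs A"
      "\<And>m. m \<in> {i, j, k} \<Longrightarrow> (\<lambda>q. z q m) \<in> smooth_funs A"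
  shows "(\<lambda>q. minor3 i j k (x q) (y q) (z q)) \<in> smooth_funs A"
    "X p (\<lambda>q. minor3 i j k (x q) (y q) (z q)) = minor3 i j k (\<lambda>m. X p (\<lambda>q. x q m)) (y p) (z p) +
      minor3 i j k (x p) (\<lambda>m. X p (\<lambda>q. y q m)) (z p) + minor3 i j k (x p) (y p) (\<lambda>m. X p (\<lambda>q. z q m))"
proof -
  have w: "(\<lambda>q. minor2 j k (x q) (y q)) \<in> smooth_funs A" "(\<lambda>q. minor2 j k (x q) (z q)) \<in> smooth_funs A"
    "(\<lambda>q. minor2 j k (y q) (z q)) \<in> smooth_funs A"
    by (rule deriv_minor2[OF A X]; simp add: sm)+
  have c: "(\<lambda>q. x q i) \<in> smooth_funs A" "(\<lambda>q. y q i) \<in> smooth_funs A" "(\<lambda>q. z q i) \<in> smooth_funs A"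
    by (simp_all add: sm)
  note s = smooth_funs_mult[OF A c(1) w(3)] smooth_funs_mult[OF A c(2) w(2)] smooth_funs_mult[OF A c(3) w(1)]
  show "(\<lambda>q. minor3 i j k (x q) (y q) (z q)) \<in> smooth_funs A"
    unfolding minor3_def by (rule smooth_funs_add[OF A smooth_funs_diff[OF A s(1,2)] s(3)])
  have dw: "X p (\<lambda>q. minor2 j k (x q) (y q)) = minor2 j k (\<lambda>m. X p (\<lambda>q. x q m)) (y p) + minor2 j k (x p) (\<lambda>m. X p (\<lambda>q. y q m))"
    "X p (\<lambda>q. minor2 j k (x q) (z q)) = minor2 j k (\<lambda>m. X p (\<lambda>q. x q m)) (z p) + minor2 j k (x p) (\<lambda>m. X p (\<lambda>q. z q m))"
    "X p (\<lambda>q. minor2 j k (y q) (z q)) = minor2 j k (\<lambda>m. X p (\<lambda>q. y q m)) (z p) + minor2 j k (y p) (\<lambda>m. X p (\<lambda>q. z q m))"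
    by (rule deriv_minor2[OF A X]; simp add: sm)+
  have eq: "X p (\<lambda>q. minor3 i j k (x q) (y q) (z q)) =
    X p (\<lambda>q. x q i * minor2 j k (y q) (z q)) - X p (\<lambda>q. y q i * minor2 j k (x q) (z q)) +
    X p (\<lambda>q. z q i * minor2 j k (x q) (y q))"
    unfolding minor3_def
    by (simp only: vfields_add[OF A X smooth_funs_diff[OF A s(1,2)] s(3)] vfields_diff[OF A X s(1,2)])
  show "X p (\<lambda>q. minor3 i j k (x q) (y q) (z q)) = minor3 i j k (\<lambda>m. X p (\<lambda>q. x q m)) (y p) (z p) +
      minor3 i j k (x p) (\<lambda>m. X p (\<lambda>q. y q m)) (z p) + minor3 i j k (x p) (y p) (\<lambda>m. X p (\<lambda>q. z q m))"
    unfolding eq vfields_mult[OF A X c(1) w(3)] vfields_mult[OF A X c(2) w(2)]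
      vfields_mult[OF A X c(3) w(1)] dw unfolding minor3_def by algebra
qed

lemma deriv_det4:
  assumes A: "smooth_atlas A" and X: "X \<in> vfields A"
    and sm: "\<And>m. m \<in> {1..4} \<Longrightarrow> (\<lambda>q. x q m) \<in> smooth_funs A"
      "\<And>m. m \<in> {1..4} \<Longrightarrow> (\<lambda>q. y q m) \<in> smooth_funs A"
      "\<And>m. m \<in> {1..4} \<Longrightarrow> (\<lambda>q. z q m) \<in> smooth_funs A"
      "\<And>m. m \<in> {1..4} \<Longrightarrow> (\<lambda>q. u q m) \<in> smooth_funs A"
  shows "(\<lambda>q. det4 (x q) (y q) (z q) (u q)) \<in> smooth_funs A"
    "X p (\<lambda>q. det4 (x q) (y q) (z q) (u q)) = det4 (\<lambda>m. X p (\<lambda>q. x q m)) (y p) (z p) (u p) +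
      det4 (x p) (\<lambda>m. X p (\<lambda>q. y q m)) (z p) (u p) + det4 (x p) (y p) (\<lambda>m. X p (\<lambda>q. z q m)) (u p) +
      det4 (x p) (y p) (z p) (\<lambda>m. X p (\<lambda>q. u q m))"
proof -
  have w: "(\<lambda>q. minor3 2 3 4 (y q) (z q) (u q)) \<in> smooth_funs A"
    "(\<lambda>q. minor3 2 3 4 (x q) (z q) (u q)) \<in> smooth_funs A"
    "(\<lambda>q. minor3 2 3 4 (x q) (y q) (u q)) \<in> smooth_funs A"
    "(\<lambda>q. minor3 2 3 4 (x q) (y q) (z q)) \<in> smooth_funs A"
    by (rule deriv_minor3[OF A X]; rule sm; auto)+
  have c: "(\<lambda>q. x q 1) \<in> smooth_funs A" "(\<lambda>q. y q 1) \<in> smooth_funs A" "(\<lambda>q. z q 1) \<in> smooth_funs A"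
    "(\<lambda>q. u q 1) \<in> smooth_funs A"
    by (simp_all add: sm)
  note s = smooth_funs_mult[OF A c(1) w(1)] smooth_funs_mult[OF A c(2) w(2)]
    smooth_funs_mult[OF A c(3) w(3)] smooth_funs_mult[OF A c(4) w(4)]
  note t = smooth_funs_diff[OF A s(1,2)]
  note t' = smooth_funs_add[OF A t s(3)]
  show "(\<lambda>q. det4 (x q) (y q) (z q) (u q)) \<in> smooth_funs A"
    unfolding det4_def by (rule smooth_funs_diff[OF A t' s(4)])
  have dw: "X p (\<lambda>q. minor3 2 3 4 (y q) (z q) (u q)) = minor3 2 3 4 (\<lambda>m. X p (\<lambda>q. y q m)) (z p) (u p) +
        minor3 2 3 4 (y p) (\<lambda>m. X p (\<lambda>q. z q m)) (u p) + minor3 2 3 4 (y p) (z p) (\<lambda>m. X p (\<lambda>q. u q m))"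
    "X p (\<lambda>q. minor3 2 3 4 (x q) (z q) (u q)) = minor3 2 3 4 (\<lambda>m. X p (\<lambda>q. x q m)) (z p) (u p) +
        minor3 2 3 4 (x p) (\<lambda>m. X p (\<lambda>q. z q m)) (u p) + minor3 2 3 4 (x p) (z p) (\<lambda>m. X p (\<lambda>q. u q m))"
    "X p (\<lambda>q. minor3 2 3 4 (x q) (y q) (u q)) = minor3 2 3 4 (\<lambda>m. X p (\<lambda>q. x q m)) (y p) (u p) +
        minor3 2 3 4 (x p) (\<lambda>m. X p (\<lambda>q. y q m)) (u p) + minor3 2 3 4 (x p) (y p) (\<lambda>m. X p (\<lambda>q. u q m))"
    "X p (\<lambda>q. minor3 2 3 4 (x q) (y q) (z q)) = minor3 2 3 4 (\<lambda>m. X p (\<lambda>q. x q m)) (y p) (z p) +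
        minor3 2 3 4 (x p) (\<lambda>m. X p (\<lambda>q. y q m)) (z p) + minor3 2 3 4 (x p) (y p) (\<lambda>m. X p (\<lambda>q. z q m))"
    by (rule deriv_minor3[OF A X]; rule sm; auto)+
  have eq: "X p (\<lambda>q. det4 (x q) (y q) (z q) (u q)) =
    X p (\<lambda>q. x q 1 * minor3 2 3 4 (y q) (z q) (u q)) - X p (\<lambda>q. y q 1 * minor3 2 3 4 (x q) (z q) (u q)) +
    X p (\<lambda>q. z q 1 * minor3 2 3 4 (x q) (y q) (u q)) - X p (\<lambda>q. u q 1 * minor3 2 3 4 (x q) (y q) (z q))"
    unfolding det4_def
    by (simp only: vfields_diff[OF A X t' s(4)] vfields_add[OF A X t s(3)] vfields_diff[OF A X s(1,2)])
  show "X p (\<lambda>q. det4 (x q) (y q) (z q) (u q)) = det4 (\<lambda>m. X p (\<lambda>q. x q m)) (y p) (z p) (u p) +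
      det4 (x p) (\<lambda>m. X p (\<lambda>q. y q m)) (z p) (u p) + det4 (x p) (y p) (\<lambda>m. X p (\<lambda>q. z q m)) (u p) +
      det4 (x p) (y p) (z p) (\<lambda>m. X p (\<lambda>q. u q m))"
    unfolding eq vfields_mult[OF A X c(1) w(1)] vfields_mult[OF A X c(2) w(2)]
      vfields_mult[OF A X c(3) w(3)] vfields_mult[OF A X c(4) w(4)] dw
    unfolding det4_def by (simp add: algebra_simps)
qed

text \<open>The value of \<open>d(\<theta>\<^sub>1 \<and> \<theta>\<^sub>2 \<and> \<theta>\<^sub>3 \<and> \<theta>\<^sub>4)\<close> on
  five vectors, up to sign. Expanding \<open>det4\<close> turns it into a combination of products \<open>(\<theta>\<^sub>s
  \<and> \<theta>\<^sub>t) \<and> (\<theta>\<^sub>u \<and> \<theta>\<^sub>v \<and> \<theta>\<^sub>w)\<close>, one for each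
  summand of \<open>d\<theta>\<^sub>2, d\<theta>\<^sub>3, d\<theta>\<^sub>4\<close>, and in each of them a factor is
  repeated.\<close>

lemma structure_form_det4:
  fixes a b c d f :: "nat \<Rightarrow> real"
  shows "det4 (\<lambda>k. structure_form k a b) c d f - det4 (\<lambda>k. structure_form k a c) b d f + det4 (\<lambda>k. structure_form k a d) b c f
   - det4 (\<lambda>k. structure_form k a f) b c d + det4 (\<lambda>k. structure_form k b c) a d f - det4 (\<lambda>k. structure_form k b d) a c f
   + det4 (\<lambda>k. structure_form k b f) a c d + det4 (\<lambda>k. structure_form k c d) a b f - det4 (\<lambda>k. structure_form k c f) a b d
   + det4 (\<lambda>k. structure_form k d f) a b c = 0"
proof -
  (* the value of the product of theta_s, theta_t and of theta_u, theta_v, theta_w on a, b, c, d, f *)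
  define S where "S s t u v w = minor2 s t a b * minor3 u v w c d f - minor2 s t a c * minor3 u v w b d f
    + minor2 s t a d * minor3 u v w b c f - minor2 s t a f * minor3 u v w b c d + minor2 s t b c * minor3 u v w a d f
    - minor2 s t b d * minor3 u v w a c f + minor2 s t b f * minor3 u v w a c d + minor2 s t c d * minor3 u v w a b f
    - minor2 s t c f * minor3 u v w a b d + minor2 s t d f * minor3 u v w a b c" for s t u v w
  have S0: "S s t s v w = 0" for s t v w
    unfolding S_def by (rule minor2_minor3_repeated)
  have rot: "S s t u v w = S s t v w u" for s t u v w
    unfolding S_def by (simp only: minor3_rotate[of u v w])
  have "S 1 5 1 3 4 = 0" "S 3 4 1 3 4 = 0" "S 4 6 1 3 4 = 0" "S 1 6 4 1 2 = 0" "S 2 4 4 1 2 = 0"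
    "S 4 5 4 1 2 = 0" "S 1 4 1 2 3 = 0"
    using S0[of 1 5 3 4] S0[of 3 4 4 1] S0[of 4 6 1 3] S0[of 1 6 2 4] S0[of 2 4 4 1] S0[of 4 5 1 2]
      S0[of 1 4 2 3] by (simp_all only: rot[of _ _ 1 3 4] rot[of _ _ 4 1 3] rot[of _ _ 4 1 2] rot[of _ _ 1 2 4])
  then have "- (1/2 * S 1 5 1 3 4 - S 3 4 1 3 4 + 1/2 * S 4 6 1 3 4)
      + (1/2 * S 1 6 4 1 2 + S 2 4 4 1 2 - 1/2 * S 4 5 4 1 2) + 2 * S 1 4 1 2 3 = 0"
    by simp
  then show ?thesis
    unfolding det4_expand structure_form_def S_def by (simp add: algebra_simps)
qed

lemma kaehler_form_alternating: "kaehler_form r x y = - kaehler_form r y x"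
  by (simp add: kaehler_form_def minor2_def)

text \<open>\<open>\<omega>\<^sub>r \<and> \<omega>\<^sub>r = 2 \<theta>\<^sub>1 \<and> \<theta>\<^sub>2 \<and> \<theta>\<^sub>3 \<and>
  \<theta>\<^sub>4\<close> for each \<open>r\<close>.\<close>

lemma kaehler_form_square_sum:
  "(\<Sum>r\<in>{1..3}. 2 * (kaehler_form r x y * kaehler_form r z u - kaehler_form r x z * kaehler_form r y u + kaehler_form r x u * kaehler_form r y z))
    = 6 * det4 x y z u"
  by (simp add: sum_3 kaehler_form_def det4_def minor3_def minor2_def) algebra

context qc_coframe
begin

lemma fund_form_coord:
  assumes "a \<in> tangent_space A p" "b \<in> tangent_space A p" "c \<in> tangent_space A p" "d \<in> tangent_space A p"
  shows "fund_form Q p [a, b, c, d] =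
    6 * det4 (\<lambda>i. \<theta> i p [a]) (\<lambda>i. \<theta> i p [b]) (\<lambda>i. \<theta> i p [c]) (\<lambda>i. \<theta> i p [d])"
proof -
  have om: "omega Q r p [v, w] = kaehler_form r (\<lambda>i. \<theta> i p [v]) (\<lambda>i. \<theta> i p [w])"
    if "r \<in> {1..3}" "v \<in> {a, b, c, d}" "w \<in> {a, b, c, d}" for r v w
    by (rule omega[OF that(1)]) (use that assms in auto)
  have alt: "omega Q r p [v, w] = - omega Q r p [w, v]"
    if "r \<in> {1..3}" "v \<in> {a, b, c, d}" "w \<in> {a, b, c, d}" for r v w
    using om[OF that] om[OF that(1,3,2)] kaehler_form_alternating by metis
  have "fund_form Q p [a, b, c, d] = (\<Sum>r\<in>{1..3}. 2 * (omega Q r p [a, b] * omega Q r p [c, d] -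
      omega Q r p [a, c] * omega Q r p [b, d] + omega Q r p [a, d] * omega Q r p [b, c]))"
    unfolding fund_form_def by (rule sum.cong[OF refl], rule wedge_2_2_self, rule alt)
  also have "\<dots> = 6 * det4 (\<lambda>i. \<theta> i p [a]) (\<lambda>i. \<theta> i p [b]) (\<lambda>i. \<theta> i p [c]) (\<lambda>i. \<theta> i p [d])"
    unfolding kaehler_form_square_sum[symmetric] by (rule sum.cong[OF refl]) (simp only: om insert_iff simp_thms)
  finally show ?thesis .
qed

text \<open>In Cartan's formula, replacing \<open>\<theta>\<^sub>k([X\<^sub>i, X\<^sub>j])\<close> by derivatives of coordinates and
  \<open>d\<theta>\<^sub>k(X\<^sub>i, X\<^sub>j)\<close> makes all derivatives of coordinates cancel; the terms with
  \<open>d\<theta>\<^sub>k\<close> add up to 0 by \<open>structure_form_det4\<close>.\<close>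

lemma fund_form_closed: "closed_form A 4 (fund_form Q)"
  unfolding closed_form_def d_eq_def
proof (intro allI impI)
  fix Xs :: "'g vfield list" assume Xs: "length Xs = Suc 4 \<and> set Xs \<subseteq> vfields A"
  then obtain X0 X1 X2 X3 X4 where eq: "Xs = [X0, X1, X2, X3, X4]"
  proof -
    have "length Xs = Suc (Suc (Suc (Suc (Suc 0))))" using Xs by linarith
    then show thesis using that unfolding length_Suc_conv length_0_conv by (elim exE conjE) simp
  qed
  have V: "X0 \<in> vfields A" "X1 \<in> vfields A" "X2 \<in> vfields A" "X3 \<in> vfields A" "X4 \<in> vfields A"
    using Xs eq by auto
  let ?c = "\<lambda>X q i. \<theta> i q [X q]"
  have ff: "fund_form Q q [X q, Y q, Z q, W q] = 6 * det4 (?c X q) (?c Y q) (?c Z q) (?c W q)"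
    if "X \<in> vfields A" "Y \<in> vfields A" "Z \<in> vfields A" "W \<in> vfields A" for X Y Z W q
    by (rule fund_form_coord) (simp_all add: vfields_tangent atlas that)
  have br: "fund_form Q q [bracket A X Y q, Z q, W q, U q] =
      6 * (det4 (\<lambda>k. X q (\<lambda>q. ?c Y q k)) (?c Z q) (?c W q) (?c U q) -
        det4 (\<lambda>k. Y q (\<lambda>q. ?c X q k)) (?c Z q) (?c W q) (?c U q) -
        det4 (\<lambda>k. structure_form k (?c X q) (?c Y q)) (?c Z q) (?c W q) (?c U q))"
    if "X \<in> vfields A" "Y \<in> vfields A" "Z \<in> vfields A" "W \<in> vfields A" "U \<in> vfields A" for X Y Z W U q
  proof -
    have "?c (bracket A X Y) q k = X q (\<lambda>q. ?c Y q k) - Y q (\<lambda>q. ?c X q k) - structure_form k (?c X q) (?c Y q)"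
      if "k \<in> {1..7}" for k
      using struct_eq[OF that \<open>X \<in> vfields A\<close> \<open>Y \<in> vfields A\<close>, of q] by (simp add: ext_d_one_form)
    then have "det4 (?c (bracket A X Y) q) (?c Z q) (?c W q) (?c U q) =
      det4 (\<lambda>k. X q (\<lambda>q. ?c Y q k) - Y q (\<lambda>q. ?c X q k) - structure_form k (?c X q) (?c Y q)) (?c Z q) (?c W q) (?c U q)"
      unfolding det4_expand by simp
    then show ?thesis
      by (simp add: ff vfields_bracket atlas that det4_diff)
  qed
  have D: "X p (\<lambda>q. fund_form Q q [Y q, Z q, W q, U q]) =
      6 * (det4 (\<lambda>k. X p (\<lambda>q. ?c Y q k)) (?c Z p) (?c W p) (?c U p)
        - det4 (\<lambda>k. X p (\<lambda>q. ?c Z q k)) (?c Y p) (?c W p) (?c U p)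
        + det4 (\<lambda>k. X p (\<lambda>q. ?c W q k)) (?c Y p) (?c Z p) (?c U p)
        - det4 (\<lambda>k. X p (\<lambda>q. ?c U q k)) (?c Y p) (?c Z p) (?c W p))"
    if "X \<in> vfields A" "Y \<in> vfields A" "Z \<in> vfields A" "W \<in> vfields A" "U \<in> vfields A" for X Y Z W U p
  proof -
    have sm: "(\<lambda>q. ?c Y q m) \<in> smooth_funs A" if "m \<in> {1..4}" "Y \<in> vfields A" for m Y
      using that by (simp add: coord_smooth)
    have d: "(\<lambda>q. det4 (?c Y q) (?c Z q) (?c W q) (?c U q)) \<in> smooth_funs A"
      "X p (\<lambda>q. det4 (?c Y q) (?c Z q) (?c W q) (?c U q)) =
        det4 (\<lambda>k. X p (\<lambda>q. ?c Y q k)) (?c Z p) (?c W p) (?c U p) +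
        det4 (?c Y p) (\<lambda>k. X p (\<lambda>q. ?c Z q k)) (?c W p) (?c U p) +
        det4 (?c Y p) (?c Z p) (\<lambda>k. X p (\<lambda>q. ?c W q k)) (?c U p) +
        det4 (?c Y p) (?c Z p) (?c W p) (\<lambda>k. X p (\<lambda>q. ?c U q k))"
      by (rule deriv_det4[OF atlas that(1)]; rule sm; use that in simp)+
    have "X p (\<lambda>q. fund_form Q q [Y q, Z q, W q, U q]) = X p (\<lambda>q. 6 * det4 (?c Y q) (?c Z q) (?c W q) (?c U q))"
      by (simp only: ff[OF that(2-5)])
    also have "\<dots> = 6 * X p (\<lambda>q. det4 (?c Y q) (?c Z q) (?c W q) (?c U q))"
      using vfields_mult[OF atlas that(1) smooth_funs_const[OF atlas, of 6] d(1), of p]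
      by (simp add: vfields_const[OF atlas that(1)])
    also note d(2)
    finally show ?thesis
      unfolding det4_swap(1)[of "?c Y p" "\<lambda>k. X p (\<lambda>q. ?c Z q k)" "?c W p" "?c U p"]
        det4_swap(2)[of "?c Y p" "?c Z p" "\<lambda>k. X p (\<lambda>q. ?c W q k)" "?c U p"]
        det4_swap(3)[of "?c Y p" "?c Z p" "?c W p" "\<lambda>k. X p (\<lambda>q. ?c U q k)"]
      by simp
  qed
  show "ext_d A (fund_form Q) Xs = eval_form (\<lambda>p vs. 0) Xs"
  proof (rule ext)
    fix p
    show "ext_d A (fund_form Q) Xs p = eval_form (\<lambda>p vs. 0) Xs p"
      using structure_form_det4[of "?c X0 p" "?c X1 p" "?c X2 p" "?c X3 p" "?c X4 p"]
      unfolding eq ext_d_four_form eval_form_def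
      by (simp add: D br V)
  qed
qed

end

section \<open>Existence of the Biquard connection\<close>

text \<open>The connection forms are \<open>\<psi>\<^sub>k\<^sub>j = conn_coeff k j * \<theta>\<^sub>l\<close> with \<open>l = conn_index
  k j\<close>; the matrix is skew, so its lower triangle is given. The entries with \<open>k, j \<le> 4\<close> come from
  Koszul's formula (those with \<open>\<theta>\<^sub>4\<close>) and from the skew part of \<open>[\<xi>, \<cdot>]\<close> on
  \<open>H\<close> (those with \<open>\<theta>\<^sub>5\<close> and \<open>\<theta>\<^sub>6\<close>); the others describe the
  action of this horizontal block on \<open>I\<^sub>1, I\<^sub>2, I\<^sub>3\<close> by commutators.\<close>

definition conn_lower :: "nat \<Rightarrow> nat \<Rightarrow> real" where
  "conn_lower k j = (
     if (k, j) \<in> {(2, 1), (3, 1), (4, 3)} then 1/4 else if (k, j) = (4, 2) then - 1/4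
     else if (k, j) = (3, 2) then 1 else if (k, j) = (4, 1) then - 2
     else if (k, j) = (6, 5) then - 1 else if (k, j) = (7, 5) then - 1/2
     else if (k, j) = (7, 6) then 1/2 else 0)"

definition conn_coeff :: "nat \<Rightarrow> nat \<Rightarrow> real" where
  "conn_coeff k j = conn_lower k j - conn_lower j k"

definition conn_index :: "nat \<Rightarrow> nat \<Rightarrow> nat" where
  "conn_index k j = (
     if (k, j) \<in> {(2, 1), (1, 2), (4, 3), (3, 4), (7, 6), (6, 7)} then 5
     else if (k, j) \<in> {(3, 1), (1, 3), (4, 2), (2, 4), (7, 5), (5, 7)} then 6 else 4)"

text \<open>The curvature form \<open>\<Omega>\<^sub>k\<^sub>j\<close>, for \<open>k, j \<le> 4\<close>, on vectors with coordinates
  \<open>x\<close> and \<open>y\<close>.\<close>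

definition curv_form :: "nat \<Rightarrow> nat \<Rightarrow> (nat \<Rightarrow> real) \<Rightarrow> (nat \<Rightarrow> real) \<Rightarrow> real" where
  "curv_form k j x y = (
     if (k, j) \<in> {(2, 1), (4, 3)} then 1/2 * (minor2 1 2 x y + minor2 3 4 x y)
     else if (k, j) \<in> {(1, 2), (3, 4)} then - 1/2 * (minor2 1 2 x y + minor2 3 4 x y)
     else if (k, j) \<in> {(3, 1), (2, 4)} then 1/2 * (minor2 1 3 x y - minor2 2 4 x y)
     else if (k, j) \<in> {(1, 3), (4, 2)} then - 1/2 * (minor2 1 3 x y - minor2 2 4 x y)
     else if (k, j) = (4, 1) then 4 * minor2 1 4 x y + 1/8 * minor2 5 6 x y
     else if (k, j) = (1, 4) then - 4 * minor2 1 4 x y - 1/8 * minor2 5 6 x y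
     else if (k, j) = (3, 2) then - 2 * minor2 1 4 x y + 1/8 * minor2 5 6 x y
     else if (k, j) = (2, 3) then 2 * minor2 1 4 x y - 1/8 * minor2 5 6 x y
     else 0)"

text \<open>The matrix of \<open>T\<^sub>\<xi>\<close> in the frame of \<open>H\<close>, where \<open>s\<close> and \<open>t\<close> are
  the coefficients of \<open>\<xi>\<^sub>1\<close> and \<open>\<xi>\<^sub>2\<close> in \<open>\<xi>\<close>.\<close>

definition torsion_coeff :: "real \<Rightarrow> real \<Rightarrow> nat \<Rightarrow> nat \<Rightarrow> real" where
  "torsion_coeff s t a b = (
     if (a, b) \<in> {(1, 2), (2, 1)} then - s / 4 else if (a, b) \<in> {(3, 4), (4, 3)} then s / 4
     else if (a, b) \<in> {(1, 3), (3, 1), (2, 4), (4, 2)} then - t / 4 else 0)"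

lemma torsion_coeff_sym: "torsion_coeff s t a b = torsion_coeff s t b a"
proof -
  have swap: "(a, b) \<in> R \<longleftrightarrow> (b, a) \<in> R" if "R = R\<inverse>" for R :: "(nat \<times> nat) set"
    using that by blast
  have "{(1, 2), (2, 1)} = {(1, 2), (2, 1 :: nat)}\<inverse>" "{(3, 4), (4, 3)} = {(3, 4), (4, 3 :: nat)}\<inverse>"
    "{(1, 3), (3, 1), (2, 4), (4, 2)} = {(1, 3), (3, 1), (2, 4), (4, 2 :: nat)}\<inverse>"
    by auto
  note this[THEN swap]
  then show ?thesis unfolding torsion_coeff_def by (simp only:)
qed

context qc_coframe
begin

definition conn_form :: "nat \<Rightarrow> nat \<Rightarrow> 'g form" where
  "conn_form k j = (\<lambda>p vs. conn_coeff k j * \<theta> (conn_index k j) p vs)"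

abbreviation nabla :: "'g conn" where "nabla \<equiv> frame_conn conn_form"

lemma conn_index_range: "conn_index k j \<in> {1..7}"
  by (simp add: conn_index_def)

lemma conn_form_one_form: "one_form A (conn_form k j)"
  unfolding conn_form_def by (rule one_form_scale[OF atlas coframe[OF conn_index_range]])

lemmas nabla_vfields = frame_conn_vfields[where \<psi> = conn_form, OF conn_form_one_form]
lemmas nabla_linear = linear_connection_frame_conn[where \<psi> = conn_form, OF conn_form_one_form]

lemma coord_nabla:
  "\<theta> 1 p [nabla X Y p] = X p (\<lambda>q. \<theta> 1 q [Y q]) - 1/4 * \<theta> 5 p [X p] * \<theta> 2 p [Y p] -
     1/4 * \<theta> 6 p [X p] * \<theta> 3 p [Y p] + 2 * \<theta> 4 p [X p] * \<theta> 4 p [Y p]"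
  "\<theta> 2 p [nabla X Y p] = X p (\<lambda>q. \<theta> 2 q [Y q]) + 1/4 * \<theta> 5 p [X p] * \<theta> 1 p [Y p] -
     \<theta> 4 p [X p] * \<theta> 3 p [Y p] + 1/4 * \<theta> 6 p [X p] * \<theta> 4 p [Y p]"
  "\<theta> 3 p [nabla X Y p] = X p (\<lambda>q. \<theta> 3 q [Y q]) + 1/4 * \<theta> 6 p [X p] * \<theta> 1 p [Y p] +
     \<theta> 4 p [X p] * \<theta> 2 p [Y p] - 1/4 * \<theta> 5 p [X p] * \<theta> 4 p [Y p]"
  "\<theta> 4 p [nabla X Y p] = X p (\<lambda>q. \<theta> 4 q [Y q]) - 2 * \<theta> 4 p [X p] * \<theta> 1 p [Y p] -
     1/4 * \<theta> 6 p [X p] * \<theta> 2 p [Y p] + 1/4 * \<theta> 5 p [X p] * \<theta> 3 p [Y p]"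
  "\<theta> 5 p [nabla X Y p] = X p (\<lambda>q. \<theta> 5 q [Y q]) + \<theta> 4 p [X p] * \<theta> 6 p [Y p] +
     1/2 * \<theta> 6 p [X p] * \<theta> 7 p [Y p]"
  "\<theta> 6 p [nabla X Y p] = X p (\<lambda>q. \<theta> 6 q [Y q]) - \<theta> 4 p [X p] * \<theta> 5 p [Y p] -
     1/2 * \<theta> 5 p [X p] * \<theta> 7 p [Y p]"
  "\<theta> 7 p [nabla X Y p] = X p (\<lambda>q. \<theta> 7 q [Y q]) - 1/2 * \<theta> 6 p [X p] * \<theta> 5 p [Y p] +
     1/2 * \<theta> 5 p [X p] * \<theta> 6 p [Y p]"
  by (simp_all add: coord_frame_conn sum_7 conn_form_def conn_coeff_def conn_lower_def conn_index_def)

lemma nabla_H: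
  assumes X: "X \<in> vfields A" and Y: "Y \<in> sections A (qc_H Q)"
  shows "nabla X Y \<in> sections A (qc_H Q)"
proof -
  note YV = sections_vfields[OF Y] and Yh = H_vertical[OF sections_mem[OF Y]]
  have "nabla X Y p \<in> qc_H Q p" for p
    unfolding H_iff
    by (simp add: vfields_tangent[OF atlas nabla_vfields[OF X YV]] coord_nabla Yh vfields_const[OF atlas X])
  then show ?thesis
    by (simp add: sections_def nabla_vfields[OF X YV])
qed

lemma V_horizontal: "v \<in> qc_V Q p \<Longrightarrow> \<theta> 1 p [v] = 0" "v \<in> qc_V Q p \<Longrightarrow> \<theta> 2 p [v] = 0"
  "v \<in> qc_V Q p \<Longrightarrow> \<theta> 3 p [v] = 0" "v \<in> qc_V Q p \<Longrightarrow> \<theta> 4 p [v] = 0"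
  by (simp_all add: V_iff)

lemma nabla_V:
  assumes X: "X \<in> vfields A" and Y: "Y \<in> sections A (qc_V Q)"
  shows "nabla X Y \<in> sections A (qc_V Q)"
proof -
  note YV = sections_vfields[OF Y] and Yh = V_horizontal[OF sections_mem[OF Y]]
  have "nabla X Y p \<in> qc_V Q p" for p
    unfolding V_iff
    by (simp add: vfields_tangent[OF atlas nabla_vfields[OF X YV]] coord_nabla Yh vfields_const[OF atlas X])
  then show ?thesis
    by (simp add: sections_def nabla_vfields[OF X YV])
qed

text \<open>The connection matrix is skew with respect to the orthonormal frame.\<close>

lemma nabla_metric:
  assumes X: "X \<in> vfields A" and Y: "Y \<in> vfields A" and Z: "Z \<in> vfields A"
  shows "X p (\<lambda>q. ext_g Q q (Y q) (Z q)) = ext_g Q p (nabla X Y p) (Z p) + ext_g Q p (Y p) (nabla X Z p)"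
proof -
  have s: "(\<lambda>q. \<theta> i q [Y q]) \<in> smooth_funs A" "(\<lambda>q. \<theta> i q [Z q]) \<in> smooth_funs A" if "i \<in> {1..7}" for i
    using that by (simp_all add: coord_smooth Y Z)
  have "X p (\<lambda>q. ext_g Q q (Y q) (Z q)) = X p (\<lambda>q. \<Sum>i\<in>{1..7}. \<theta> i q [Y q] * \<theta> i q [Z q])"
    by (simp only: ext_g_coord[OF vfields_tangent[OF atlas Y] vfields_tangent[OF atlas Z]])
  also have "\<dots> = (\<Sum>i\<in>{1..7}. X p (\<lambda>q. \<theta> i q [Y q] * \<theta> i q [Z q]))"
    by (rule vfields_sum[OF atlas X smooth_funs_mult[OF atlas s]])
  also have "\<dots> = (\<Sum>i\<in>{1..7}. X p (\<lambda>q. \<theta> i q [Y q]) * \<theta> i p [Z p] + \<theta> i p [Y p] * X p (\<lambda>q. \<theta> i q [Z q]))"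
    by (rule sum.cong[OF refl]) (rule vfields_mult[OF atlas X s])
  also have "\<dots> = (\<Sum>i\<in>{1..7}. \<theta> i p [nabla X Y p] * \<theta> i p [Z p]) + (\<Sum>i\<in>{1..7}. \<theta> i p [Y p] * \<theta> i p [nabla X Z p])"
    unfolding sum_7 coord_nabla by algebra
  also have "\<dots> = ext_g Q p (nabla X Y p) (Z p) + ext_g Q p (Y p) (nabla X Z p)"
    by (simp only: ext_g_coord[OF vfields_tangent[OF atlas nabla_vfields[OF X Y]] vfields_tangent[OF atlas Z]]
      ext_g_coord[OF vfields_tangent[OF atlas Y] vfields_tangent[OF atlas nabla_vfields[OF X Z]]])
  finally show ?thesis .
qed

lemma coord_torsion_nabla:
  assumes "X \<in> vfields A" "Y \<in> vfields A" "k \<in> {1..7}"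
  shows "\<theta> k p [torsion A nabla X Y p] = structure_form k (\<lambda>i. \<theta> i p [X p]) (\<lambda>i. \<theta> i p [Y p]) +
    (\<Sum>j\<in>{1..7}. conn_coeff k j * (\<theta> (conn_index k j) p [X p] * \<theta> j p [Y p] - \<theta> (conn_index k j) p [Y p] * \<theta> j p [X p]))"
  using coord_torsion[where \<psi> = conn_form, OF conn_form_one_form assms(3,1,2)] struct_eq[OF assms(3,1,2)]
  by (simp add: conn_form_def algebra_simps)

lemmas nabla_eval = sum_7 conn_coeff_def conn_lower_def conn_index_def structure_form_def minor2_def

lemma torsion_nabla_vfields: "X \<in> vfields A \<Longrightarrow> Y \<in> vfields A \<Longrightarrow> torsion A nabla X Y \<in> vfields A"
  by (rule torsion_vfields[OF conn_form_one_form])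

text \<open>By the first structure equation the horizontal coordinates of the torsion vanish. A vertical coordinate is
  \<open>d\<theta>\<^sub>k(X, Y)\<close>, which is \<open>- \<theta>\<^sub>k([X, Y])\<close> for horizontal fields.\<close>

lemma torsion_nabla_HH:
  assumes X: "X \<in> sections A (qc_H Q)" and Y: "Y \<in> sections A (qc_H Q)"
  shows "torsion A nabla X Y p f = - vert Q p (bracket A X Y p) f"
proof -
  note XV = sections_vfields[OF X] and YV = sections_vfields[OF Y]
  note h = H_vertical[OF sections_mem[OF X]] H_vertical[OF sections_mem[OF Y]]
  have "torsion A nabla X Y p = tcomb (-1) (vert Q p (bracket A X Y p)) 0 (vert Q p (bracket A X Y p))"
  proof (rule tangent_eqI)
    fix k :: nat assume k: "k \<in> {1..7}"
    have br: "\<theta> m p [bracket A X Y p] = - structure_form m (\<lambda>i. \<theta> i p [X p]) (\<lambda>i. \<theta> i p [Y p])"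
      if "m \<in> {5, 6, 7}" for m
      using struct_eq[of m, OF _ XV YV, of p] that
      by (auto simp: ext_d_one_form h vfields_const[OF atlas XV] vfields_const[OF atlas YV])
    show "\<theta> k p [torsion A nabla X Y p] = \<theta> k p [tcomb (-1) (vert Q p (bracket A X Y p)) 0 (vert Q p (bracket A X Y p))]"
      unfolding coord_torsion_nabla[OF XV YV k] coord_tcomb[OF k vert_tangent vert_tangent] coord_vert[OF k]
      using cases_1_7[OF k] by (elim disjE) (simp_all add: br h nabla_eval)
  qed (simp_all add: vfields_tangent[OF atlas torsion_nabla_vfields[OF XV YV]] tangent_space_tcomb atlas vert_tangent)
  then show ?thesis by (simp add: tcomb_def)
qed

lemma torsion_nabla_VH:
  assumes xi: "\<xi> \<in> sections A (qc_V Q)" and X: "X \<in> sections A (qc_H Q)"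
  shows "torsion A nabla \<xi> X \<in> sections A (qc_H Q)"
    and "a \<in> {1..4} \<Longrightarrow> \<theta> a p [torsion A nabla \<xi> X p] =
      (\<Sum>b\<in>{1..4}. torsion_coeff (\<theta> 5 p [\<xi> p]) (\<theta> 6 p [\<xi> p]) a b * \<theta> b p [X p])"
proof -
  note xV = sections_vfields[OF xi] and XV = sections_vfields[OF X]
  note h = V_horizontal[OF sections_mem[OF xi]] H_vertical[OF sections_mem[OF X]]
  have "torsion A nabla \<xi> X p \<in> qc_H Q p" for p
    unfolding H_iff
    by (simp add: vfields_tangent[OF atlas torsion_nabla_vfields[OF xV XV]] coord_torsion_nabla[OF xV XV] h nabla_eval)
  then show "torsion A nabla \<xi> X \<in> sections A (qc_H Q)"
    by (simp add: sections_def torsion_nabla_vfields[OF xV XV])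
  assume a: "a \<in> {1..4}"
  then have a7: "a \<in> {1..7}" by simp
  show "\<theta> a p [torsion A nabla \<xi> X p] =
      (\<Sum>b\<in>{1..4}. torsion_coeff (\<theta> 5 p [\<xi> p]) (\<theta> 6 p [\<xi> p]) a b * \<theta> b p [X p])"
    unfolding coord_torsion_nabla[OF xV XV a7]
    using cases_1_4[OF a] by (elim disjE) (simp_all add: h nabla_eval sum_4 torsion_coeff_def algebra_simps)
qed

lemma endo_coord:
  assumes B: "endo_on (qc_H Q p) B" and v: "v \<in> qc_H Q p" and a: "a \<in> {1..4}"
  shows "\<theta> a p [B v] = (\<Sum>c\<in>{1..4}. \<theta> c p [v] * \<theta> a p [B (e c p)])"
proof (rule H_linear_form[OF _ v, of "\<lambda>v. \<theta> a p [B v]"])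
  have a7: "a \<in> {1..7}" using a by simp
  show "linear_form_on (qc_H Q p) (\<lambda>v. \<theta> a p [B v])"
    unfolding linear_form_on_def
  proof (intro ballI allI)
    fix v w x y assume vw: "v \<in> qc_H Q p" "w \<in> qc_H Q p"
    then have "B v \<in> qc_H Q p" "B w \<in> qc_H Q p" "B (tcomb x v y w) = tcomb x (B v) y (B w)"
      using B unfolding endo_on_def by blast+
    then show "\<theta> a p [B (tcomb x v y w)] = x * \<theta> a p [B v] + y * \<theta> a p [B w]"
      by (simp add: coord_tcomb[OF a7] H_tangent)
  qed
qed

lemma orthonormal_coord:
  assumes "orthonormal_basis_at Q p b" "i \<in> {1..4}" "j \<in> {1..4}"
  shows "(\<Sum>c\<in>{1..4}. \<theta> c p [b i] * \<theta> c p [b j]) = (if i = j then 1 else 0)"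
proof -
  have "b i \<in> qc_H Q p" "b j \<in> qc_H Q p" "qc_g Q p (b i) (b j) = (if i = j then 1 else 0)"
    using assms unfolding orthonormal_basis_at_def by blast+
  then show ?thesis by (simp add: g_coord)
qed

text \<open>Symmetric endomorphisms are orthogonal to skew ones. The trace is taken over an arbitrary orthonormal basis \<open>b\<close>,
  in which \<open>T\<close> lists the images of the basis vectors under the symmetric endomorphism with matrix
  \<open>\<tau>\<close> in the frame.\<close>

lemma trace_symmetric_skew:
  assumes E: "orthonormal_basis_at Q p b" and T: "\<And>i. i \<in> {1..4} \<Longrightarrow> T i \<in> qc_H Q p"
    and Tc: "\<And>i a. i \<in> {1..4} \<Longrightarrow> a \<in> {1..4} \<Longrightarrow> \<theta> a p [T i] = (\<Sum>c\<in>{1..4}. \<tau> a c * \<theta> c p [b i])"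
    and sym: "\<And>a c. \<tau> a c = \<tau> c a"
    and B: "endo_on (qc_H Q p) B"
    and skew: "\<And>v w. v \<in> qc_H Q p \<Longrightarrow> w \<in> qc_H Q p \<Longrightarrow> qc_g Q p (B v) w = - qc_g Q p v (B w)"
  shows "(\<Sum>i\<in>{1..4}. qc_g Q p (T i) (B (b i))) = 0"
proof -
  define \<beta> where "\<beta> a c = \<theta> a p [B (e c p)]" for a c
  have BH: "B v \<in> qc_H Q p" if "v \<in> qc_H Q p" for v using B that unfolding endo_on_def by blast
  have bH: "b i \<in> qc_H Q p" if "i \<in> {1..4}" for i using E that unfolding orthonormal_basis_at_def by blast
  have b_skew: "\<beta> a c = - \<beta> c a" if "a \<in> {1..4}" "c \<in> {1..4}" for a c
  proof -
    have "qc_g Q p (B (e c p)) (e a p) = - qc_g Q p (e c p) (B (e a p))"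
      by (rule skew) (use that frame_H in auto)
    then show ?thesis
      using cases_1_4[OF that(1)] cases_1_4[OF that(2)]
      by (elim disjE) (simp_all add: g_coord frame_H BH sum_4 dual \<beta>_def)
  qed
  have "qc_g Q p (T i) (B (b i)) = (\<Sum>x\<in>{1..4}. \<Sum>y\<in>{1..4}. (\<Sum>a\<in>{1..4}. \<tau> a x * \<beta> a y) * \<theta> x p [b i] * \<theta> y p [b i])"
    if i: "i \<in> {1..4}" for i
  proof -
    have "qc_g Q p (T i) (B (b i)) = (\<Sum>a\<in>{1..4}. (\<Sum>c\<in>{1..4}. \<tau> a c * \<theta> c p [b i]) * (\<Sum>c\<in>{1..4}. \<theta> c p [b i] * \<beta> a c))"
      unfolding g_coord[OF T[OF i] BH[OF bH[OF i]]]
      by (rule sum.cong[OF refl]) (simp only: Tc[OF i] endo_coord[OF B bH[OF i]] \<beta>_def)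
    then show ?thesis
      unfolding sum_4 by algebra
  qed
  then have "(\<Sum>i\<in>{1..4}. qc_g Q p (T i) (B (b i))) =
      (\<Sum>i\<in>{1..4}. \<Sum>x\<in>{1..4}. \<Sum>y\<in>{1..4}. (\<Sum>a\<in>{1..4}. \<tau> a x * \<beta> a y) * \<theta> x p [b i] * \<theta> y p [b i])"
    by simp
  also have "\<dots> = (\<Sum>x\<in>{1..4}. \<Sum>a\<in>{1..4}. \<tau> a x * \<beta> a x)"
    by (rule trace_orthonormal[where f = "\<lambda>i x. \<theta> x p [b i]"]) (rule orthonormal_coord[OF E])
  also have "\<dots> = 0"
    using b_skew[of 1 1] b_skew[of 2 2] b_skew[of 3 3] b_skew[of 4 4] b_skew[of 1 2] b_skew[of 1 3] b_skew[of 1 4]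
      b_skew[of 2 3] b_skew[of 2 4] b_skew[of 3 4] sym[of 2 1] sym[of 3 1] sym[of 4 1] sym[of 3 2] sym[of 4 2] sym[of 4 3]
    by (simp add: sum_4)
  finally show ?thesis .
qed

lemma quat_endo_H:
  assumes v: "v \<in> qc_H Q p"
  shows "quat_endo Q a p v \<in> qc_H Q p"
    and "k \<in> {1..4} \<Longrightarrow> \<theta> k p [quat_endo Q a p v] =
      (\<Sum>r\<in>{1..3}. a r p * quat_mult r (\<lambda>i. \<theta> i p [v]) k)"
proof -
  have t: "qc_I Q r p v \<in> tangent_space A p" if "r \<in> {1..3}" for r
    by (rule H_tangent[OF I_H[OF that v]])
  have c: "\<theta> k p [quat_endo Q a p v] = (\<Sum>r\<in>{1..3}. a r p * \<theta> k p [qc_I Q r p v])" if "k \<in> {1..7}" for k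
    unfolding quat_endo_def by (rule one_form_sum[OF atlas coframe[OF that] t])
  have "quat_endo Q a p v \<in> tangent_space A p"
    unfolding quat_endo_def by (rule tangent_space_sum[OF atlas t])
  then show "quat_endo Q a p v \<in> qc_H Q p"
    unfolding H_iff by (simp add: c sum_3 H_vertical I_H v)
  assume k: "k \<in> {1..4}"
  then have k7: "k \<in> {1..7}" by simp
  show "\<theta> k p [quat_endo Q a p v] = (\<Sum>r\<in>{1..3}. a r p * quat_mult r (\<lambda>i. \<theta> i p [v]) k)"
    unfolding c[OF k7] by (intro sum.cong refl) (simp only: coord_I[OF _ v k])
qed

lemma appl_quat_section:
  assumes a: "\<And>r. r \<in> {1..3} \<Longrightarrow> a r \<in> smooth_funs A" and Y: "Y \<in> sections A (qc_H Q)"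
  shows "appl (quat_endo Q a) Y \<in> sections A (qc_H Q)"
proof -
  have "appl (quat_endo Q a) Y = lincomb {1..3} a (\<lambda>r. appl (qc_I Q r) Y)"
    by (simp add: appl_def quat_endo_def lincomb_def)
  also have "\<dots> \<in> vfields A"
    by (rule vfields_lincomb[OF atlas _ a]) (auto intro: sections_vfields[OF appl_I_section[OF _ Y]])
  finally show ?thesis
    using quat_endo_H(1)[OF sections_mem[OF Y]] by (simp add: sections_def appl_def)
qed

lemma phi_coord:
  assumes "v \<in> qc_H Q p" "k \<in> {1..4}"
  shows "\<theta> k p [phi Q \<xi> p v] = (\<Sum>r\<in>{1..3}. \<theta> (4 + r) p [\<xi> p] * quat_mult r (\<lambda>i. \<theta> i p [v]) k)"
  unfolding phi_def quat_endo_H(2)[OF assms] by (intro sum.cong refl) (simp add: eta)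

lemma phi_section:
  assumes "\<xi> \<in> vfields A" "Y \<in> sections A (qc_H Q)"
  shows "appl (phi Q \<xi>) Y \<in> sections A (qc_H Q)"
  unfolding phi_def by (rule appl_quat_section[OF _ assms(2)]) (simp add: eta coord_smooth assms(1))

text \<open>Up to sign, \<open>quat_mult\<close> only permutes coordinates, so it commutes with derivations.\<close>

lemma deriv_quat_mult:
  assumes X: "X \<in> vfields A" and Y: "Y \<in> vfields A" and r: "r \<in> {1..3}" and k: "k \<in> {1..4}"
  shows "(\<lambda>q. quat_mult r (\<lambda>i. \<theta> i q [Y q]) k) \<in> smooth_funs A"
    "X p (\<lambda>q. quat_mult r (\<lambda>i. \<theta> i q [Y q]) k) = quat_mult r (\<lambda>i. X p (\<lambda>q. \<theta> i q [Y q])) k"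
  using cases_1_3[OF r] cases_1_4[OF k]
  by (elim disjE; simp add: quat_mult_simps coord_smooth Y smooth_funs_uminus atlas vfields_uminus[OF atlas X])+

text \<open>The derivatives of the coordinates of \<open>\<xi>\<close> and \<open>Y\<close> match by the Leibniz rule. The remaining
  terms say that the vertical block of the connection matrix is the action of the horizontal block on \<open>I\<^sub>1,
  I\<^sub>2, I\<^sub>3\<close> by commutators, which is how that block was chosen.\<close>

lemma phi_parallel:
  assumes X: "X \<in> vfields A" and xi: "\<xi> \<in> sections A (qc_V Q)" and Y: "Y \<in> sections A (qc_H Q)"
  shows "nabla_endo nabla X (phi Q \<xi>) Y = appl (phi Q (nabla X \<xi>)) Y"
proof -
  let ?Z = "appl (phi Q \<xi>) Y" and ?W = "appl (phi Q \<xi>) (nabla X Y)"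
  note xV = sections_vfields[OF xi] and YV = sections_vfields[OF Y]
  note YH = sections_mem[OF Y] and DYH = sections_mem[OF nabla_H[OF X Y]]
  have Z: "?Z \<in> sections A (qc_H Q)" by (rule phi_section[OF xV Y])
  have W: "?W \<in> sections A (qc_H Q)" by (rule phi_section[OF xV nabla_H[OF X Y]])
  have R: "appl (phi Q (nabla X \<xi>)) Y \<in> sections A (qc_H Q)" by (rule phi_section[OF nabla_vfields[OF X xV] Y])
  have DZ: "nabla X ?Z \<in> sections A (qc_H Q)" by (rule nabla_H[OF X Z])
  have nab: "nabla_endo nabla X (phi Q \<xi>) Y = vdiff (nabla X ?Z) ?W" by (simp add: nabla_endo_def)
  have Zc: "\<theta> k q [?Z q] = (\<Sum>r\<in>{1..3}. \<theta> (4 + r) q [\<xi> q] * quat_mult r (\<lambda>i. \<theta> i q [Y q]) k)"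
    if "k \<in> {1..4}" for k q
    unfolding appl_def by (rule phi_coord[OF YH that])
  have Wc: "\<theta> k q [?W q] = (\<Sum>r\<in>{1..3}. \<theta> (4 + r) q [\<xi> q] * quat_mult r (\<lambda>i. \<theta> i q [nabla X Y q]) k)"
    if "k \<in> {1..4}" for k q
    unfolding appl_def by (rule phi_coord[OF DYH that])
  have Rc: "\<theta> k q [appl (phi Q (nabla X \<xi>)) Y q] =
      (\<Sum>r\<in>{1..3}. \<theta> (4 + r) q [nabla X \<xi> q] * quat_mult r (\<lambda>i. \<theta> i q [Y q]) k)"
    if "k \<in> {1..4}" for k q
    unfolding appl_def by (rule phi_coord[OF YH that])
  have XZ: "X p (\<lambda>q. \<theta> k q [?Z q]) = (\<Sum>r\<in>{1..3}.
      X p (\<lambda>q. \<theta> (4 + r) q [\<xi> q]) * quat_mult r (\<lambda>i. \<theta> i p [Y p]) k +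
      \<theta> (4 + r) p [\<xi> p] * quat_mult r (\<lambda>i. X p (\<lambda>q. \<theta> i q [Y q])) k)" if k: "k \<in> {1..4}" for k p
  proof -
    have s: "(\<lambda>q. \<theta> (4 + r) q [\<xi> q]) \<in> smooth_funs A" if "r \<in> {1..3}" for r
      using that by (simp add: coord_smooth xV)
    note m = deriv_quat_mult[OF X YV _ k]
    have "X p (\<lambda>q. \<theta> k q [?Z q]) =
      X p (\<lambda>q. \<Sum>r\<in>{1..3}. \<theta> (4 + r) q [\<xi> q] * quat_mult r (\<lambda>i. \<theta> i q [Y q]) k)"
      by (simp only: Zc[OF k])
    also have "\<dots> = (\<Sum>r\<in>{1..3}. X p (\<lambda>q. \<theta> (4 + r) q [\<xi> q] * quat_mult r (\<lambda>i. \<theta> i q [Y q]) k))"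
      by (rule vfields_sum[OF atlas X smooth_funs_mult[OF atlas s m(1)]])
    also have "\<dots> = (\<Sum>r\<in>{1..3}.
      X p (\<lambda>q. \<theta> (4 + r) q [\<xi> q]) * quat_mult r (\<lambda>i. \<theta> i p [Y p]) k +
      \<theta> (4 + r) p [\<xi> p] * X p (\<lambda>q. quat_mult r (\<lambda>i. \<theta> i q [Y q]) k))"
      by (rule sum.cong[OF refl]) (rule vfields_mult[OF atlas X s m(1)])
    finally show ?thesis by (simp add: m(2))
  qed
  have eq: "\<theta> k p [nabla X ?Z p] - \<theta> k p [?W p] = \<theta> k p [appl (phi Q (nabla X \<xi>)) Y p]"
    if k: "k \<in> {1..4}" for k p
  proof -
    have n: "4 + 1 = (5::nat)" "4 + 2 = (6::nat)" "4 + 3 = (7::nat)" by simp_all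
    have i: "1 \<in> {1..4::nat}" "2 \<in> {1..4::nat}" "3 \<in> {1..4::nat}" "4 \<in> {1..4::nat}" by simp_all
    note d = coord_nabla XZ[OF i(1)] XZ[OF i(2)] XZ[OF i(3)] XZ[OF i(4)]
    note e = Zc[OF i(1)] Zc[OF i(2)] Zc[OF i(3)] Zc[OF i(4)]
      Wc[OF i(1)] Wc[OF i(2)] Wc[OF i(3)] Wc[OF i(4)] Rc[OF i(1)] Rc[OF i(2)] Rc[OF i(3)] Rc[OF i(4)]
      sum_3 n quat_mult_simps
    have "\<theta> 1 p [nabla X ?Z p] - \<theta> 1 p [?W p] = \<theta> 1 p [appl (phi Q (nabla X \<xi>)) Y p]"
      unfolding d unfolding e unfolding coord_nabla by algebra
    moreover have "\<theta> 2 p [nabla X ?Z p] - \<theta> 2 p [?W p] = \<theta> 2 p [appl (phi Q (nabla X \<xi>)) Y p]"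
      unfolding d unfolding e unfolding coord_nabla by algebra
    moreover have "\<theta> 3 p [nabla X ?Z p] - \<theta> 3 p [?W p] = \<theta> 3 p [appl (phi Q (nabla X \<xi>)) Y p]"
      unfolding d unfolding e unfolding coord_nabla by algebra
    moreover have "\<theta> 4 p [nabla X ?Z p] - \<theta> 4 p [?W p] = \<theta> 4 p [appl (phi Q (nabla X \<xi>)) Y p]"
      unfolding d unfolding e unfolding coord_nabla by algebra
    ultimately show ?thesis using cases_1_4[OF k] by auto
  qed
  have "vdiff (nabla X ?Z) ?W p = appl (phi Q (nabla X \<xi>)) Y p" for p
  proof (rule H_eqI)
    have vd: "vdiff (nabla X ?Z) ?W p = tcomb 1 (nabla X ?Z p) (-1) (?W p)"
      by (simp add: vdiff_def tcomb_def)
    show "vdiff (nabla X ?Z) ?W p \<in> qc_H Q p"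
      unfolding vd by (rule H_tcomb[OF sections_mem[OF DZ] sections_mem[OF W]])
    show "appl (phi Q (nabla X \<xi>)) Y p \<in> qc_H Q p" by (rule sections_mem[OF R])
    fix k :: nat assume k: "k \<in> {1..4}"
    then have "k \<in> {1..7}" by simp
    then show "\<theta> k p [vdiff (nabla X ?Z) ?W p] = \<theta> k p [appl (phi Q (nabla X \<xi>)) Y p]"
      unfolding eq[OF k, symmetric]
      by (rule one_form_vdiff[OF atlas coframe sections_vfields[OF DZ] sections_vfields[OF W]])
  qed
  then show ?thesis unfolding nab by (rule ext)
qed

text \<open>Both copies of \<open>sp(1)\<close> consist of skew endomorphisms; for the first one this is the skewness of the
  \<open>\<omega>\<^sub>r\<close>.\<close>

lemma sp1_endo_skew:
  assumes "B \<in> sp1_first Q p \<union> sp1_second Q p"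
  shows "endo_on (qc_H Q p) B"
    and "\<And>v w. v \<in> qc_H Q p \<Longrightarrow> w \<in> qc_H Q p \<Longrightarrow> qc_g Q p (B v) w = - qc_g Q p v (B w)"
proof -
  have "endo_on (qc_H Q p) B \<and>
    (\<forall>v\<in>qc_H Q p. \<forall>w\<in>qc_H Q p. qc_g Q p (B v) w = - qc_g Q p v (B w))"
  proof (cases "B \<in> sp1_second Q p")
    case True
    then show ?thesis unfolding sp1_second_def by blast
  next
    case False
    then obtain c where "B = (\<lambda>v f. \<Sum>r\<in>{1..3}. c r * qc_I Q r p v f)"
      using assms unfolding sp1_first_def by blast
    then have B: "B = quat_endo Q (\<lambda>r p. c r) p"
      by (simp add: quat_endo_def fun_eq_iff)
    note BH = quat_endo_H(1)[of _ p "\<lambda>r p. c r"] and Bc = quat_endo_H(2)[of _ p _ "\<lambda>r p. c r"]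
    show ?thesis
    proof (intro conjI ballI)
      show "endo_on (qc_H Q p) B"
        unfolding endo_on_def B
      proof (intro conjI ballI allI)
        fix v w a b assume v: "v \<in> qc_H Q p" and w: "w \<in> qc_H Q p"
        show "quat_endo Q (\<lambda>r p. c r) p (tcomb a v b w) =
          tcomb a (quat_endo Q (\<lambda>r p. c r) p v) b (quat_endo Q (\<lambda>r p. c r) p w)"
        proof (rule H_eqI)
          fix k :: nat assume k: "k \<in> {1..4}"
          show "\<theta> k p [quat_endo Q (\<lambda>r p. c r) p (tcomb a v b w)] =
            \<theta> k p [tcomb a (quat_endo Q (\<lambda>r p. c r) p v) b (quat_endo Q (\<lambda>r p. c r) p w)]"
            using cases_1_4[OF k]
            by (elim disjE) (simp_all add: Bc coord_tcomb H_tcomb H_tangent BH v w sum_3 quat_mult_simps algebra_simps)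
        qed (simp_all add: BH H_tcomb v w)
      qed (rule BH)
      fix v w assume v: "v \<in> qc_H Q p" and w: "w \<in> qc_H Q p"
      show "qc_g Q p (B v) w = - qc_g Q p v (B w)"
        unfolding B by (simp add: g_coord BH v w Bc sum_4 sum_3 quat_mult_simps algebra_simps)
    qed
  qed
  then show "endo_on (qc_H Q p) B"
    and "\<And>v w. v \<in> qc_H Q p \<Longrightarrow> w \<in> qc_H Q p \<Longrightarrow> qc_g Q p (B v) w = - qc_g Q p v (B w)"
    by blast+
qed

text \<open>The bundle of the \<open>I\<^sub>r\<close> is preserved because \<open>\<phi>\<close> is parallel: a section
  \<open>\<Sum>\<^sub>r a\<^sub>r I\<^sub>r\<close> is the image under \<open>\<phi>\<close> of \<open>\<Sum>\<^sub>r
  a\<^sub>r \<xi>\<^sub>r\<close>. The orthogonality of \<open>T\<^sub>\<xi>\<close> to \<open>sp(1) \<oplus> sp(1)\<close>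
  is that of symmetric and skew endomorphisms.\<close>

lemma nabla_biquard: "biquard_connection A Q nabla"
  unfolding biquard_connection_def
proof (intro conjI ballI allI impI)
  show "linear_connection A nabla" by (rule nabla_linear)
  show "nabla X Y \<in> sections A (qc_H Q)" if "X \<in> vfields A" "Y \<in> sections A (qc_H Q)" for X Y
    using that by (rule nabla_H)
  show "nabla X Y \<in> sections A (qc_V Q)" if "X \<in> vfields A" "Y \<in> sections A (qc_V Q)" for X Y
    using that by (rule nabla_V)
  show "X p (\<lambda>q. ext_g Q q (Y q) (Z q)) = ext_g Q p (nabla X Y p) (Z p) + ext_g Q p (Y p) (nabla X Z p)"
    if "X \<in> vfields A" "Y \<in> vfields A" "Z \<in> vfields A" for X Y Z p
    using that by (rule nabla_metric)
  show "torsion A nabla X Y p f = - vert Q p (bracket A X Y p) f"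
    if "X \<in> sections A (qc_H Q)" "Y \<in> sections A (qc_H Q)" for X Y p f
    using that by (rule torsion_nabla_HH)
  show "torsion A nabla \<xi> X \<in> sections A (qc_H Q)"
    if "\<xi> \<in> sections A (qc_V Q)" "X \<in> sections A (qc_H Q)" for \<xi> X
    using that by (rule torsion_nabla_VH)
  show "nabla_endo nabla X (phi Q \<xi>) Y = appl (phi Q (nabla X \<xi>)) Y"
    if "X \<in> vfields A" "\<xi> \<in> sections A (qc_V Q)" "Y \<in> sections A (qc_H Q)" for X \<xi> Y
    using that by (rule phi_parallel)
next
  fix \<xi> E p B
  assume xi: "\<xi> \<in> sections A (qc_V Q)"
    and E: "(\<forall>i\<in>{1..4}. E i \<in> sections A (qc_H Q)) \<and> orthonormal_basis_at Q p (\<lambda>i. E i p)"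
    and B: "B \<in> sp1_first Q p \<union> sp1_second Q p"
  have EH: "E i \<in> sections A (qc_H Q)" if "i \<in> {1..4}" for i using E that by blast
  show "(\<Sum>i\<in>{1..4}. qc_g Q p (torsion A nabla \<xi> (E i) p) (B (E i p))) = 0"
  proof (rule trace_symmetric_skew[where b = "\<lambda>i. E i p" and
        \<tau> = "torsion_coeff (\<theta> 5 p [\<xi> p]) (\<theta> 6 p [\<xi> p])"])
    show "orthonormal_basis_at Q p (\<lambda>i. E i p)" using E by blast
    show "torsion A nabla \<xi> (E i) p \<in> qc_H Q p" if "i \<in> {1..4}" for i
      by (rule sections_mem[OF torsion_nabla_VH(1)[OF xi EH[OF that]]])
    show "\<theta> a p [torsion A nabla \<xi> (E i) p] = (\<Sum>c\<in>{1..4}.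
        torsion_coeff (\<theta> 5 p [\<xi> p]) (\<theta> 6 p [\<xi> p]) a c * \<theta> c p [E i p])"
      if "i \<in> {1..4}" "a \<in> {1..4}" for i a
      by (rule torsion_nabla_VH(2)[OF xi EH[OF that(1)] that(2)])
  qed (rule torsion_coeff_sym sp1_endo_skew[OF B]; assumption?)+
next
  fix \<sigma> X assume s: "\<sigma> \<in> quat_sections A Q" and X: "X \<in> vfields A"
  then obtain a where a: "\<sigma> = quat_endo Q a" "\<And>r. r \<in> {1..3} \<Longrightarrow> a r \<in> smooth_funs A"
    unfolding quat_sections_def by blast
  (* the frame fields e 5, e 6, e 7 are xi_1, xi_2, xi_3, hence the shift of the index by 4 *)
  define \<xi> where "\<xi> = lincomb {5..7} (\<lambda>j. a (j - 4)) e"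
  have xV: "\<xi> \<in> vfields A"
    unfolding \<xi>_def by (rule vfields_lincomb[OF atlas _ a(2) frame]) auto
  have xc: "\<theta> k p [\<xi> p] = (if k \<in> {5..7} then a (k - 4) p else 0)" if "k \<in> {1..7}" for k p
    unfolding \<xi>_def by (rule coord_lincomb[OF that]) auto
  have xi: "\<xi> \<in> sections A (qc_V Q)"
    by (simp add: sections_def xV V_iff xc vfields_tangent atlas)
  have "phi Q \<xi> = quat_endo Q a"
    unfolding phi_def quat_endo_def by (simp add: sum_3 eta_simps xc flip: One_nat_def)
  then have "nabla_endo nabla X \<sigma> Y = appl (phi Q (nabla X \<xi>)) Y" if "Y \<in> sections A (qc_H Q)" for Y
    using phi_parallel[OF X xi that] by (simp add: a)
  moreover have "(\<lambda>p. qc_eta Q r p [nabla X \<xi> p]) \<in> smooth_funs A" if "r \<in> {1..3}" for r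
    using that by (simp add: eta coord_smooth nabla_vfields X xV)
  then have "phi Q (nabla X \<xi>) \<in> quat_sections A Q"
    unfolding phi_def quat_sections_def by blast
  ultimately show "\<exists>\<tau>\<in>quat_sections A Q. \<forall>Y\<in>sections A (qc_H Q). nabla_endo nabla X \<sigma> Y = appl \<tau> Y"
    by blast
qed

end

section \<open>Uniqueness of the Biquard connection on horizontal fields\<close>

text \<open>The anti-self-dual forms \<open>\<theta>\<^sub>1\<^sub>2 - \<theta>\<^sub>3\<^sub>4\<close>, \<open>\<theta>\<^sub>1\<^sub>3
  - \<theta>\<^sub>4\<^sub>2\<close>, \<open>\<theta>\<^sub>1\<^sub>4 - \<theta>\<^sub>2\<^sub>3\<close> (with
  \<open>\<theta>\<^sub>i\<^sub>j = \<theta>\<^sub>i \<and> \<theta>\<^sub>j\<close>). The endomorphisms that they define are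
  the right multiplications by the imaginary quaternions; these commute with the left multiplications
  \<open>I\<^sub>r\<close> and supply the elements of the second \<open>sp(1)\<close> against which the torsion is tested.\<close>

definition antiselfdual_form :: "nat \<Rightarrow> (nat \<Rightarrow> real) \<Rightarrow> (nat \<Rightarrow> real) \<Rightarrow> real" where
  "antiselfdual_form r x y = (if r = 1 then minor2 1 2 x y - minor2 3 4 x y
     else if r = 2 then minor2 1 3 x y - minor2 4 2 x y else minor2 1 4 x y - minor2 2 3 x y)"

definition opposite_mult :: "nat \<Rightarrow> (nat \<Rightarrow> real) \<Rightarrow> nat \<Rightarrow> real" where
  "opposite_mult r x k = antiselfdual_form r x (\<lambda>i. if i = k then 1 else 0)"

lemma opposite_mult_simps:
  "opposite_mult 1 x 1 = - x 2" "opposite_mult 1 x 2 = x 1" "opposite_mult 1 x 3 = x 4" "opposite_mult 1 x 4 = - x 3"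
  "opposite_mult 2 x 1 = - x 3" "opposite_mult 2 x 2 = - x 4" "opposite_mult 2 x 3 = x 1" "opposite_mult 2 x 4 = x 2"
  "opposite_mult 3 x 1 = - x 4" "opposite_mult 3 x 2 = x 3" "opposite_mult 3 x 3 = - x 2" "opposite_mult 3 x 4 = x 1"
  by (simp_all add: opposite_mult_def antiselfdual_form_def minor2_def)

text \<open>The algebraic reason for the uniqueness of the Levi-Civita connection: a trilinear form that is skew in its last two slots
  and symmetric in its first two vanishes. It is applied to the difference of two connections.\<close>

lemma skew_symmetric_zero:
  fixes d :: "nat \<Rightarrow> nat \<Rightarrow> nat \<Rightarrow> real"
  assumes skew: "\<And>i a b. i \<in> S \<Longrightarrow> a \<in> S \<Longrightarrow> b \<in> S \<Longrightarrow> d i a b = - d i b a"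
    and sym: "\<And>i a b. i \<in> S \<Longrightarrow> a \<in> S \<Longrightarrow> b \<in> S \<Longrightarrow> d i a b = d a i b"
    and "i \<in> S" "a \<in> S" "b \<in> S"
  shows "d i a b = 0"
proof -
  have "d i a b = - d i b a" by (rule skew) fact+
  also have "\<dots> = - d b i a" using sym[of i b a] assms(3-) by simp
  also have "\<dots> = d b a i" using skew[of b i a] assms(3-) by simp
  also have "\<dots> = d a b i" by (rule sym) fact+
  also have "\<dots> = - d a i b" by (rule skew) fact+
  also have "\<dots> = - d i a b" using sym[of a i b] assms(3-) by simp
  finally show ?thesis by simp
qed

context qc_coframe
begin

definition opposite_endo :: "nat \<Rightarrow> 'g \<Rightarrow> 'g tvec \<Rightarrow> 'g tvec" where
  "opposite_endo r p v = (\<lambda>f. \<Sum>k\<in>{1..4}. opposite_mult r (\<lambda>i. \<theta> i p [v]) k * e k p f)"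

lemma opposite_endo_H: "opposite_endo r p v \<in> qc_H Q p"
  unfolding dist tspan_def opposite_endo_def by blast

lemma opposite_endo_coord: "k \<in> {1..4} \<Longrightarrow> \<theta> k p [opposite_endo r p v] = opposite_mult r (\<lambda>i. \<theta> i p [v]) k"
  unfolding opposite_endo_def by (subst coord_sum) auto

lemma opposite_endo_sp1:
  assumes r: "r \<in> {1..3}"
  shows "opposite_endo r p \<in> sp1_second Q p"
  unfolding sp1_second_def endo_on_def
proof (intro CollectI conjI ballI allI)
  fix v w a b assume v: "v \<in> qc_H Q p" and w: "w \<in> qc_H Q p"
  show "opposite_endo r p v \<in> qc_H Q p" by (rule opposite_endo_H)
  show "opposite_endo r p (tcomb a v b w) = tcomb a (opposite_endo r p v) b (opposite_endo r p w)"
  proof (rule H_eqI)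
    fix k :: nat assume k: "k \<in> {1..4}"
    show "\<theta> k p [opposite_endo r p (tcomb a v b w)] = \<theta> k p [tcomb a (opposite_endo r p v) b (opposite_endo r p w)]"
      using cases_1_3[OF r] cases_1_4[OF k]
      by (elim disjE) (simp_all add: opposite_endo_coord coord_tcomb H_tangent v w opposite_endo_H opposite_mult_simps)
  qed (simp_all add: opposite_endo_H H_tcomb)
  show "qc_g Q p (opposite_endo r p v) w = - qc_g Q p v (opposite_endo r p w)"
    using cases_1_3[OF r]
    by (elim disjE) (simp_all add: g_coord opposite_endo_H v w opposite_endo_coord sum_4 opposite_mult_simps)
  fix s :: nat assume s: "s \<in> {1..3}"
  show "opposite_endo r p (qc_I Q s p v) = qc_I Q s p (opposite_endo r p v)"
  proof (rule H_eqI)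
    fix k :: nat assume k: "k \<in> {1..4}"
    show "\<theta> k p [opposite_endo r p (qc_I Q s p v)] = \<theta> k p [qc_I Q s p (opposite_endo r p v)]"
      using cases_1_3[OF r] cases_1_3[OF s] cases_1_4[OF k]
      by (elim disjE) (simp_all add: opposite_endo_coord coord_I_simps v opposite_endo_H opposite_mult_simps)
  qed (simp_all add: opposite_endo_H I_H[OF s])
qed

lemma frame_section_H: "a \<in> {1..4} \<Longrightarrow> e a \<in> sections A (qc_H Q)"
  by (simp add: sections_def frame frame_H)

lemma frame_section_V: "s \<in> {5..7} \<Longrightarrow> e s \<in> sections A (qc_V Q)"
  by (auto simp: sections_def frame V_iff frame_tangent dual)

text \<open>The consequences of the definition that enter the uniqueness proof.\<close>

lemma biquardD:
  assumes "biquard_connection A Q D"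
  shows "linear_connection A D"
    "X \<in> vfields A \<Longrightarrow> Y \<in> vfields A \<Longrightarrow> D X Y \<in> vfields A"
    "X \<in> vfields A \<Longrightarrow> Y \<in> sections A (qc_H Q) \<Longrightarrow> D X Y \<in> sections A (qc_H Q)"
    "X \<in> vfields A \<Longrightarrow> Y \<in> sections A (qc_V Q) \<Longrightarrow> D X Y \<in> sections A (qc_V Q)"
    "X \<in> vfields A \<Longrightarrow> Y \<in> vfields A \<Longrightarrow> Z \<in> vfields A \<Longrightarrow>
      X p (\<lambda>q. ext_g Q q (Y q) (Z q)) = ext_g Q p (D X Y p) (Z p) + ext_g Q p (Y p) (D X Z p)"
    "X \<in> sections A (qc_H Q) \<Longrightarrow> Y \<in> sections A (qc_H Q) \<Longrightarrow>
      torsion A D X Y p f = - vert Q p (bracket A X Y p) f"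
    "\<xi> \<in> sections A (qc_V Q) \<Longrightarrow> X \<in> sections A (qc_H Q) \<Longrightarrow> torsion A D \<xi> X \<in> sections A (qc_H Q)"
    "\<xi> \<in> sections A (qc_V Q) \<Longrightarrow> (\<And>i. i \<in> {1..4} \<Longrightarrow> E i \<in> sections A (qc_H Q)) \<Longrightarrow>
      orthonormal_basis_at Q p (\<lambda>i. E i p) \<Longrightarrow> B \<in> sp1_first Q p \<union> sp1_second Q p \<Longrightarrow>
      (\<Sum>i\<in>{1..4}. qc_g Q p (torsion A D \<xi> (E i) p) (B (E i p))) = 0"
proof -
  note c1 = assms[unfolded biquard_connection_def]
  note c2 = conjunct2[OF c1] note c3 = conjunct2[OF c2] note c4 = conjunct2[OF c3]
  note c5 = conjunct2[OF c4] note c6 = conjunct2[OF c5] note c7 = conjunct2[OF c6] note c8 = conjunct2[OF c7]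
  show L: "linear_connection A D" by (rule conjunct1[OF c1])
  show "X \<in> vfields A \<Longrightarrow> Y \<in> vfields A \<Longrightarrow> D X Y \<in> vfields A"
    by (rule conjunct1[OF L[unfolded linear_connection_def], rule_format])
  show "X \<in> vfields A \<Longrightarrow> Y \<in> sections A (qc_H Q) \<Longrightarrow> D X Y \<in> sections A (qc_H Q)"
    by (rule conjunct1[OF c2, rule_format])
  show "X \<in> vfields A \<Longrightarrow> Y \<in> sections A (qc_V Q) \<Longrightarrow> D X Y \<in> sections A (qc_V Q)"
    by (rule conjunct1[OF c3, rule_format])
  show "X \<in> vfields A \<Longrightarrow> Y \<in> vfields A \<Longrightarrow> Z \<in> vfields A \<Longrightarrow>
      X p (\<lambda>q. ext_g Q q (Y q) (Z q)) = ext_g Q p (D X Y p) (Z p) + ext_g Q p (Y p) (D X Z p)"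
    by (rule conjunct1[OF c4, rule_format])
  show "X \<in> sections A (qc_H Q) \<Longrightarrow> Y \<in> sections A (qc_H Q) \<Longrightarrow>
      torsion A D X Y p f = - vert Q p (bracket A X Y p) f"
    by (rule conjunct1[OF c6, rule_format])
  show "\<xi> \<in> sections A (qc_V Q) \<Longrightarrow> X \<in> sections A (qc_H Q) \<Longrightarrow> torsion A D \<xi> X \<in> sections A (qc_H Q)"
    by (rule conjunct1[OF c7, rule_format])
  assume "\<xi> \<in> sections A (qc_V Q)" "\<And>i. i \<in> {1..4} \<Longrightarrow> E i \<in> sections A (qc_H Q)"
    "orthonormal_basis_at Q p (\<lambda>i. E i p)" and B: "B \<in> sp1_first Q p \<union> sp1_second Q p"
  then have "\<forall>B\<in>sp1_first Q p \<union> sp1_second Q p.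
      (\<Sum>i\<in>{1..4}. qc_g Q p (torsion A D \<xi> (E i) p) (B (E i p))) = 0"
    by (intro conjunct1[OF c8, THEN bspec, THEN spec, THEN spec, THEN mp] conjI ballI)
  then show "(\<Sum>i\<in>{1..4}. qc_g Q p (torsion A D \<xi> (E i) p) (B (E i p))) = 0"
    using B by (rule bspec)
qed

context
  fixes D assumes D: "biquard_connection A Q D"
begin

lemma biquard_frame_skew:
  assumes i: "i \<in> {1..7}" and a: "a \<in> {1..4}" and b: "b \<in> {1..4}"
  shows "\<theta> b p [D (e i) (e a) p] = - \<theta> a p [D (e i) (e b) p]"
proof -
  have ei: "e i \<in> vfields A" and ea: "e a \<in> vfields A" and eb: "e b \<in> vfields A"
    using i a b by (simp_all add: frame)
  have t: "X p \<in> tangent_space A p" if "X \<in> vfields A" for X p by (rule vfields_tangent[OF atlas that])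
  have "e i p (\<lambda>q. ext_g Q q (e a q) (e b q)) = e i p (\<lambda>q. if a = b then 1 else 0)"
    using cases_1_4[OF a] cases_1_4[OF b] by (elim disjE) (simp_all add: ext_g_coord frame_tangent dual sum_7)
  also have "\<dots> = 0" by (rule vfields_const[OF atlas ei])
  finally have "ext_g Q p (D (e i) (e a) p) (e b p) + ext_g Q p (e a p) (D (e i) (e b) p) = 0"
    using biquardD(5)[OF D ei ea eb, of p] by simp
  moreover have "ext_g Q p (D (e i) (e a) p) (e b p) = \<theta> b p [D (e i) (e a) p]"
    unfolding ext_g_coord[OF t[OF biquardD(2)[OF D ei ea]] t[OF eb]]
    using cases_1_4[OF b] by (elim disjE) (simp_all add: sum_7 dual)
  moreover have "ext_g Q p (e a p) (D (e i) (e b) p) = \<theta> a p [D (e i) (e b) p]"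
    unfolding ext_g_coord[OF t[OF ea] t[OF biquardD(2)[OF D ei eb]]]
    using cases_1_4[OF a] by (elim disjE) (simp_all add: sum_7 dual)
  ultimately show ?thesis by simp
qed

lemma coord_torsion_general:
  assumes "k \<in> {1..7}" "X \<in> vfields A" "Y \<in> vfields A"
  shows "\<theta> k p [torsion A D X Y p] = \<theta> k p [D X Y p] - \<theta> k p [D Y X p] - \<theta> k p [bracket A X Y p]"
  using assms
  by (simp add: torsion_def one_form_vdiff[OF atlas coframe] vfields_vdiff vfields_bracket atlas biquardD(2)[OF D])

lemma biquard_horizontal_torsion:
  assumes X: "X \<in> sections A (qc_H Q)" and Y: "Y \<in> sections A (qc_H Q)" and b: "b \<in> {1..4}"
  shows "\<theta> b p [D X Y p] - \<theta> b p [D Y X p] = \<theta> b p [bracket A X Y p]"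
proof -
  have b7: "b \<in> {1..7}" using b by simp
  let ?v = "vert Q p (bracket A X Y p)"
  have "torsion A D X Y p = tcomb (-1) ?v 0 ?v"
    by (rule ext) (simp add: biquardD(6)[OF D X Y] tcomb_def)
  then have "\<theta> b p [torsion A D X Y p] = 0"
    using b by (simp add: coord_tcomb[OF b7 vert_tangent vert_tangent] coord_vert[OF b7])
  then show ?thesis
    by (simp add: coord_torsion_general[OF b7 sections_vfields[OF X] sections_vfields[OF Y]])
qed

lemma biquard_mixed_torsion:
  assumes xi: "\<xi> \<in> sections A (qc_V Q)" and X: "X \<in> sections A (qc_H Q)" and b: "b \<in> {1..4}"
  shows "\<theta> b p [torsion A D \<xi> X p] = \<theta> b p [D \<xi> X p] - \<theta> b p [bracket A \<xi> X p]"
proof -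
  have b7: "b \<in> {1..7}" using b by simp
  have "\<theta> b p [D X \<xi> p] = 0"
    using V_horizontal[OF sections_mem[OF biquardD(4)[OF D sections_vfields[OF X] xi], of p]] cases_1_4[OF b]
    by (elim disjE) simp_all
  then show ?thesis
    by (simp add: coord_torsion_general[OF b7 sections_vfields[OF xi] sections_vfields[OF X]])
qed

text \<open>The vertical-horizontal torsion condition, for the frame as orthonormal basis; \<open>\<nabla>\<^sub>X\<xi>\<close> is
  vertical and drops out.\<close>

lemma biquard_mixed_trace:
  assumes s: "s \<in> {5..7}" and B: "B \<in> sp1_first Q p \<union> sp1_second Q p"
  shows "(\<Sum>i\<in>{1..4}. \<Sum>b\<in>{1..4}. (\<theta> b p [D (e s) (e i) p] - \<theta> b p [bracket A (e s) (e i) p]) * \<theta> b p [B (e i p)]) = 0"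
proof -
  note es = frame_section_V[OF s]
  have BH: "B v \<in> qc_H Q p" if "v \<in> qc_H Q p" for v
    using sp1_endo_skew(1)[OF B] that unfolding endo_on_def by blast
  have "(\<Sum>i\<in>{1..4}. qc_g Q p (torsion A D (e s) (e i) p) (B (e i p))) = 0"
    by (rule biquardD(8)[OF D es frame_section_H onb B])
  moreover have "qc_g Q p (torsion A D (e s) (e i) p) (B (e i p)) =
      (\<Sum>b\<in>{1..4}. (\<theta> b p [D (e s) (e i) p] - \<theta> b p [bracket A (e s) (e i) p]) * \<theta> b p [B (e i p)])"
    if i: "i \<in> {1..4}" for i
    unfolding g_coord[OF sections_mem[OF biquardD(7)[OF D es frame_section_H[OF i]]] BH[OF frame_H[OF i]]]
    by (rule sum.cong[OF refl]) (simp only: biquard_mixed_torsion[OF es frame_section_H[OF i]])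
  ultimately show ?thesis by simp
qed

end

lemma I_sp1: "r \<in> {1..3} \<Longrightarrow> quat_endo Q (\<lambda>s p. if s = r then 1 else 0) p \<in> sp1_first Q p"
  unfolding sp1_first_def quat_endo_def
  by (intro CollectI exI[of _ "\<lambda>s. if s = r then 1 else 0"]) simp

text \<open>Let \<open>d\<close> be the difference of the horizontal connection coefficients; it is skew in its last two indices. Along
  \<open>H\<close> it is also symmetric in its first two, because both connections have the same horizontal torsion, so it
  vanishes. Along \<open>V\<close> it is orthogonal to the skew endomorphisms given by the self-dual and the anti-self-dual
  forms, and these six span all skew endomorphisms of \<open>H\<close>.\<close>

lemma biquard_unique_frame:
  assumes D: "biquard_connection A Q D" and D': "biquard_connection A Q D'"
    and i: "i \<in> {1..7}" and a: "a \<in> {1..4}"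
  shows "D (e i) (e a) = D' (e i) (e a)"
proof -
  have ei: "e i \<in> vfields A" by (rule frame[OF i])
  note ea = frame_section_H[OF a]
  have zero: "\<theta> b p [D (e i) (e a) p] - \<theta> b p [D' (e i) (e a) p] = 0" if b: "b \<in> {1..4}" for b p
  proof -
    define d where "d i a b = \<theta> b p [D (e i) (e a) p] - \<theta> b p [D' (e i) (e a) p]" for i a b
    have skew: "d i a b = - d i b a" if "i \<in> {1..7}" "a \<in> {1..4}" "b \<in> {1..4}" for i a b
      using biquard_frame_skew[OF D that, of p] biquard_frame_skew[OF D' that, of p] by (simp add: d_def)
    show ?thesis
    proof (cases "i \<le> 4")
      case True
      then have i4: "i \<in> {1..4}" using i by simp
      have "d i a b = 0"
      proof (rule skew_symmetric_zero[where S = "{1..4}"])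
        show "d i a b = - d i b a" if "i \<in> {1..4}" "a \<in> {1..4}" "b \<in> {1..4}" for i a b
          by (rule skew) (use that in auto)
        show "d i a b = d a i b" if "i \<in> {1..4}" "a \<in> {1..4}" "b \<in> {1..4}" for i a b
          using biquard_horizontal_torsion[OF D frame_section_H[OF that(1)] frame_section_H[OF that(2)] that(3), of p]
            biquard_horizontal_torsion[OF D' frame_section_H[OF that(1)] frame_section_H[OF that(2)] that(3), of p]
          by (simp add: d_def)
      qed (use i4 a b in auto)
      then show ?thesis by (simp add: d_def)
    next
      case False
      then have s: "i \<in> {5..7}" using i by auto
      have tr: "(\<Sum>a\<in>{1..4}. \<Sum>b\<in>{1..4}. d i a b * \<theta> b p [B (e a p)]) = 0"
        if "B \<in> sp1_first Q p \<union> sp1_second Q p" for B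
        using biquard_mixed_trace[OF D s that] biquard_mixed_trace[OF D' s that]
        unfolding d_def sum_4 by (simp add: algebra_simps)
      have trI: "(\<Sum>a\<in>{1..4}. \<Sum>b\<in>{1..4}. d i a b * quat_mult r (\<lambda>j. \<theta> j p [e a p]) b) = 0"
        if "r \<in> {1..3}" for r
      proof -
        have "\<theta> b p [quat_endo Q (\<lambda>s p. if s = r then 1 else 0) p (e a p)] = quat_mult r (\<lambda>j. \<theta> j p [e a p]) b"
          if "a \<in> {1..4}" "b \<in> {1..4}" for a b
          unfolding quat_endo_H(2)[OF frame_H[OF that(1)] that(2)] using cases_1_3[OF \<open>r \<in> {1..3}\<close>]
          by (elim disjE) (simp_all add: sum_3)
        then show ?thesis using tr[OF UnI1[OF I_sp1[OF that]]] by simp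
      qed
      have trA: "(\<Sum>a\<in>{1..4}. \<Sum>b\<in>{1..4}. d i a b * opposite_mult r (\<lambda>j. \<theta> j p [e a p]) b) = 0"
        if "r \<in> {1..3}" for r
        using tr[OF UnI2[OF opposite_endo_sp1[OF that]]] by (simp add: opposite_endo_coord)
      have sk: "d i a a = 0" "d i a b = - d i b a" if "a \<in> {1..4}" "b \<in> {1..4}" for a b
        using skew[OF i that(1) that(1)] skew[OF i that] by simp_all
      have "d i 1 2 + d i 3 4 = 0" "d i 1 3 + d i 4 2 = 0" "d i 1 4 + d i 2 3 = 0"
        using trI[of 1] trI[of 2] trI[of 3] sk(2)[of 2 1] sk(2)[of 4 3] sk(2)[of 3 1] sk(2)[of 2 4] sk(2)[of 4 1]
          sk(2)[of 3 2] by (simp_all add: sum_4 quat_mult_simps dual)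
      moreover have "d i 1 2 - d i 3 4 = 0" "d i 1 3 - d i 4 2 = 0" "d i 1 4 - d i 2 3 = 0"
        using trA[of 1] trA[of 2] trA[of 3] sk(2)[of 2 1] sk(2)[of 4 3] sk(2)[of 3 1] sk(2)[of 2 4] sk(2)[of 4 1]
          sk(2)[of 3 2] by (simp_all add: sum_4 opposite_mult_simps dual)
      ultimately have "d i 1 2 = 0" "d i 3 4 = 0" "d i 1 3 = 0" "d i 4 2 = 0" "d i 1 4 = 0" "d i 2 3 = 0"
        by linarith+
      then have "d i a b = 0"
        using cases_1_4[OF a] cases_1_4[OF b] sk(1)[OF a a] sk(2)[OF a b] by (elim disjE) simp_all
      then show ?thesis by (simp add: d_def)
    qed
  qed
  show ?thesis
  proof (rule vfields_eqI)
    note s = biquardD(3)[OF D ei ea] and s' = biquardD(3)[OF D' ei ea]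
    show "D (e i) (e a) \<in> vfields A" "D' (e i) (e a) \<in> vfields A"
      by (rule sections_vfields[OF s]) (rule sections_vfields[OF s'])
    fix k :: nat and p assume k: "k \<in> {1..7}"
    show "\<theta> k p [D (e i) (e a) p] = \<theta> k p [D' (e i) (e a) p]"
      using cases_1_7[OF k] zero[of _ p] H_vertical[OF sections_mem[OF s, of p]] H_vertical[OF sections_mem[OF s', of p]]
      by (elim disjE) simp_all
  qed
qed

lemma biquard_unique_H:
  assumes D: "biquard_connection A Q D" and D': "biquard_connection A Q D'"
    and X: "X \<in> vfields A" and Y: "Y \<in> sections A (qc_H Q)"
  shows "D X Y = D' X Y"
proof (rule linear_connection_eqI[OF biquardD(1)[OF D] biquardD(1)[OF D'], of "{1..4}"])
  show "D (e i) (e a) = D' (e i) (e a)" if "i \<in> {1..7}" "a \<in> {1..4}" for i a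
    using biquard_unique_frame[OF D D' that] .
  show "\<theta> k p [Y p] = 0" if "k \<in> {1..7} - {1..4}" for k p
  proof -
    have "k = 5 \<or> k = 6 \<or> k = 7" using that by auto
    then show ?thesis using H_vertical[OF sections_mem[OF Y]] by auto
  qed
qed (auto simp: X sections_vfields[OF Y])

section \<open>Torsion and scalar curvature\<close>

lemma biquard_torsion_nonzero:
  assumes D: "biquard_connection A Q D"
  shows "nonzero_torsion_endo A Q D"
proof -
  have xi: "e 5 \<in> sections A (qc_V Q)" and X: "e 1 \<in> sections A (qc_H Q)"
    by (simp_all add: frame_section_V frame_section_H)
  fix p
  have eq: "D (e 5) (e 1) = nabla (e 5) (e 1)"
    by (rule biquard_unique_H[OF D nabla_biquard sections_vfields[OF xi] X])
  have "\<theta> 2 p [torsion A D (e 5) (e 1) p] = \<theta> 2 p [torsion A nabla (e 5) (e 1) p]"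
    using biquard_mixed_torsion[OF D xi X, of 2 p] biquard_mixed_torsion[OF nabla_biquard xi X, of 2 p] eq by simp
  also have "\<dots> = - 1/4"
    using torsion_nabla_VH(2)[OF xi X, of 2 p] by (simp add: sum_4 torsion_coeff_def dual)
  finally have "torsion A D (e 5) (e 1) p \<noteq> (\<lambda>f. 0)"
    using coord_sum[of 2 "{}" p "\<lambda>j. 0"] by auto
  then have "torsion A D (e 5) (e 1) \<noteq> (\<lambda>p f. 0)" by metis
  then show ?thesis
    unfolding nonzero_torsion_endo_def using xi X by blast
qed

text \<open>The second structure equation, evaluated; each \<open>d\<psi>\<^sub>k\<^sub>j\<close> is a multiple of some
  \<open>d\<theta>\<^sub>l\<close>.\<close>

lemma curvature_form:
  assumes k: "k \<in> {1..4}" and j: "j \<in> {1..4}" and X: "X \<in> vfields A" and Y: "Y \<in> vfields A"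
  shows "ext_d A (conn_form k j) [X, Y] p + (\<Sum>m\<in>{1..7}. conn_form k m p [X p] * conn_form m j p [Y p] -
      conn_form k m p [Y p] * conn_form m j p [X p]) = curv_form k j (\<lambda>i. \<theta> i p [X p]) (\<lambda>i. \<theta> i p [Y p])"
proof -
  have "ext_d A (conn_form k j) [X, Y] p =
    conn_coeff k j * structure_form (conn_index k j) (\<lambda>i. \<theta> i p [X p]) (\<lambda>i. \<theta> i p [Y p])"
    unfolding conn_form_def ext_d_one_form_scale[OF atlas coframe[OF conn_index_range] X Y]
    by (simp only: struct_eq[OF conn_index_range X Y])
  then show ?thesis
    using cases_1_4[OF k] cases_1_4[OF j]
    by (elim disjE) (simp_all add: conn_form_def nabla_eval curv_form_def algebra_simps)
qed

lemma coord_curvature_nabla: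
  assumes k: "k \<in> {1..4}" and X: "X \<in> vfields A" and Y: "Y \<in> vfields A" and Z: "Z \<in> sections A (qc_H Q)"
  shows "\<theta> k p [curvature A nabla X Y Z p] =
    (\<Sum>j\<in>{1..4}. curv_form k j (\<lambda>i. \<theta> i p [X p]) (\<lambda>i. \<theta> i p [Y p]) * \<theta> j p [Z p])"
proof -
  let ?c = "\<lambda>j. ext_d A (conn_form k j) [X, Y] p + (\<Sum>m\<in>{1..7}. conn_form k m p [X p] * conn_form m j p [Y p] -
      conn_form k m p [Y p] * conn_form m j p [X p])"
  have k7: "k \<in> {1..7}" using k by simp
  have "\<theta> k p [curvature A nabla X Y Z p] = (\<Sum>j\<in>{1..7}. ?c j * \<theta> j p [Z p])"
    by (rule coord_curvature[where \<psi> = conn_form, OF conn_form_one_form k7 X Y sections_vfields[OF Z]])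
  also have "\<dots> = (\<Sum>j\<in>{1..4}. ?c j * \<theta> j p [Z p])"
    unfolding sum_7[of "\<lambda>j. ?c j * \<theta> j p [Z p]"] sum_4 by (simp only: H_vertical[OF sections_mem[OF Z]])
  also have "\<dots> = (\<Sum>j\<in>{1..4}. curv_form k j (\<lambda>i. \<theta> i p [X p]) (\<lambda>i. \<theta> i p [Y p]) * \<theta> j p [Z p])"
    by (rule sum.cong[OF refl]) (simp only: curvature_form[OF k _ X Y])
  finally show ?thesis .
qed

text \<open>In the curvature on sections of \<open>H\<close>, covariant derivatives are taken of sections of \<open>H\<close> only.\<close>

lemma curvature_eq_nabla:
  assumes D: "biquard_connection A Q D"
    and X: "X \<in> vfields A" and Y: "Y \<in> vfields A" and Z: "Z \<in> sections A (qc_H Q)"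
  shows "curvature A D X Y Z = curvature A nabla X Y Z"
  using biquard_unique_H[OF D nabla_biquard X nabla_H[OF Y Z]] biquard_unique_H[OF D nabla_biquard Y nabla_H[OF X Z]]
    biquard_unique_H[OF D nabla_biquard X Z] biquard_unique_H[OF D nabla_biquard Y Z]
    biquard_unique_H[OF D nabla_biquard vfields_bracket[OF atlas X Y] Z]
  by (simp add: curvature_def)

end

text \<open>Both sums are traces over the orthonormal basis \<open>f\<close> and may be taken in the frame. The first one gives the Ricci
  form, which is diagonal with entries \<open>-5, -1, -1, -5\<close>.\<close>

lemma ricci_trace:
  fixes f :: "nat \<Rightarrow> nat \<Rightarrow> real"
  assumes on: "\<And>i j. i \<in> {1..4} \<Longrightarrow> j \<in> {1..4} \<Longrightarrow> (\<Sum>c\<in>{1..4}. f i c * f j c) = (if i = j then 1 else 0)"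
    and vert: "\<And>i. i \<in> {1..4} \<Longrightarrow> f i 5 = 0" "\<And>i. i \<in> {1..4} \<Longrightarrow> f i 6 = 0"
  shows "(\<Sum>a\<in>{1..4}. \<Sum>b\<in>{1..4}. \<Sum>k\<in>{1..4}.
    (\<Sum>j\<in>{1..4}. curv_form k j (f b) (f a) * f a j) * f b k) = - 12"
proof -
  (* u c are the coordinates of e c; the curvature forms are linear in y *)
  define u where "u c = (\<lambda>i::nat. if i = c then 1 else 0 :: real)" for c
  define \<beta> where "\<beta> x c j = (\<Sum>k\<in>{1..4}. curv_form k j x (u c) * x k)" for x c j
  define ric :: "nat \<Rightarrow> nat \<Rightarrow> real" where
    "ric c j = (if c = j then if c = 1 \<or> c = 4 then - 5 else - 1 else 0)" for c j
  have expand: "curv_form k j x y = (\<Sum>c\<in>{1..4}. curv_form k j x (u c) * y c)"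
    if k: "k \<in> {1..4}" and j: "j \<in> {1..4}" and v: "x 5 = 0" "x 6 = 0" "y 5 = 0" "y 6 = 0" for k j x y
  proof -
    have "k = 1 \<or> k = 2 \<or> k = 3 \<or> k = 4" "j = 1 \<or> j = 2 \<or> j = 3 \<or> j = 4" using k j by auto
    then show ?thesis
      using v by (elim disjE) (simp_all add: curv_form_def minor2_def u_def sum_4 algebra_simps)
  qed
  have "(\<Sum>a\<in>{1..4}. \<Sum>b\<in>{1..4}. \<Sum>k\<in>{1..4}. (\<Sum>j\<in>{1..4}. curv_form k j (f b) (f a) * f a j) * f b k) =
    (\<Sum>b\<in>{1..4}. \<Sum>a\<in>{1..4}. \<Sum>k\<in>{1..4}. (\<Sum>j\<in>{1..4}. curv_form k j (f b) (f a) * f a j) * f b k)"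
    by (rule sum.swap)
  also have "\<dots> = (\<Sum>b\<in>{1..4}. \<Sum>c\<in>{1..4}. \<Sum>j\<in>{1..4}. ric c j * f b c * f b j)"
  proof (rule sum.cong[OF refl])
    fix b :: nat assume b: "b \<in> {1..4}"
    have "(\<Sum>a\<in>{1..4}. \<Sum>k\<in>{1..4}. (\<Sum>j\<in>{1..4}. curv_form k j (f b) (f a) * f a j) * f b k) =
      (\<Sum>a\<in>{1..4}. \<Sum>c\<in>{1..4}. \<Sum>j\<in>{1..4}. \<beta> (f b) c j * f a c * f a j)"
    proof (rule sum.cong[OF refl])
      fix a :: nat assume a: "a \<in> {1..4}"
      have "(\<Sum>k\<in>{1..4}. (\<Sum>j\<in>{1..4}. curv_form k j (f b) (f a) * f a j) * f b k) =
        (\<Sum>k\<in>{1..4}. (\<Sum>j\<in>{1..4}. (\<Sum>c\<in>{1..4}. curv_form k j (f b) (u c) * f a c) * f a j) * f b k)"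
        by (rule sum.cong[OF refl], rule arg_cong2[where f = "(*)", OF _ refl],
            rule sum.cong[OF refl], rule arg_cong2[where f = "(*)", OF _ refl], rule expand)
          (simp_all add: vert[OF a] vert[OF b])
      then show "(\<Sum>k\<in>{1..4}. (\<Sum>j\<in>{1..4}. curv_form k j (f b) (f a) * f a j) * f b k) =
        (\<Sum>c\<in>{1..4}. \<Sum>j\<in>{1..4}. \<beta> (f b) c j * f a c * f a j)"
        unfolding \<beta>_def sum_4 by algebra
    qed
    also have "\<dots> = (\<Sum>c\<in>{1..4}. \<beta> (f b) c c)"
      by (rule trace_orthonormal[OF on])
    also have "\<dots> = (\<Sum>c\<in>{1..4}. \<Sum>j\<in>{1..4}. ric c j * f b c * f b j)"
      using vert[OF b] by (simp add: \<beta>_def ric_def sum_4 curv_form_def minor2_def u_def algebra_simps)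
    finally show "(\<Sum>a\<in>{1..4}. \<Sum>k\<in>{1..4}. (\<Sum>j\<in>{1..4}. curv_form k j (f b) (f a) * f a j) * f b k) =
      (\<Sum>c\<in>{1..4}. \<Sum>j\<in>{1..4}. ric c j * f b c * f b j)" .
  qed
  also have "\<dots> = (\<Sum>c\<in>{1..4}. ric c c)"
    by (rule trace_orthonormal[OF on])
  also have "\<dots> = - 12" by (simp add: ric_def sum_4)
  finally show ?thesis .
qed

context qc_coframe
begin

lemma biquard_scal:
  assumes D: "biquard_connection A Q D"
  shows "normalized_qc_scal A Q D (\<lambda>p. - 1/2)"
  unfolding normalized_qc_scal_def
proof (intro allI impI)
  fix E p
  assume E: "(\<forall>a\<in>{1..4}. E a \<in> sections A (qc_H Q)) \<and> orthonormal_basis_at Q p (\<lambda>a. E a p)"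
  then have EH: "E a \<in> sections A (qc_H Q)" if "a \<in> {1..4}" for a using that by blast
  note EV = sections_vfields[OF EH]
  let ?f = "\<lambda>a i. \<theta> i p [E a p]"
  have "(\<Sum>a\<in>{1..4}. \<Sum>b\<in>{1..4}. ext_g Q p (curvature A D (E b) (E a) (E a) p) (E b p)) =
    (\<Sum>a\<in>{1..4}. \<Sum>b\<in>{1..4}. \<Sum>k\<in>{1..4}. (\<Sum>j\<in>{1..4}. curv_form k j (?f b) (?f a) * ?f a j) * ?f b k)"
  proof (intro sum.cong refl)
    fix a b :: nat assume a: "a \<in> {1..4}" and b: "b \<in> {1..4}"
    let ?R = "curvature A nabla (E b) (E a) (E a)"
    have "ext_g Q p (curvature A D (E b) (E a) (E a) p) (E b p) = ext_g Q p (?R p) (E b p)"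
      by (simp only: curvature_eq_nabla[OF D EV[OF b] EV[OF a] EH[OF a]])
    also have "\<dots> = (\<Sum>i\<in>{1..7}. \<theta> i p [?R p] * \<theta> i p [E b p])"
      by (rule ext_g_coord[OF vfields_tangent[OF atlas curvature_vfields[OF conn_form_one_form EV[OF b] EV[OF a] EV[OF a]]]
            vfields_tangent[OF atlas EV[OF b]]])
    also have "\<dots> = (\<Sum>k\<in>{1..4}. \<theta> k p [?R p] * \<theta> k p [E b p])"
      by (simp add: sum_7 sum_4 H_vertical[OF sections_mem[OF EH[OF b]]])
    also have "\<dots> = (\<Sum>k\<in>{1..4}. (\<Sum>j\<in>{1..4}. curv_form k j (?f b) (?f a) * ?f a j) * ?f b k)"
      by (rule sum.cong[OF refl]) (simp only: coord_curvature_nabla[OF _ EV[OF b] EV[OF a] EH[OF a]])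
    finally show "ext_g Q p (curvature A D (E b) (E a) (E a) p) (E b p) =
      (\<Sum>k\<in>{1..4}. (\<Sum>j\<in>{1..4}. curv_form k j (?f b) (?f a) * ?f a j) * ?f b k)" .
  qed
  also have "\<dots> = - 12"
  proof (rule ricci_trace)
    show "(\<Sum>c\<in>{1..4}. ?f i c * ?f j c) = (if i = j then 1 else 0)" if "i \<in> {1..4}" "j \<in> {1..4}" for i j
      using orthonormal_coord[of p "\<lambda>a. E a p", OF _ that] E by blast
  qed (simp_all add: H_vertical[OF sections_mem[OF EH]])
  finally show "24 * (- 1/2) = (\<Sum>a\<in>{1..4::nat}. \<Sum>b\<in>{1..4::nat}.
      ext_g Q p (curvature A D (E b) (E a) (E a) p) (E b p))" by simp
qed

end

theorem theorem4p2:
  fixes A :: "('g::{t2_space, second_countable_topology}, real ^ 7) atlas"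
    and G :: "'g monoid"
    and \<theta> :: "nat \<Rightarrow> 'g form"
    and e :: "nat \<Rightarrow> 'g vfield"
    and w :: "nat \<Rightarrow> nat \<Rightarrow> 'g form"
    and Q :: "'g qc"
  defines "w \<equiv> \<lambda>i j. wedge 1 1 (\<theta> i) (\<theta> j)"
  assumes "lie_group A G"
    and "simply_connected (UNIV :: 'g set)"
    and "solvable G"
    and "left_inv_form_basis A G {1..7} \<theta>"
    and "\<forall>j\<in>{1..7}. e j \<in> left_inv_fields A G"
    and "\<forall>i\<in>{1..7}. \<forall>j\<in>{1..7}. \<forall>p. \<theta> i p [e j p] = (if i = j then 1 else 0)"
    and "d_eq A 1 (\<theta> 1) (\<lambda>p vs. 0)"
    and "d_eq A 1 (\<theta> 2) (\<lambda>p vs. 1/2 * w 1 5 p vs - w 3 4 p vs + 1/2 * w 4 6 p vs)"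
    and "d_eq A 1 (\<theta> 3) (\<lambda>p vs. 1/2 * w 1 6 p vs + w 2 4 p vs - 1/2 * w 4 5 p vs)"
    and "d_eq A 1 (\<theta> 4) (\<lambda>p vs. - 2 * w 1 4 p vs)"
    and "d_eq A 1 (\<theta> 5) (\<lambda>p vs. 2 * (w 1 2 p vs + w 3 4 p vs) - w 4 6 p vs)"
    and "d_eq A 1 (\<theta> 6) (\<lambda>p vs. 2 * (w 1 3 p vs + w 4 2 p vs) + w 4 5 p vs)"
    and "d_eq A 1 (\<theta> 7) (\<lambda>p vs. 2 * (w 1 4 p vs + w 2 3 p vs) - 1/2 * w 5 6 p vs)"
    and "\<forall>r\<in>{1..3}. qc_eta Q r = \<theta> (4 + r) \<and> qc_xi Q r = e (4 + r)"
    and "\<forall>p. qc_H Q p = tspan {1..4} (\<lambda>a. e a p)"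
    and "\<forall>p. inner_product_on (qc_H Q p) (qc_g Q p) \<and> orthonormal_basis_at Q p (\<lambda>a. e a p)"
    and "\<forall>r\<in>{1..3}. \<forall>p. \<forall>x\<in>qc_H Q p. qc_I Q r p x \<in> qc_H Q p"
    and "\<forall>p. \<forall>x\<in>tangent_space A p. \<forall>y\<in>tangent_space A p.
           omega Q 1 p [x, y] = w 1 2 p [x, y] + w 3 4 p [x, y] \<and>
           omega Q 2 p [x, y] = w 1 3 p [x, y] + w 4 2 p [x, y] \<and>
           omega Q 3 p [x, y] = w 1 4 p [x, y] + w 2 3 p [x, y]"
  shows "integrable_qc_structure A Q \<and>
         closed_form A 4 (fund_form Q) \<and>
         (\<exists>D. biquard_connection A Q D) \<and>
         (\<forall>D. biquard_connection A Q D \<longrightarrow>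
            nonzero_torsion_endo A Q D \<and>
            normalized_qc_scal A Q D (\<lambda>p. - 1/2))"
proof -
  note A = assms(2) and basis = assms(5) and left = assms(6) and dual = assms(7) and d = assms(8-14)
    and eta_xi = assms(15) and H = assms(16) and g = assms(17) and I = assms(18) and om = assms(19)
  have atlas: "smooth_atlas A" using A by (simp add: lie_group_def)
  have one: "one_form A (\<theta> i)" if "i \<in> {1..7}" for i
  proof -
    have "\<theta> i \<in> left_inv_one_forms A G" using basis that unfolding left_inv_form_basis_def by (elim conjE) (rule bspec)
    then show ?thesis by (simp add: left_inv_one_forms_def)
  qed
  have ev: "e j \<in> vfields A" if "j \<in> {1..7}" for j
    using bspec[OF left that] by (simp add: left_inv_fields_def)
  have w_eval: "w i j p [x, y] = minor2 i j (\<lambda>k. \<theta> k p [x]) (\<lambda>k. \<theta> k p [y])" for i j p x y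
    unfolding w_def wedge_1_1 minor2_def by (simp only: mult.commute)
  have dd: "ext_d A \<alpha> [X, Y] p = \<beta> p [X p, Y p]"
    if "d_eq A 1 \<alpha> \<beta>" "X \<in> vfields A" "Y \<in> vfields A" for \<alpha> \<beta> X Y p
    using that unfolding d_eq_def eval_form_def by simp
  interpret qc_coframe A \<theta> e Q
  proof (unfold_locales)
    show "smooth_atlas A" by (rule atlas)
    show "finite {1..7::nat}" "card {1..7::nat} = DIM(real ^ 7)" by simp_all
    show "one_form A (\<theta> i)" if "i \<in> {1..7}" for i using that by (rule one)
    show "e j \<in> vfields A" if "j \<in> {1..7}" for j using that by (rule ev)
    show "\<theta> i p [e j p] = (if i = j then 1 else 0)" if "i \<in> {1..7}" "j \<in> {1..7}" for i j p
      using dual that by blast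
    show "ext_d A (\<theta> k) [X, Y] p = structure_form k (\<lambda>i. \<theta> i p [X p]) (\<lambda>i. \<theta> i p [Y p])"
      if k: "k \<in> {1..7}" and X: "X \<in> vfields A" and Y: "Y \<in> vfields A" for k X Y p
      using cases_1_7[OF k] d[THEN dd, OF X Y, of p]
      by (elim disjE) (simp_all add: structure_form_def w_eval)
    show "qc_eta Q r = \<theta> (4 + r)" "qc_xi Q r = e (4 + r)" if "r \<in> {1..3}" for r
      using bspec[OF eta_xi that] by simp_all
    show "qc_H Q p = tspan {1..4} (\<lambda>a. e a p)" for p using H by blast
    show "inner_product_on (qc_H Q p) (qc_g Q p)" "orthonormal_basis_at Q p (\<lambda>a. e a p)" for p
      using g by blast+
    show "qc_I Q r p v \<in> qc_H Q p" if "r \<in> {1..3}" "v \<in> qc_H Q p" for r v p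
      using I that by blast
    show "omega Q r p [v, x] = kaehler_form r (\<lambda>i. \<theta> i p [v]) (\<lambda>i. \<theta> i p [x])"
      if r: "r \<in> {1..3}" and v: "v \<in> tangent_space A p" and x: "x \<in> tangent_space A p" for r v x p
      using cases_1_3[OF r] bspec[OF bspec[OF spec[OF om, of p] v] x]
      by (elim disjE) (simp_all add: kaehler_form_def w_eval)
  qed
  show ?thesis
    using integrable fund_form_closed nabla_biquard biquard_torsion_nonzero biquard_scal by blast
qed

end
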